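(* Let $\mathfrak{Q}'$ be the theory defined in the context below. For every consistent, recursively enumerable theory $T$ in the language of arithmetic with $\mathfrak{Q}' \subseteq T$ (where $T$ is presented by a $\Sigma_1$-formula defining its set of axioms, from which $\mathsf{Pr}_T$ is built), we have $T \nvdash \mathsf{Con}(T)$.
   Context: Work in a first-order language of arithmetic such as $\{0,S,+,\times,\leqslant\}$, with a fixed standard G\"odel numbering; $\ulcorner\alpha\urcorner$ denotes the numeral of the G\"odel number of $\alpha$. $\Sigma_1$-formulas are those built from bounded ($\Sigma_0$) formulas by existential quantification, closed under conjunction, disjunction, existential quantifiers and bounded universal quantifiers. ${\tt Q}$ denotes Robinson's Arithmetic: the finitely axiomatized theory consisting of the axioms of Peano Arithmetic without induction, plus $\forall x\exists y[x=0\vee x=S(y)]$. An r.e. theory $U$ is given by a $\Sigma_1$-formula defining (the G\"odel numbers of) its axioms; $\mathsf{Pr}_U(x)$ is the standard $\Sigma_1$ provability predicate $\exists y\,\mathsf{Proof}_U(x,y)$ built from it, expressing ``$x$ is the G\"odel number of a sentence provable in $U$''. $\bot$ is a fixed contradictory sentence (e.g. $0\neq 0$) and $\mathsf{Con}(U)$ is $\neg\mathsf{Pr}_U(\ulcorner\bot\urcorner)$. A theory $U$ extends (contains) ${\tt Q}$ when $U$ proves every axiom of ${\tt Q}$. Define $\mathfrak{Q}' = {\tt Q} \cup \{\mathsf{Pr}_U(\ulcorner\varphi\rightarrow\psi\urcorner)\rightarrow[\mathsf{Pr}_U(\ulcorner\varphi\urcorner)\rightarrow\mathsf{Pr}_U(\ulcorner\psi\urcorner)]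 : U \text{ an r.e. theory}, \varphi,\psi \text{ sentences}\} \cup \{\sigma\rightarrow\mathsf{Pr}_U(\ulcorner\sigma\urcorner) : \sigma \text{ a } \Sigma_1\text{-sentence}, U \supseteq {\tt Q} \text{ an r.e. theory}\}$. *)

theory Defs
  imports Main
begin

section \<open>The language of arithmetic\<close>

datatype trm =
    Zer                (\<open>\<^bold>0\<close>)
  | Vr nat
  | Scc trm
  | Pls trm trm        (infixl \<open>\<^bold>+\<close> 65)
  | Tms trm trm        (infixl \<open>\<^bold>*\<close> 70)

datatype fm =
    Eql trm trm        (infix \<open>\<^bold>=\<close> 50)
  | Leq trm trm        (infix \<open>\<^bold>\<le>\<close> 50)
  | Neg fm             (\<open>\<^bold>\<not> _\<close> [40] 40)
  | Imp fm fm          (infixr \<open>\<^bold>\<rightarrow>\<close> 25)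
  | Forall nat fm

abbreviation Con :: "fm \<Rightarrow> fm \<Rightarrow> fm" (infixr \<open>\<^bold>\<and>\<close> 35)
  where "\<phi> \<^bold>\<and> \<psi> \<equiv> \<^bold>\<not> (\<phi> \<^bold>\<rightarrow> \<^bold>\<not> \<psi>)"

abbreviation Dis :: "fm \<Rightarrow> fm \<Rightarrow> fm" (infixr \<open>\<^bold>\<or>\<close> 30)
  where "\<phi> \<^bold>\<or> \<psi> \<equiv> \<^bold>\<not> \<phi> \<^bold>\<rightarrow> \<psi>"

abbreviation Iff :: "fm \<Rightarrow> fm \<Rightarrow> fm" (infixr \<open>\<^bold>\<leftrightarrow>\<close> 25)
  where "\<phi> \<^bold>\<leftrightarrow> \<psi> \<equiv> (\<phi> \<^bold>\<rightarrow> \<psi>) \<^bold>\<and> (\<psi> \<^bold>\<rightarrow> \<phi>)"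

abbreviation Exists :: "nat \<Rightarrow> fm \<Rightarrow> fm"
  where "Exists x \<phi> \<equiv> \<^bold>\<not> Forall x (\<^bold>\<not> \<phi>)"

abbreviation BForall :: "nat \<Rightarrow> trm \<Rightarrow> fm \<Rightarrow> fm"
  where "BForall x t \<phi> \<equiv> Forall x (Vr x \<^bold>\<le> t \<^bold>\<rightarrow> \<phi>)"

abbreviation BExists :: "nat \<Rightarrow> trm \<Rightarrow> fm \<Rightarrow> fm"
  where "BExists x t \<phi> \<equiv> Exists x (Vr x \<^bold>\<le> t \<^bold>\<and> \<phi>)"

abbreviation Falsum :: fm (\<open>\<^bold>\<bottom>\<close>)
  where "\<^bold>\<bottom> \<equiv> \<^bold>\<not> (\<^bold>0 \<^bold>= \<^bold>0)"

primrec num :: "nat \<Rightarrow> trm" where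
  "num 0 = \<^bold>0"
| "num (Suc n) = Scc (num n)"

primrec fvt :: "trm \<Rightarrow> nat set" where
  "fvt \<^bold>0 = {}"
| "fvt (Vr x) = {x}"
| "fvt (Scc s) = fvt s"
| "fvt (s \<^bold>+ t) = fvt s \<union> fvt t"
| "fvt (s \<^bold>* t) = fvt s \<union> fvt t"

primrec fv :: "fm \<Rightarrow> nat set" where
  "fv (s \<^bold>= t) = fvt s \<union> fvt t"
| "fv (s \<^bold>\<le> t) = fvt s \<union> fvt t"
| "fv (\<^bold>\<not> \<phi>) = fv \<phi>"
| "fv (\<phi> \<^bold>\<rightarrow> \<psi>) = fv \<phi> \<union> fv \<psi>"
| "fv (Forall x \<phi>) = fv \<phi> - {x}"

definition sentence :: "fm \<Rightarrow> bool"
  where "sentence \<phi> \<longleftrightarrow> fv \<phi> = {}"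

primrec substt :: "trm \<Rightarrow> nat \<Rightarrow> trm \<Rightarrow> trm" where
  "substt \<^bold>0 x t = \<^bold>0"
| "substt (Vr y) x t = (if y = x then t else Vr y)"
| "substt (Scc s) x t = Scc (substt s x t)"
| "substt (r \<^bold>+ s) x t = substt r x t \<^bold>+ substt s x t"
| "substt (r \<^bold>* s) x t = substt r x t \<^bold>* substt s x t"

text \<open>Substitution for free occurrences; bound variables are never renamed, see \<open>free_for\<close>.\<close>

primrec subst :: "fm \<Rightarrow> nat \<Rightarrow> trm \<Rightarrow> fm" where
  "subst (r \<^bold>= s) x t = (substt r x t \<^bold>= substt s x t)"
| "subst (r \<^bold>\<le> s) x t = (substt r x t \<^bold>\<le> substt s x t)"
| "subst (\<^bold>\<not> \<phi>) x t = (\<^bold>\<not> subst \<phi> x t)"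
| "subst (\<phi> \<^bold>\<rightarrow> \<psi>) x t = (subst \<phi> x t \<^bold>\<rightarrow> subst \<psi> x t)"
| "subst (Forall y \<phi>) x t = (if y = x then Forall y \<phi> else Forall y (subst \<phi> x t))"

primrec free_for :: "trm \<Rightarrow> nat \<Rightarrow> fm \<Rightarrow> bool" where
  "free_for t x (r \<^bold>= s) \<longleftrightarrow> True"
| "free_for t x (r \<^bold>\<le> s) \<longleftrightarrow> True"
| "free_for t x (\<^bold>\<not> \<phi>) \<longleftrightarrow> free_for t x \<phi>"
| "free_for t x (\<phi> \<^bold>\<rightarrow> \<psi>) \<longleftrightarrow> free_for t x \<phi> \<and> free_for t x \<psi>"
| "free_for t x (Forall y \<phi>) \<longleftrightarrow> x \<notin> fv (Forall y \<phi>) \<or> y \<notin> fvt t \<and> free_for t x \<phi>"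

inductive sigma0 :: "fm \<Rightarrow> bool" where
  "sigma0 (s \<^bold>= t)"
| "sigma0 (s \<^bold>\<le> t)"
| "sigma0 \<phi> \<Longrightarrow> sigma0 (\<^bold>\<not> \<phi>)"
| "sigma0 \<phi> \<Longrightarrow> sigma0 \<psi> \<Longrightarrow> sigma0 (\<phi> \<^bold>\<rightarrow> \<psi>)"
| "sigma0 \<phi> \<Longrightarrow> x \<notin> fvt t \<Longrightarrow> sigma0 (BForall x t \<phi>)"
| "sigma0 \<phi> \<Longrightarrow> x \<notin> fvt t \<Longrightarrow> sigma0 (BExists x t \<phi>)"

inductive sigma1 :: "fm \<Rightarrow> bool" where
  "sigma0 \<phi> \<Longrightarrow> sigma1 \<phi>"
| "sigma1 \<phi> \<Longrightarrow> sigma1 \<psi> \<Longrightarrow> sigma1 (\<phi> \<^bold>\<and> \<psi>)"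
| "sigma1 \<phi> \<Longrightarrow> sigma1 \<psi> \<Longrightarrow> sigma1 (\<phi> \<^bold>\<or> \<psi>)"
| "sigma1 \<phi> \<Longrightarrow> sigma1 (Exists x \<phi>)"
| "sigma1 \<phi> \<Longrightarrow> x \<notin> fvt t \<Longrightarrow> sigma1 (BForall x t \<phi>)"

section \<open>The standard model\<close>

primrec evalt :: "(nat \<Rightarrow> nat) \<Rightarrow> trm \<Rightarrow> nat" where
  "evalt e \<^bold>0 = 0"
| "evalt e (Vr x) = e x"
| "evalt e (Scc s) = Suc (evalt e s)"
| "evalt e (s \<^bold>+ t) = evalt e s + evalt e t"
| "evalt e (s \<^bold>* t) = evalt e s * evalt e t"

primrec sat :: "(nat \<Rightarrow> nat) \<Rightarrow> fm \<Rightarrow> bool" where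
  "sat e (s \<^bold>= t) \<longleftrightarrow> evalt e s = evalt e t"
| "sat e (s \<^bold>\<le> t) \<longleftrightarrow> evalt e s \<le> evalt e t"
| "sat e (\<^bold>\<not> \<phi>) \<longleftrightarrow> \<not> sat e \<phi>"
| "sat e (\<phi> \<^bold>\<rightarrow> \<psi>) \<longleftrightarrow> (sat e \<phi> \<longrightarrow> sat e \<psi>)"
| "sat e (Forall x \<phi>) \<longleftrightarrow> (\<forall>n. sat (e(x := n)) \<phi>)"

section \<open>First-order provability\<close>

definition equality_axioms :: "fm list" where
  "equality_axioms =
    [Vr 0 \<^bold>= Vr 0,
     Vr 0 \<^bold>= Vr 1 \<^bold>\<rightarrow> Vr 0 \<^bold>= Vr 2 \<^bold>\<rightarrow> Vr 1 \<^bold>= Vr 2,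
     Vr 0 \<^bold>= Vr 1 \<^bold>\<rightarrow> Scc (Vr 0) \<^bold>= Scc (Vr 1),
     Vr 0 \<^bold>= Vr 1 \<^bold>\<rightarrow> Vr 2 \<^bold>= Vr 3 \<^bold>\<rightarrow> Vr 0 \<^bold>+ Vr 2 \<^bold>= Vr 1 \<^bold>+ Vr 3,
     Vr 0 \<^bold>= Vr 1 \<^bold>\<rightarrow> Vr 2 \<^bold>= Vr 3 \<^bold>\<rightarrow> Vr 0 \<^bold>* Vr 2 \<^bold>= Vr 1 \<^bold>* Vr 3,
     Vr 0 \<^bold>= Vr 1 \<^bold>\<rightarrow> Vr 2 \<^bold>= Vr 3 \<^bold>\<rightarrow> Vr 0 \<^bold>\<le> Vr 2 \<^bold>\<rightarrow> Vr 1 \<^bold>\<le> Vr 3]"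

inductive logical_axiom :: "fm \<Rightarrow> bool" where
  "logical_axiom (\<phi> \<^bold>\<rightarrow> \<psi> \<^bold>\<rightarrow> \<phi>)"
| "logical_axiom ((\<phi> \<^bold>\<rightarrow> \<psi> \<^bold>\<rightarrow> \<chi>) \<^bold>\<rightarrow> (\<phi> \<^bold>\<rightarrow> \<psi>) \<^bold>\<rightarrow> \<phi> \<^bold>\<rightarrow> \<chi>)"
| "logical_axiom ((\<^bold>\<not> \<phi> \<^bold>\<rightarrow> \<^bold>\<not> \<psi>) \<^bold>\<rightarrow> \<psi> \<^bold>\<rightarrow> \<phi>)"
| "free_for t x \<phi> \<Longrightarrow> logical_axiom (Forall x \<phi> \<^bold>\<rightarrow> subst \<phi> x t)"
| "x \<notin> fv \<phi> \<Longrightarrow> logical_axiom (Forall x (\<phi> \<^bold>\<rightarrow> \<psi>) \<^bold>\<rightarrow> \<phi> \<^bold>\<rightarrow> Forall x \<psi>)"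
| "\<phi> \<in> set equality_axioms \<Longrightarrow> logical_axiom \<phi>"

inductive prv :: "fm set \<Rightarrow> fm \<Rightarrow> bool" (infix \<open>\<tturnstile>\<close> 20) for U :: "fm set" where
  nonlogical: "\<phi> \<in> U \<Longrightarrow> U \<tturnstile> \<phi>"
| logical: "logical_axiom \<phi> \<Longrightarrow> U \<tturnstile> \<phi>"
| modus_ponens: "U \<tturnstile> \<phi> \<Longrightarrow> U \<tturnstile> (\<phi> \<^bold>\<rightarrow> \<psi>) \<Longrightarrow> U \<tturnstile> \<psi>"
| generalization: "U \<tturnstile> \<phi> \<Longrightarrow> U \<tturnstile> Forall x \<phi>"

definition consistent :: "fm set \<Rightarrow> bool"
  where "consistent U \<longleftrightarrow> \<not> (\<exists>\<phi>. (U \<tturnstile> \<phi>) \<and> (U \<tturnstile> \<^bold>\<not> \<phi>))"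

definition extends :: "fm set \<Rightarrow> fm set \<Rightarrow> bool"
  where "extends U V \<longleftrightarrow> (\<forall>\<phi> \<in> V. U \<tturnstile> \<phi>)"

definition Robinson_Q :: "fm set" where
  "Robinson_Q =
    {Forall 0 (\<^bold>\<not> (Scc (Vr 0) \<^bold>= \<^bold>0)),
     Forall 0 (Forall 1 (Scc (Vr 0) \<^bold>= Scc (Vr 1) \<^bold>\<rightarrow> Vr 0 \<^bold>= Vr 1)),
     Forall 0 (Vr 0 \<^bold>+ \<^bold>0 \<^bold>= Vr 0),
     Forall 0 (Forall 1 (Vr 0 \<^bold>+ Scc (Vr 1) \<^bold>= Scc (Vr 0 \<^bold>+ Vr 1))),
     Forall 0 (Vr 0 \<^bold>* \<^bold>0 \<^bold>= \<^bold>0),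
     Forall 0 (Forall 1 (Vr 0 \<^bold>* Scc (Vr 1) \<^bold>= Vr 0 \<^bold>* Vr 1 \<^bold>+ Vr 0)),
     Forall 0 (Forall 1 (Vr 0 \<^bold>\<le> Vr 1 \<^bold>\<leftrightarrow> Exists 2 (Vr 2 \<^bold>+ Vr 0 \<^bold>= Vr 1))),
     Forall 0 (Exists 1 (Vr 0 \<^bold>= \<^bold>0 \<^bold>\<or> Vr 0 \<^bold>= Scc (Vr 1)))}"

section \<open>Goedel numbering\<close>

text \<open>An injective pairing given by a term of the language, so that the codes of compound
  expressions are given by terms as well.\<close>

definition pair :: "nat \<Rightarrow> nat \<Rightarrow> nat"
  where "pair a b = (a + b) * (a + b) + a"

primrec gnt :: "trm \<Rightarrow> nat" where
  "gnt \<^bold>0 = pair 0 0"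
| "gnt (Vr x) = pair 1 x"
| "gnt (Scc s) = pair 2 (gnt s)"
| "gnt (s \<^bold>+ t) = pair 3 (pair (gnt s) (gnt t))"
| "gnt (s \<^bold>* t) = pair 4 (pair (gnt s) (gnt t))"

primrec gn :: "fm \<Rightarrow> nat" where
  "gn (s \<^bold>= t) = pair 5 (pair (gnt s) (gnt t))"
| "gn (s \<^bold>\<le> t) = pair 6 (pair (gnt s) (gnt t))"
| "gn (\<^bold>\<not> \<phi>) = pair 7 (gn \<phi>)"
| "gn (\<phi> \<^bold>\<rightarrow> \<psi>) = pair 8 (pair (gn \<phi>) (gn \<psi>))"
| "gn (Forall x \<phi>) = pair 9 (pair x (gn \<phi>))"

definition goedel_numeral :: "fm \<Rightarrow> trm" (\<open>\<ulcorner>_\<urcorner>\<close>)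
  where "\<ulcorner>\<phi>\<urcorner> = num (gn \<phi>)"

definition pairT :: "trm \<Rightarrow> trm \<Rightarrow> trm"
  where "pairT s t = (s \<^bold>+ t) \<^bold>* (s \<^bold>+ t) \<^bold>+ s"

abbreviation zerT :: trm where "zerT \<equiv> pairT (num 0) (num 0)"
abbreviation vrT :: "trm \<Rightarrow> trm" where "vrT x \<equiv> pairT (num 1) x"
abbreviation sccT :: "trm \<Rightarrow> trm" where "sccT a \<equiv> pairT (num 2) a"
abbreviation plsT :: "trm \<Rightarrow> trm \<Rightarrow> trm" where "plsT a b \<equiv> pairT (num 3) (pairT a b)"
abbreviation tmsT :: "trm \<Rightarrow> trm \<Rightarrow> trm" where "tmsT a b \<equiv> pairT (num 4) (pairT a b)"
abbreviation eqlT :: "trm \<Rightarrow> trm \<Rightarrow> trm" where "eqlT a b \<equiv> pairT (num 5) (pairT a b)"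
abbreviation leqT :: "trm \<Rightarrow> trm \<Rightarrow> trm" where "leqT a b \<equiv> pairT (num 6) (pairT a b)"
abbreviation negT :: "trm \<Rightarrow> trm" where "negT a \<equiv> pairT (num 7) a"
abbreviation impT :: "trm \<Rightarrow> trm \<Rightarrow> trm" where "impT a b \<equiv> pairT (num 8) (pairT a b)"
abbreviation forallT :: "trm \<Rightarrow> trm \<Rightarrow> trm" where "forallT x a \<equiv> pairT (num 9) (pairT x a)"

section \<open>Arithmetization of syntax\<close>

text \<open>The formulas below are schematic in terms (usually variables) which must avoid the bound
  variables of the schema.  Those are 1 and 2 for the coding of sequences, 3 for \<open>sentenceF\<close>, and
  for the remaining schemas pairwise disjoint blocks of ten starting at 10, 20, and so on.
  Variable 0 is reserved for the argument of a formula with one free variable.\<close>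

text \<open>Goedel's beta function: \<open>z\<close> is the remainder of \<open>c\<close> modulo \<open>1 + (i + 1) * d\<close>.  The numbers
  \<open>c\<close>, \<open>d\<close>, \<open>n\<close> code the sequence of the values for \<open>i = 0, \<dots>, n\<close>.\<close>

definition betaF :: "trm \<Rightarrow> trm \<Rightarrow> trm \<Rightarrow> trm \<Rightarrow> fm" where
  "betaF c d i z =
    (Exists 1 (c \<^bold>= Vr 1 \<^bold>* Scc (Scc i \<^bold>* d) \<^bold>+ z) \<^bold>\<and> z \<^bold>\<le> Scc i \<^bold>* d)"

definition earlierF :: "trm \<Rightarrow> trm \<Rightarrow> trm \<Rightarrow> trm \<Rightarrow> fm" where
  "earlierF c d i w = Exists 2 (Scc (Vr 2) \<^bold>\<le> i \<^bold>\<and> betaF c d (Vr 2) w)"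

text \<open>Every entry of the sequence coded by \<open>c\<close>, \<open>d\<close>, \<open>n\<close> is justified by \<open>step E z\<close>, where \<open>E w\<close>
  says that \<open>w\<close> occurs earlier in the sequence and \<open>z\<close> is the entry.\<close>

definition seqF :: "nat \<Rightarrow> ((trm \<Rightarrow> fm) \<Rightarrow> trm \<Rightarrow> fm) \<Rightarrow> trm \<Rightarrow> trm \<Rightarrow> trm \<Rightarrow> fm" where
  "seqF k step c d n =
    BForall k n (Exists (k + 1)
      (betaF c d (Vr k) (Vr (k + 1)) \<^bold>\<and> step (earlierF c d (Vr k)) (Vr (k + 1))))"

definition constructibleF :: "nat \<Rightarrow> ((trm \<Rightarrow> fm) \<Rightarrow> trm \<Rightarrow> fm) \<Rightarrow> trm \<Rightarrow> fm" where
  "constructibleF k step x =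
    Exists k (Exists (k + 1) (Exists (k + 2)
      (betaF (Vr k) (Vr (k + 1)) (Vr (k + 2)) x \<^bold>\<and>
       seqF (k + 3) step (Vr k) (Vr (k + 1)) (Vr (k + 2)))))"

definition termF :: "trm \<Rightarrow> fm" where
  "termF = constructibleF 10 (\<lambda>E z.
      z \<^bold>= zerT
    \<^bold>\<or> Exists 15 (z \<^bold>= vrT (Vr 15))
    \<^bold>\<or> Exists 15 (E (Vr 15) \<^bold>\<and> z \<^bold>= sccT (Vr 15))
    \<^bold>\<or> Exists 15 (Exists 16 (E (Vr 15) \<^bold>\<and> E (Vr 16) \<^bold>\<and>
        (z \<^bold>= plsT (Vr 15) (Vr 16) \<^bold>\<or> z \<^bold>= tmsT (Vr 15) (Vr 16)))))"

definition formulaF :: "trm \<Rightarrow> fm" where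
  "formulaF = constructibleF 20 (\<lambda>E z.
      Exists 25 (Exists 26 (termF (Vr 25) \<^bold>\<and> termF (Vr 26) \<^bold>\<and>
        (z \<^bold>= eqlT (Vr 25) (Vr 26) \<^bold>\<or> z \<^bold>= leqT (Vr 25) (Vr 26))))
    \<^bold>\<or> Exists 25 (E (Vr 25) \<^bold>\<and> z \<^bold>= negT (Vr 25))
    \<^bold>\<or> Exists 25 (Exists 26 (E (Vr 25) \<^bold>\<and> E (Vr 26) \<^bold>\<and> z \<^bold>= impT (Vr 25) (Vr 26)))
    \<^bold>\<or> Exists 25 (Exists 26 (E (Vr 26) \<^bold>\<and> z \<^bold>= forallT (Vr 25) (Vr 26))))"

text \<open>The variable with index \<open>x\<close> does not occur in the term coded by the second argument.\<close>

definition not_in_termF :: "trm \<Rightarrow> trm \<Rightarrow> fm" where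
  "not_in_termF x = constructibleF 30 (\<lambda>E z.
      z \<^bold>= zerT
    \<^bold>\<or> Exists 35 (\<^bold>\<not> (Vr 35 \<^bold>= x) \<^bold>\<and> z \<^bold>= vrT (Vr 35))
    \<^bold>\<or> Exists 35 (E (Vr 35) \<^bold>\<and> z \<^bold>= sccT (Vr 35))
    \<^bold>\<or> Exists 35 (Exists 36 (E (Vr 35) \<^bold>\<and> E (Vr 36) \<^bold>\<and>
        (z \<^bold>= plsT (Vr 35) (Vr 36) \<^bold>\<or> z \<^bold>= tmsT (Vr 35) (Vr 36)))))"

text \<open>The variable with index \<open>x\<close> is not free in the formula coded by the second argument.\<close>

definition not_freeF :: "trm \<Rightarrow> trm \<Rightarrow> fm" where
  "not_freeF x = constructibleF 40 (\<lambda>E z.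
      Exists 45 (Exists 46 (not_in_termF x (Vr 45) \<^bold>\<and> not_in_termF x (Vr 46) \<^bold>\<and>
        (z \<^bold>= eqlT (Vr 45) (Vr 46) \<^bold>\<or> z \<^bold>= leqT (Vr 45) (Vr 46))))
    \<^bold>\<or> Exists 45 (E (Vr 45) \<^bold>\<and> z \<^bold>= negT (Vr 45))
    \<^bold>\<or> Exists 45 (Exists 46 (E (Vr 45) \<^bold>\<and> E (Vr 46) \<^bold>\<and> z \<^bold>= impT (Vr 45) (Vr 46)))
    \<^bold>\<or> Exists 45 (Exists 46 (E (Vr 46) \<^bold>\<and> z \<^bold>= forallT (Vr 45) (Vr 46)))
    \<^bold>\<or> Exists 46 (formulaF (Vr 46) \<^bold>\<and> z \<^bold>= forallT x (Vr 46)))"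

definition sentenceF :: "trm \<Rightarrow> fm" where
  "sentenceF x = (formulaF x \<^bold>\<and> BForall 3 x (not_freeF (Vr 3) x))"

text \<open>\<open>subst_termF x t (pairT r r')\<close>: substituting the term \<open>t\<close> for the variable with index \<open>x\<close> turns
  the term \<open>r\<close> into \<open>r'\<close>; similarly \<open>substF\<close> for formulas, where \<open>t\<close> moreover has to be free for
  the variable.\<close>

definition subst_termF :: "trm \<Rightarrow> trm \<Rightarrow> trm \<Rightarrow> fm" where
  "subst_termF x t = constructibleF 50 (\<lambda>E z.
      z \<^bold>= pairT zerT zerT
    \<^bold>\<or> z \<^bold>= pairT (vrT x) t
    \<^bold>\<or> Exists 55 (\<^bold>\<not> (Vr 55 \<^bold>= x) \<^bold>\<and> z \<^bold>= pairT (vrT (Vr 55)) (vrT (Vr 55)))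
    \<^bold>\<or> Exists 55 (Exists 56 (E (pairT (Vr 55) (Vr 56)) \<^bold>\<and>
        z \<^bold>= pairT (sccT (Vr 55)) (sccT (Vr 56))))
    \<^bold>\<or> Exists 55 (Exists 56 (Exists 57 (Exists 58
        (E (pairT (Vr 55) (Vr 56)) \<^bold>\<and> E (pairT (Vr 57) (Vr 58)) \<^bold>\<and>
         (z \<^bold>= pairT (plsT (Vr 55) (Vr 57)) (plsT (Vr 56) (Vr 58)) \<^bold>\<or>
          z \<^bold>= pairT (tmsT (Vr 55) (Vr 57)) (tmsT (Vr 56) (Vr 58))))))))"

definition substF :: "trm \<Rightarrow> trm \<Rightarrow> trm \<Rightarrow> fm" where
  "substF x t = constructibleF 60 (\<lambda>E z.
      Exists 65 (Exists 66 (Exists 67 (Exists 68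
        (subst_termF x t (pairT (Vr 65) (Vr 66)) \<^bold>\<and> subst_termF x t (pairT (Vr 67) (Vr 68)) \<^bold>\<and>
         (z \<^bold>= pairT (eqlT (Vr 65) (Vr 67)) (eqlT (Vr 66) (Vr 68)) \<^bold>\<or>
          z \<^bold>= pairT (leqT (Vr 65) (Vr 67)) (leqT (Vr 66) (Vr 68)))))))
    \<^bold>\<or> Exists 65 (Exists 66 (E (pairT (Vr 65) (Vr 66)) \<^bold>\<and>
        z \<^bold>= pairT (negT (Vr 65)) (negT (Vr 66))))
    \<^bold>\<or> Exists 65 (Exists 66 (Exists 67 (Exists 68
        (E (pairT (Vr 65) (Vr 66)) \<^bold>\<and> E (pairT (Vr 67) (Vr 68)) \<^bold>\<and>
         z \<^bold>= pairT (impT (Vr 65) (Vr 67)) (impT (Vr 66) (Vr 68))))))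
    \<^bold>\<or> Exists 65 (Exists 66 (not_freeF x (forallT (Vr 65) (Vr 66)) \<^bold>\<and>
        z \<^bold>= pairT (forallT (Vr 65) (Vr 66)) (forallT (Vr 65) (Vr 66))))
    \<^bold>\<or> Exists 65 (Exists 66 (Exists 67
        (\<^bold>\<not> (Vr 65 \<^bold>= x) \<^bold>\<and> not_in_termF (Vr 65) t \<^bold>\<and> E (pairT (Vr 66) (Vr 67)) \<^bold>\<and>
         z \<^bold>= pairT (forallT (Vr 65) (Vr 66)) (forallT (Vr 65) (Vr 67))))))"

definition logical_axiomF :: "trm \<Rightarrow> fm" where
  "logical_axiomF z =
   (  Exists 70 (Exists 71 (formulaF (Vr 70) \<^bold>\<and> formulaF (Vr 71) \<^bold>\<and>
        z \<^bold>= impT (Vr 70) (impT (Vr 71) (Vr 70))))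
    \<^bold>\<or> Exists 70 (Exists 71 (Exists 72 (formulaF (Vr 70) \<^bold>\<and> formulaF (Vr 71) \<^bold>\<and> formulaF (Vr 72) \<^bold>\<and>
        z \<^bold>= impT (impT (Vr 70) (impT (Vr 71) (Vr 72)))
                 (impT (impT (Vr 70) (Vr 71)) (impT (Vr 70) (Vr 72))))))
    \<^bold>\<or> Exists 70 (Exists 71 (formulaF (Vr 70) \<^bold>\<and> formulaF (Vr 71) \<^bold>\<and>
        z \<^bold>= impT (impT (negT (Vr 70)) (negT (Vr 71))) (impT (Vr 71) (Vr 70))))
    \<^bold>\<or> Exists 70 (Exists 71 (Exists 72 (Exists 73
        (termF (Vr 71) \<^bold>\<and> substF (Vr 70) (Vr 71) (pairT (Vr 72) (Vr 73)) \<^bold>\<and>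
         z \<^bold>= impT (forallT (Vr 70) (Vr 72)) (Vr 73)))))
    \<^bold>\<or> Exists 70 (Exists 71 (Exists 72 (not_freeF (Vr 70) (Vr 71) \<^bold>\<and> formulaF (Vr 72) \<^bold>\<and>
        z \<^bold>= impT (forallT (Vr 70) (impT (Vr 71) (Vr 72)))
                 (impT (Vr 71) (forallT (Vr 70) (Vr 72))))))
    \<^bold>\<or> foldr Dis (map (\<lambda>\<phi>. z \<^bold>= \<ulcorner>\<phi>\<urcorner>) equality_axioms) \<^bold>\<bottom>)"

text \<open>\<open>proofF \<alpha> x y\<close>: the number \<open>y\<close> codes a proof of the sentence \<open>x\<close> from the axioms defined by
  \<open>\<alpha>\<close>, a formula whose only free variable is 0.  The formula \<open>\<alpha>\<close> applied to the term \<open>z\<close> is written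
  as \<open>Exists 0 (Vr 0 \<^bold>= z \<^bold>\<and> \<alpha>)\<close>, which avoids a capture of \<open>z\<close> by the quantifiers of \<open>\<alpha>\<close>.\<close>

definition proofF :: "fm \<Rightarrow> trm \<Rightarrow> trm \<Rightarrow> fm" where
  "proofF \<alpha> x y =
    (sentenceF x \<^bold>\<and>
     Exists 80 (Exists 81 (Exists 82
       (y \<^bold>= pairT (Vr 80) (pairT (Vr 81) (Vr 82)) \<^bold>\<and>
        betaF (Vr 80) (Vr 81) (Vr 82) x \<^bold>\<and>
        seqF 83
          (\<lambda>E z.
              logical_axiomF z
            \<^bold>\<or> Exists 0 (Vr 0 \<^bold>= z \<^bold>\<and> \<alpha>)
            \<^bold>\<or> Exists 85 (E (Vr 85) \<^bold>\<and> E (impT (Vr 85) z))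
            \<^bold>\<or> Exists 85 (Exists 86 (E (Vr 86) \<^bold>\<and> z \<^bold>= forallT (Vr 85) (Vr 86))))
          (Vr 80) (Vr 81) (Vr 82)))))"

definition provableF :: "fm \<Rightarrow> fm" where
  "provableF \<alpha> = Exists 90 (proofF \<alpha> (Vr 0) (Vr 90))"

section \<open>R.e. theories, provability and consistency sentences\<close>

definition presents :: "fm \<Rightarrow> fm set \<Rightarrow> bool" where
  "presents \<alpha> U \<longleftrightarrow>
    sigma1 \<alpha> \<and> fv \<alpha> \<subseteq> {0} \<and> (\<forall>\<phi> \<in> U. sentence \<phi>) \<and>
    (\<forall>e. sat e \<alpha> \<longleftrightarrow> e 0 \<in> gn ` U)"

definition Pr :: "fm \<Rightarrow> fm \<Rightarrow> fm"
  where "Pr \<alpha> \<phi> = subst (provableF \<alpha>) 0 \<ulcorner>\<phi>\<urcorner>"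

definition Consis :: "fm \<Rightarrow> fm"
  where "Consis \<alpha> = (\<^bold>\<not> Pr \<alpha> \<^bold>\<bottom>)"

definition Q_prime :: "fm set" where
  "Q_prime = Robinson_Q
    \<union> {Pr \<alpha> (\<phi> \<^bold>\<rightarrow> \<psi>) \<^bold>\<rightarrow> Pr \<alpha> \<phi> \<^bold>\<rightarrow> Pr \<alpha> \<psi> | \<alpha> U \<phi> \<psi>.
         presents \<alpha> U \<and> sentence \<phi> \<and> sentence \<psi>}
    \<union> {\<sigma> \<^bold>\<rightarrow> Pr \<alpha> \<sigma> | \<alpha> U \<sigma>.
         presents \<alpha> U \<and> extends U Robinson_Q \<and> sentence \<sigma> \<and> sigma1 \<sigma>}"

end

theory Submission
  imports Defs "HOL-Number_Theory.Cong"
begin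

text \<open>The second and third derivability conditions are axioms of the theory, so Loeb's argument needs
  only two further ingredients.  The first one is closure under necessitation: a proof is coded with
  Goedel's beta function, hence the \<open>\<Sigma>\<^sub>1\<close>-sentence \<open>Pr \<alpha> \<phi>\<close> is true, and Robinson arithmetic proves
  every true \<open>\<Sigma>\<^sub>1\<close>-sentence.  The second one is a sentence \<open>G\<close> that is provably equivalent to \<open>\<^bold>\<not> Pr \<tau> G\<close>.
  As Robinson arithmetic has no induction, the diagonal function is represented by a \<open>\<Sigma>\<^sub>0\<close>-formula with
  a bound \<open>v\<close> on the computation, together with the requirement that no computation below \<open>v\<close> has
  another value; comparability of \<open>v\<close> with numerals then yields provable uniqueness.\<close>

section \<open>Substitution\<close>

text \<open>The predicates for syntax and provability are verified in one direction: genuine terms,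
  substitutions and derivations make the corresponding formulas true in the standard model. Bound
  variables are never renamed, so instantiating a formula by open terms may capture them. Truth is
  therefore turned into provability through environments: an instance of a formula puts the numeral
  \<open>num (e x)\<close> for every free variable, and numerals are closed.

  The diagonal sentence is not obtained by substituting a numeral but has the form
  \<open>Forall 1 (...)\<close>, which equates \<open>Vr 1\<close> with the numeral before stating
  the matrix. As pairing is a term of the language, its code is a term in the code of the matrix and
  the code of that numeral. The only recursion left to formalize is the one sending \<open>n\<close>
  to the code of \<open>num n\<close>.

  The third derivability condition is applied to a provability sentence, so \<open>Pr\<close> has to
  be Sigma_1 in the sense of the inductive definition, and not merely up to equivalence.\<close>

lemma fvt_num [simp]: "fvt (num n) = {}"
  by (induction n) auto

lemma evalt_num [simp]: "evalt e (num n) = n"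
  by (induction n) auto

lemma substt_num [simp]: "substt (num n) x t = num n"
  by (induction n) auto

lemma substt_idle: "x \<notin> fvt s \<Longrightarrow> substt s x t = s"
  by (induction s) auto

lemma subst_idle: "x \<notin> fv \<phi> \<Longrightarrow> subst \<phi> x t = \<phi>"
  by (induction \<phi>) (auto simp: substt_idle)

lemma substt_Vr [simp]: "substt s x (Vr x) = s"
  by (induction s) auto

lemma subst_Vr [simp]: "subst \<phi> x (Vr x) = \<phi>"
  by (induction \<phi>) auto

lemma fvt_substt: "fvt (substt s x t) \<subseteq> fvt s - {x} \<union> fvt t"
  by (induction s) auto

lemma fv_subst: "fv (subst \<phi> x t) \<subseteq> fv \<phi> - {x} \<union> fvt t"
proof (induction \<phi>)
  case (Eql r s)
  then show ?case using fvt_substt[of r x t] fvt_substt[of s x t] by auto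
next
  case (Leq r s)
  then show ?case using fvt_substt[of r x t] fvt_substt[of s x t] by auto
qed auto

lemma free_for_closed: "fvt t = {} \<Longrightarrow> free_for t x \<phi>"
  by (induction \<phi>) auto

lemma free_for_num [simp]: "free_for (num n) x \<phi>"
  by (simp add: free_for_closed)

lemma free_for_Vr [simp]: "free_for (Vr x) x \<phi>"
  by (induction \<phi>) auto

section \<open>Simultaneous substitution\<close>

primrec simsubstt :: "(nat \<Rightarrow> trm) \<Rightarrow> trm \<Rightarrow> trm" where
  "simsubstt \<sigma> \<^bold>0 = \<^bold>0"
| "simsubstt \<sigma> (Vr x) = \<sigma> x"
| "simsubstt \<sigma> (Scc s) = Scc (simsubstt \<sigma> s)"
| "simsubstt \<sigma> (s \<^bold>+ t) = simsubstt \<sigma> s \<^bold>+ simsubstt \<sigma> t"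
| "simsubstt \<sigma> (s \<^bold>* t) = simsubstt \<sigma> s \<^bold>* simsubstt \<sigma> t"

text \<open>Like \<open>subst\<close> it never renames. Provability of instances is claimed only
  where capture cannot occur: for quantifier-free formulas and for maps into numerals.\<close>

primrec simsubst :: "(nat \<Rightarrow> trm) \<Rightarrow> fm \<Rightarrow> fm" where
  "simsubst \<sigma> (s \<^bold>= t) = (simsubstt \<sigma> s \<^bold>= simsubstt \<sigma> t)"
| "simsubst \<sigma> (s \<^bold>\<le> t) = (simsubstt \<sigma> s \<^bold>\<le> simsubstt \<sigma> t)"
| "simsubst \<sigma> (\<^bold>\<not> \<phi>) = (\<^bold>\<not> simsubst \<sigma> \<phi>)"
| "simsubst \<sigma> (\<phi> \<^bold>\<rightarrow> \<psi>) = (simsubst \<sigma> \<phi> \<^bold>\<rightarrow> simsubst \<sigma> \<psi>)"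
| "simsubst \<sigma> (Forall x \<phi>) = Forall x (simsubst (\<sigma>(x := Vr x)) \<phi>)"

lemma simsubstt_cong: "(\<And>x. x \<in> fvt s \<Longrightarrow> \<sigma> x = \<rho> x) \<Longrightarrow> simsubstt \<sigma> s = simsubstt \<rho> s"
  by (induction s) auto

lemma simsubst_cong: "(\<And>x. x \<in> fv \<phi> \<Longrightarrow> \<sigma> x = \<rho> x) \<Longrightarrow> simsubst \<sigma> \<phi> = simsubst \<rho> \<phi>"
proof (induction \<phi> arbitrary: \<sigma> \<rho>)
  case (Eql s t)
  then show ?case using simsubstt_cong[of s \<sigma> \<rho>] simsubstt_cong[of t \<sigma> \<rho>] by auto
next
  case (Leq s t)
  then show ?case using simsubstt_cong[of s \<sigma> \<rho>] simsubstt_cong[of t \<sigma> \<rho>] by auto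
next
  case (Neg \<phi>)
  have "simsubst \<sigma> \<phi> = simsubst \<rho> \<phi>" by (rule Neg.IH) (use Neg.prems in simp)
  then show ?case by simp
next
  case (Imp \<phi> \<psi>)
  have "simsubst \<sigma> \<phi> = simsubst \<rho> \<phi>" "simsubst \<sigma> \<psi> = simsubst \<rho> \<psi>"
    by (rule Imp.IH, use Imp.prems in simp)+
  then show ?case by simp
next
  case (Forall x \<phi>)
  have "simsubst (\<sigma>(x := Vr x)) \<phi> = simsubst (\<rho>(x := Vr x)) \<phi>"
    by (rule Forall.IH) (use Forall.prems in auto)
  then show ?case by simp
qed

lemma simsubstt_fun_upd:
  "(\<And>y. y \<noteq> x \<Longrightarrow> x \<notin> fvt (\<sigma> y)) \<Longrightarrow>
    substt (simsubstt (\<sigma>(x := Vr x)) s) x t = simsubstt (\<sigma>(x := t)) s"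
  by (induction s) (auto simp: substt_idle)

text \<open>By the side condition the only free \<open>x\<close> that the second substitution can
  hit are those left in place by the first, so the two steps merge into one.\<close>

lemma simsubst_fun_upd:
  "(\<And>y. y \<noteq> x \<Longrightarrow> x \<notin> fvt (\<sigma> y)) \<Longrightarrow>
    subst (simsubst (\<sigma>(x := Vr x)) \<phi>) x t = simsubst (\<sigma>(x := t)) \<phi>"
proof (induction \<phi> arbitrary: \<sigma>)
  case (Forall y \<phi>)
  show ?case
  proof (cases "y = x")
    case False
    have "subst (simsubst ((\<sigma>(y := Vr y))(x := Vr x)) \<phi>) x t = simsubst ((\<sigma>(y := Vr y))(x := t)) \<phi>"
      by (rule Forall.IH) (use Forall.prems False in auto)
    moreover have "\<sigma>(x := s, y := Vr y) = \<sigma>(y := Vr y, x := s)" for s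
      using False by auto
    ultimately show ?thesis using False by (simp del: fun_upd_apply)
  qed (simp del: fun_upd_apply)
qed (auto simp: simsubstt_fun_upd)

lemma simsubstt_Vr [simp]: "simsubstt Vr s = s"
  by (induction s) auto

lemma simsubst_Vr [simp]: "simsubst Vr \<phi> = \<phi>"
proof (induction \<phi>)
  case (Forall x \<phi>)
  have "Vr(x := Vr x) = Vr" by auto
  with Forall show ?case by simp
qed auto

lemma subst_eq_simsubst: "subst \<phi> x t = simsubst (Vr(x := t)) \<phi>"
proof -
  have "Vr(x := Vr x) = Vr" by auto
  then show ?thesis using simsubst_fun_upd[of x Vr \<phi> t] by auto
qed

section \<open>Derivations from hypotheses\<close>

text \<open>Adding open hypotheses to \<open>U\<close> would break the deduction theorem, since
  \<open>generalization\<close> could bind their free variables. Iterated implications make that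
  theorem definitional and leave the eigenvariable condition to \<open>derives_allI\<close>.\<close>

primrec derives :: "fm set \<Rightarrow> fm list \<Rightarrow> fm \<Rightarrow> bool" where
  "derives U [] \<phi> \<longleftrightarrow> (U \<tturnstile> \<phi>)"
| "derives U (\<gamma> # \<Gamma>) \<phi> \<longleftrightarrow> derives U \<Gamma> (\<gamma> \<^bold>\<rightarrow> \<phi>)"

lemma prv_K: "U \<tturnstile> \<phi> \<Longrightarrow> U \<tturnstile> (\<psi> \<^bold>\<rightarrow> \<phi>)"
  using prv.modus_ponens prv.logical logical_axiom.intros(1) by blast

lemma prv_refl: "U \<tturnstile> (\<phi> \<^bold>\<rightarrow> \<phi>)"
proof -
  have "U \<tturnstile> (\<phi> \<^bold>\<rightarrow> (\<phi> \<^bold>\<rightarrow> \<phi>) \<^bold>\<rightarrow> \<phi>)" "U \<tturnstile> (\<phi> \<^bold>\<rightarrow> \<phi> \<^bold>\<rightarrow> \<phi>)"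
    "U \<tturnstile> ((\<phi> \<^bold>\<rightarrow> (\<phi> \<^bold>\<rightarrow> \<phi>) \<^bold>\<rightarrow> \<phi>) \<^bold>\<rightarrow> (\<phi> \<^bold>\<rightarrow> \<phi> \<^bold>\<rightarrow> \<phi>) \<^bold>\<rightarrow> \<phi> \<^bold>\<rightarrow> \<phi>)"
    by (rule prv.logical, rule logical_axiom.intros)+
  from prv.modus_ponens[OF this(2) prv.modus_ponens[OF this(1,3)]] show ?thesis .
qed

lemma derives_prv: "U \<tturnstile> \<phi> \<Longrightarrow> derives U \<Gamma> \<phi>"
  by (induction \<Gamma> arbitrary: \<phi>) (simp_all add: prv_K)

lemma derives_axiom: "logical_axiom \<phi> \<Longrightarrow> derives U \<Gamma> \<phi>"
  by (simp add: derives_prv prv.logical)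

lemma derives_mp: "derives U \<Gamma> (\<phi> \<^bold>\<rightarrow> \<psi>) \<Longrightarrow> derives U \<Gamma> \<phi> \<Longrightarrow> derives U \<Gamma> \<psi>"
proof (induction \<Gamma> arbitrary: \<phi> \<psi>)
  case (Cons \<gamma> \<Gamma>)
  have "derives U \<Gamma> ((\<gamma> \<^bold>\<rightarrow> \<phi> \<^bold>\<rightarrow> \<psi>) \<^bold>\<rightarrow> (\<gamma> \<^bold>\<rightarrow> \<phi>) \<^bold>\<rightarrow> \<gamma> \<^bold>\<rightarrow> \<psi>)"
    by (intro derives_axiom logical_axiom.intros)
  from Cons.IH[OF Cons.IH[OF this]] Cons.prems show ?case by simp
next
  case Nil
  then show ?case using prv.modus_ponens[of U \<phi> \<psi>] by simp
qed

lemma derives_impI: "derives U (\<phi> # \<Gamma>) \<psi> \<Longrightarrow> derives U \<Gamma> (\<phi> \<^bold>\<rightarrow> \<psi>)"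
  by simp

lemma derives_Cons: "derives U \<Gamma> \<psi> \<Longrightarrow> derives U (\<phi> # \<Gamma>) \<psi>"
  using derives_mp[OF derives_axiom[OF logical_axiom.intros(1)]] by simp

lemma derives_hyp: "\<phi> \<in> set \<Gamma> \<Longrightarrow> derives U \<Gamma> \<phi>"
proof (induction \<Gamma>)
  case (Cons \<gamma> \<Gamma>)
  then show ?case
    using derives_Cons[of U \<Gamma> \<phi> \<gamma>] derives_prv[OF prv_refl, of U \<Gamma> \<gamma>] by auto
qed simp

lemma derives_weaken: "derives U \<Gamma> \<phi> \<Longrightarrow> set \<Gamma> \<subseteq> set \<Delta> \<Longrightarrow> derives U \<Delta> \<phi>"
proof (induction \<Gamma> arbitrary: \<phi>)
  case (Cons \<gamma> \<Gamma>)
  then show ?case using derives_mp[of U \<Delta> \<gamma> \<phi>] derives_hyp[of \<gamma> \<Delta> U] by auto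
qed (simp add: derives_prv)

lemma derives_cut: "derives U \<Gamma> \<phi> \<Longrightarrow> derives U (\<phi> # \<Gamma>) \<psi> \<Longrightarrow> derives U \<Gamma> \<psi>"
  using derives_mp[of U \<Gamma> \<phi> \<psi>] by simp

lemma derives_allI: "derives U \<Gamma> \<phi> \<Longrightarrow> \<forall>\<gamma> \<in> set \<Gamma>. x \<notin> fv \<gamma> \<Longrightarrow> derives U \<Gamma> (Forall x \<phi>)"
proof (induction \<Gamma> arbitrary: \<phi>)
  case (Cons \<gamma> \<Gamma>)
  then have "derives U \<Gamma> (Forall x (\<gamma> \<^bold>\<rightarrow> \<phi>))" by simp
  moreover have "derives U \<Gamma> (Forall x (\<gamma> \<^bold>\<rightarrow> \<phi>) \<^bold>\<rightarrow> \<gamma> \<^bold>\<rightarrow> Forall x \<phi>)"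
    using Cons.prems by (intro derives_axiom logical_axiom.intros) auto
  ultimately show ?case using derives_mp[of U \<Gamma>] by simp
qed (simp add: prv.generalization)

lemma derives_allE: "derives U \<Gamma> (Forall x \<phi>) \<Longrightarrow> free_for t x \<phi> \<Longrightarrow> derives U \<Gamma> (subst \<phi> x t)"
  using derives_mp[OF derives_axiom[OF logical_axiom.intros(4)]] by blast

lemma derives_explode: "derives U \<Gamma> \<phi> \<Longrightarrow> derives U \<Gamma> (\<^bold>\<not> \<phi>) \<Longrightarrow> derives U \<Gamma> \<psi>"
  by (rule derives_mp[OF derives_mp[OF derives_axiom[OF logical_axiom.intros(3)]]],
      rule derives_mp[OF derives_axiom[OF logical_axiom.intros(1)]])

text \<open>Clavius' law. The provable formula \<open>?\<tau>\<close> stands for truth: the negation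
  of \<open>\<phi>\<close> refutes it, and contraposition returns \<open>\<phi>\<close>.\<close>

lemma derives_negE: "derives U \<Gamma> (\<^bold>\<not> \<phi> \<^bold>\<rightarrow> \<phi>) \<Longrightarrow> derives U \<Gamma> \<phi>"
proof -
  assume *: "derives U \<Gamma> (\<^bold>\<not> \<phi> \<^bold>\<rightarrow> \<phi>)"
  let ?\<tau> = "\<phi> \<^bold>\<rightarrow> \<phi>"
  have "derives U ((\<^bold>\<not> \<phi>) # \<Gamma>) (\<^bold>\<not> ?\<tau>)"
    using * derives_explode[of U "(\<^bold>\<not> \<phi>) # \<Gamma>" \<phi>] derives_hyp[of "\<^bold>\<not> \<phi>" "(\<^bold>\<not> \<phi>) # \<Gamma>"] by simp
  then have "derives U \<Gamma> (?\<tau> \<^bold>\<rightarrow> \<phi>)"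
    using derives_mp[OF derives_axiom[OF logical_axiom.intros(3)]] by simp
  then show ?thesis using derives_mp[OF _ derives_prv[OF prv_refl]] by blast
qed

lemma derives_classical:
  assumes "derives U ((\<^bold>\<not> \<phi>) # \<Gamma>) \<psi>" "derives U ((\<^bold>\<not> \<phi>) # \<Gamma>) (\<^bold>\<not> \<psi>)"
  shows "derives U \<Gamma> \<phi>"
  by (rule derives_negE[OF derives_impI[OF derives_explode[OF assms]]])

lemma derives_notnotD: "derives U \<Gamma> (\<^bold>\<not> \<^bold>\<not> \<phi>) \<Longrightarrow> derives U \<Gamma> \<phi>"
  by (rule derives_classical[of U \<phi> \<Gamma> "\<^bold>\<not> \<phi>"], rule derives_hyp, simp, rule derives_Cons)

lemma derives_notI:
  assumes "derives U (\<phi> # \<Gamma>) \<psi>" "derives U (\<phi> # \<Gamma>) (\<^bold>\<not> \<psi>)"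
  shows "derives U \<Gamma> (\<^bold>\<not> \<phi>)"
proof -
  have "derives U (\<phi> # \<Gamma>) (\<^bold>\<not> \<phi>)" by (rule derives_explode[OF assms])
  then have *: "derives U ((\<^bold>\<not> \<^bold>\<not> \<phi>) # \<Gamma>) (\<phi> \<^bold>\<rightarrow> \<^bold>\<not> \<phi>)"
    by (rule derives_Cons[OF derives_impI])
  have "derives U ((\<^bold>\<not> \<^bold>\<not> \<phi>) # \<Gamma>) \<phi>"
    by (rule derives_notnotD) (simp add: derives_hyp del: derives.simps)
  from derives_classical[OF this derives_mp[OF * this]] show ?thesis .
qed

lemma derives_notI': "derives U (\<phi> # \<Gamma>) (\<^bold>\<not> \<phi>) \<Longrightarrow> derives U \<Gamma> (\<^bold>\<not> \<phi>)"
  by (rule derives_notI[of U \<phi> \<Gamma> \<phi>]) (simp_all add: derives_hyp del: derives.simps)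

lemma derives_cases:
  assumes "derives U (\<phi> # \<Gamma>) \<psi>" "derives U ((\<^bold>\<not> \<phi>) # \<Gamma>) \<psi>"
  shows "derives U \<Gamma> \<psi>"
proof (rule derives_classical)
  show "derives U ((\<^bold>\<not> \<psi>) # \<Gamma>) (\<^bold>\<not> \<phi>)"
  proof (rule derives_notI)
    show "derives U (\<phi> # (\<^bold>\<not> \<psi>) # \<Gamma>) \<psi>" by (rule derives_weaken[OF assms(1)]) auto
  qed (simp add: derives_hyp del: derives.simps)
  show "derives U ((\<^bold>\<not> \<psi>) # \<Gamma>) (\<^bold>\<not> \<^bold>\<not> \<phi>)"
  proof (rule derives_notI)
    show "derives U ((\<^bold>\<not> \<phi>) # (\<^bold>\<not> \<psi>) # \<Gamma>) \<psi>" by (rule derives_weaken[OF assms(2)]) auto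
  qed (simp add: derives_hyp del: derives.simps)
qed

lemma derives_conjI:
  assumes "derives U \<Gamma> \<phi>" "derives U \<Gamma> \<psi>"
  shows "derives U \<Gamma> (\<phi> \<^bold>\<and> \<psi>)"
proof (rule derives_notI[of U _ \<Gamma> \<psi>])
  show "derives U ((\<phi> \<^bold>\<rightarrow> \<^bold>\<not> \<psi>) # \<Gamma>) (\<^bold>\<not> \<psi>)"
    by (rule derives_mp[OF _ derives_Cons[OF assms(1)]], rule derives_hyp) simp
qed (rule derives_Cons[OF assms(2)])

lemma derives_conjD1: "derives U \<Gamma> (\<phi> \<^bold>\<and> \<psi>) \<Longrightarrow> derives U \<Gamma> \<phi>"
proof (rule derives_classical[of U \<phi> \<Gamma> "\<phi> \<^bold>\<rightarrow> \<^bold>\<not> \<psi>"])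
  show "derives U ((\<^bold>\<not> \<phi>) # \<Gamma>) (\<phi> \<^bold>\<rightarrow> \<^bold>\<not> \<psi>)"
    by (rule derives_impI, rule derives_explode[of _ _ \<phi>]) (simp_all add: derives_hyp del: derives.simps)
qed (rule derives_Cons)

lemma derives_conjD2: "derives U \<Gamma> (\<phi> \<^bold>\<and> \<psi>) \<Longrightarrow> derives U \<Gamma> \<psi>"
proof (rule derives_classical[of U \<psi> \<Gamma> "\<phi> \<^bold>\<rightarrow> \<^bold>\<not> \<psi>"])
  show "derives U ((\<^bold>\<not> \<psi>) # \<Gamma>) (\<phi> \<^bold>\<rightarrow> \<^bold>\<not> \<psi>)"
    by (rule derives_impI) (simp_all add: derives_hyp del: derives.simps)
qed (rule derives_Cons)

lemma derives_disjI1: "derives U \<Gamma> \<phi> \<Longrightarrow> derives U \<Gamma> (\<phi> \<^bold>\<or> \<psi>)"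
  by (rule derives_impI, rule derives_explode[of _ _ \<phi>], erule derives_Cons)
    (simp add: derives_hyp del: derives.simps)

lemma derives_disjI2: "derives U \<Gamma> \<psi> \<Longrightarrow> derives U \<Gamma> (\<phi> \<^bold>\<or> \<psi>)"
  by (rule derives_impI, rule derives_Cons)

lemma derives_disjE:
  assumes "derives U \<Gamma> (\<phi> \<^bold>\<or> \<psi>)" "derives U (\<phi> # \<Gamma>) \<chi>" "derives U (\<psi> # \<Gamma>) \<chi>"
  shows "derives U \<Gamma> \<chi>"
proof (rule derives_cases[OF assms(2)])
  have "derives U ((\<^bold>\<not> \<phi>) # \<Gamma>) \<psi>" using assms(1) by simp
  moreover have "derives U ((\<^bold>\<not> \<phi>) # \<Gamma>) (\<psi> \<^bold>\<rightarrow> \<chi>)"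
    by (rule derives_Cons[OF derives_impI[OF assms(3)]])
  ultimately show "derives U ((\<^bold>\<not> \<phi>) # \<Gamma>) \<chi>" by (rule derives_mp[rotated])
qed

lemma derives_iffD1: "derives U \<Gamma> (\<phi> \<^bold>\<leftrightarrow> \<psi>) \<Longrightarrow> derives U \<Gamma> \<phi> \<Longrightarrow> derives U \<Gamma> \<psi>"
  by (rule derives_mp[OF derives_conjD1])

lemma derives_iffD2: "derives U \<Gamma> (\<phi> \<^bold>\<leftrightarrow> \<psi>) \<Longrightarrow> derives U \<Gamma> \<psi> \<Longrightarrow> derives U \<Gamma> \<phi>"
  by (rule derives_mp[OF derives_conjD2])

lemma derives_iffI: "derives U (\<phi> # \<Gamma>) \<psi> \<Longrightarrow> derives U (\<psi> # \<Gamma>) \<phi> \<Longrightarrow> derives U \<Gamma> (\<phi> \<^bold>\<leftrightarrow> \<psi>)"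
  by (intro derives_conjI derives_impI)

lemma derives_exI:
  assumes "derives U \<Gamma> (subst \<phi> x t)" "free_for t x \<phi>"
  shows "derives U \<Gamma> (Exists x \<phi>)"
proof (rule derives_notI[of U _ \<Gamma> "subst \<phi> x t"])
  have "derives U (Forall x (\<^bold>\<not> \<phi>) # \<Gamma>) (subst (\<^bold>\<not> \<phi>) x t)"
    by (rule derives_allE[OF derives_hyp]) (use assms(2) in simp_all)
  then show "derives U (Forall x (\<^bold>\<not> \<phi>) # \<Gamma>) (\<^bold>\<not> subst \<phi> x t)" by simp
qed (rule derives_Cons[OF assms(1)])

lemma derives_exE:
  assumes "derives U \<Gamma> (Exists x \<phi>)" "derives U (\<phi> # \<Gamma>) \<psi>" "x \<notin> fv \<psi>" "\<forall>\<gamma> \<in> set \<Gamma>. x \<notin> fv \<gamma>"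
  shows "derives U \<Gamma> \<psi>"
proof (rule derives_classical[of U \<psi> \<Gamma> "Forall x (\<^bold>\<not> \<phi>)"])
  show "derives U ((\<^bold>\<not> \<psi>) # \<Gamma>) (Forall x (\<^bold>\<not> \<phi>))"
  proof (rule derives_allI, rule derives_notI)
    show "derives U (\<phi> # (\<^bold>\<not> \<psi>) # \<Gamma>) \<psi>" by (rule derives_weaken[OF assms(2)]) auto
    show "derives U (\<phi> # (\<^bold>\<not> \<psi>) # \<Gamma>) (\<^bold>\<not> \<psi>)" by (simp add: derives_hyp del: derives.simps)
  qed (use assms(3,4) in simp)
qed (rule derives_Cons[OF assms(1)])

lemma prv_subst: "U \<tturnstile> \<phi> \<Longrightarrow> free_for t x \<phi> \<Longrightarrow> U \<tturnstile> subst \<phi> x t"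
  using derives_allE[of U "[]" x \<phi> t] prv.generalization[of U \<phi> x] by simp

lemma derives_cut2: "derives U [\<phi>, \<psi>] \<chi> \<Longrightarrow> derives U \<Gamma> \<phi> \<Longrightarrow> derives U \<Gamma> \<psi> \<Longrightarrow> derives U \<Gamma> \<chi>"
  using derives_mp[OF derives_mp[OF derives_prv[of U "\<psi> \<^bold>\<rightarrow> \<phi> \<^bold>\<rightarrow> \<chi>" \<Gamma>]]] by simp

declare derives.simps(2) [simp del]

section \<open>Equality\<close>

text \<open>On these formulas every term is free for every variable, so open axioms can be
  instantiated by arbitrary terms.\<close>

primrec qfree :: "fm \<Rightarrow> bool" where
  "qfree (s \<^bold>= t) \<longleftrightarrow> True"
| "qfree (s \<^bold>\<le> t) \<longleftrightarrow> True"
| "qfree (\<^bold>\<not> \<phi>) \<longleftrightarrow> qfree \<phi>"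
| "qfree (\<phi> \<^bold>\<rightarrow> \<psi>) \<longleftrightarrow> qfree \<phi> \<and> qfree \<psi>"
| "qfree (Forall x \<phi>) \<longleftrightarrow> False"

lemma qfree_free_for: "qfree \<phi> \<Longrightarrow> free_for t x \<phi>"
  by (induction \<phi>) auto

lemma qfree_subst: "qfree \<phi> \<Longrightarrow> qfree (subst \<phi> x t)"
  by (induction \<phi>) auto

lemma finite_fvt: "finite (fvt t)"
  by (induction t) auto

text \<open>Renaming the variables first avoids clashes between the successive substitutions.\<close>

lemma prv_instance:
  assumes "U \<tturnstile> \<phi>" "qfree \<phi>" "fv \<phi> \<subseteq> {0, 1, 2, 3}"
  shows "U \<tturnstile> simsubst (Vr(0 := a, 1 := b, 2 := c, 3 := d)) \<phi>"
proof -
  have "finite (fvt a \<union> fvt b \<union> fvt c \<union> fvt d \<union> {3})" by (simp add: finite_fvt)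
  then obtain M where M: "\<forall>x \<in> fvt a \<union> fvt b \<union> fvt c \<union> fvt d \<union> {3}. x < M"
    using finite_nat_set_iff_bounded by auto
  have fresh: "k \<notin> fvt a \<and> k \<notin> fvt b \<and> k \<notin> fvt c \<and> k \<notin> fvt d" if "k \<ge> M" for k
    using M that by (meson UnCI not_less)
  have M3: "3 < M" using M by auto
  define vars where "vars = [(0, Vr M), (1, Vr (M+1)), (2, Vr (M+2)), (3, Vr (M+3)), (M, a), (M+1, b), (M+2, c), (M+3, d)]"
  have step: "U \<tturnstile> foldl (\<lambda>\<phi> (x, t). subst \<phi> x t) \<phi> xs" if "U \<tturnstile> \<phi>" "qfree \<phi>" for xs \<phi>
    using that by (induction xs arbitrary: \<phi>) (auto simp: qfree_subst qfree_free_for prv_subst)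
  define \<sigma> where "\<sigma> = Vr(0 := a, 1 := b, 2 := c, 3 := d)"
  then have \<sigma>: "\<sigma> 0 = a" "\<sigma> (Suc 0) = b" "\<sigma> 2 = c" "\<sigma> 3 = d" by auto
  have tm: "foldl (\<lambda>s (x, t). substt s x t) s vars = simsubstt \<sigma> s"
    if "fvt s \<subseteq> {0, 1, 2, 3}" for s
    using that M3 by (induction s) (auto simp: vars_def substt_idle fresh \<sigma>)
  have "foldl (\<lambda>\<phi> (x, t). subst \<phi> x t) \<phi> vars = simsubst \<sigma> \<phi>"
    using assms(2,3)
  proof (induction \<phi>)
    case (Eql s t)
    then show ?case using tm[of s] tm[of t] by (simp add: vars_def)
  next
    case (Leq s t)
    then show ?case using tm[of s] tm[of t] by (simp add: vars_def)
  qed (simp_all add: vars_def)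
  with step[OF assms(1,2), of vars] show ?thesis by (simp add: \<sigma>_def)
qed

lemma derives_instance:
  assumes "U \<tturnstile> \<phi>" "qfree \<phi>" "fv \<phi> \<subseteq> {0, 1, 2, 3}"
  shows "derives U \<Gamma> (simsubst (Vr(0 := a, 1 := b, 2 := c, 3 := d)) \<phi>)"
  by (rule derives_prv[OF prv_instance[OF assms]])

lemma derives_equality_axiom:
  assumes "\<phi> \<in> set equality_axioms"
  shows "derives U \<Gamma> (simsubst (Vr(0 := a, 1 := b, 2 := c, 3 := d)) \<phi>)"
proof (rule derives_instance)
  show "qfree \<phi>" "fv \<phi> \<subseteq> {0, 1, 2, 3}" using assms by (auto simp: equality_axioms_def)
qed (intro prv.logical logical_axiom.intros assms)

lemma derives_eq_refl: "derives U \<Gamma> (t \<^bold>= t)"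
  using derives_equality_axiom[of "Vr 0 \<^bold>= Vr 0" U \<Gamma> t t t t] by (simp add: equality_axioms_def)

lemma derives_eq_euclid: "derives U \<Gamma> (s \<^bold>= t) \<Longrightarrow> derives U \<Gamma> (s \<^bold>= u) \<Longrightarrow> derives U \<Gamma> (t \<^bold>= u)"
  using derives_equality_axiom[of "Vr 0 \<^bold>= Vr 1 \<^bold>\<rightarrow> Vr 0 \<^bold>= Vr 2 \<^bold>\<rightarrow> Vr 1 \<^bold>= Vr 2" U \<Gamma> s t u]
    derives_mp[OF derives_mp, of U \<Gamma> "s \<^bold>= t" "s \<^bold>= u" "t \<^bold>= u"]
  by (simp add: equality_axioms_def)

lemma derives_eq_sym: "derives U \<Gamma> (s \<^bold>= t) \<Longrightarrow> derives U \<Gamma> (t \<^bold>= s)"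
  by (rule derives_eq_euclid[OF _ derives_eq_refl])

lemma derives_eq_trans: "derives U \<Gamma> (s \<^bold>= t) \<Longrightarrow> derives U \<Gamma> (t \<^bold>= u) \<Longrightarrow> derives U \<Gamma> (s \<^bold>= u)"
  by (rule derives_eq_euclid[OF derives_eq_sym])

lemma derives_eq_Scc: "derives U \<Gamma> (s \<^bold>= t) \<Longrightarrow> derives U \<Gamma> (Scc s \<^bold>= Scc t)"
  using derives_equality_axiom[of "Vr 0 \<^bold>= Vr 1 \<^bold>\<rightarrow> Scc (Vr 0) \<^bold>= Scc (Vr 1)" U \<Gamma> s t]
    derives_mp[of U \<Gamma> "s \<^bold>= t" "Scc s \<^bold>= Scc t"]
  by (simp add: equality_axioms_def)

lemma derives_eq_Pls:
  "derives U \<Gamma> (s \<^bold>= t) \<Longrightarrow> derives U \<Gamma> (s' \<^bold>= t') \<Longrightarrow> derives U \<Gamma> (s \<^bold>+ s' \<^bold>= t \<^bold>+ t')"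
  using derives_equality_axiom[of "Vr 0 \<^bold>= Vr 1 \<^bold>\<rightarrow> Vr 2 \<^bold>= Vr 3 \<^bold>\<rightarrow> Vr 0 \<^bold>+ Vr 2 \<^bold>= Vr 1 \<^bold>+ Vr 3" U \<Gamma> s t s' t']
    derives_mp[OF derives_mp, of U \<Gamma> "s \<^bold>= t" "s' \<^bold>= t'" "s \<^bold>+ s' \<^bold>= t \<^bold>+ t'"]
  by (simp add: equality_axioms_def)

lemma derives_eq_Tms:
  "derives U \<Gamma> (s \<^bold>= t) \<Longrightarrow> derives U \<Gamma> (s' \<^bold>= t') \<Longrightarrow> derives U \<Gamma> (s \<^bold>* s' \<^bold>= t \<^bold>* t')"
  using derives_equality_axiom[of "Vr 0 \<^bold>= Vr 1 \<^bold>\<rightarrow> Vr 2 \<^bold>= Vr 3 \<^bold>\<rightarrow> Vr 0 \<^bold>* Vr 2 \<^bold>= Vr 1 \<^bold>* Vr 3" U \<Gamma> s t s' t']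
    derives_mp[OF derives_mp, of U \<Gamma> "s \<^bold>= t" "s' \<^bold>= t'" "s \<^bold>* s' \<^bold>= t \<^bold>* t'"]
  by (simp add: equality_axioms_def)

lemma derives_eq_Leq:
  "derives U \<Gamma> (s \<^bold>= t) \<Longrightarrow> derives U \<Gamma> (s' \<^bold>= t') \<Longrightarrow> derives U \<Gamma> (s \<^bold>\<le> s') \<Longrightarrow> derives U \<Gamma> (t \<^bold>\<le> t')"
  using derives_equality_axiom[of "Vr 0 \<^bold>= Vr 1 \<^bold>\<rightarrow> Vr 2 \<^bold>= Vr 3 \<^bold>\<rightarrow> Vr 0 \<^bold>\<le> Vr 2 \<^bold>\<rightarrow> Vr 1 \<^bold>\<le> Vr 3" U \<Gamma> s t s' t']
    derives_mp[OF derives_mp[OF derives_mp], of U \<Gamma> "s \<^bold>= t" "s' \<^bold>= t'" "s \<^bold>\<le> s'" "t \<^bold>\<le> t'"]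
  by (simp add: equality_axioms_def)

lemma derives_eq_substt: "derives U \<Gamma> (s \<^bold>= t) \<Longrightarrow> derives U \<Gamma> (substt r x s \<^bold>= substt r x t)"
  by (induction r) (simp_all add: derives_eq_refl derives_eq_Scc derives_eq_Pls derives_eq_Tms)

text \<open>Leibniz's law. Negations and antecedents reverse the roles of \<open>s\<close> and
  \<open>t\<close>, so the induction is over all pairs of terms.\<close>

lemma derives_eq_subst:
  assumes "derives U \<Gamma> (s \<^bold>= t)" "derives U \<Gamma> (subst \<phi> x s)" "free_for s x \<phi>" "free_for t x \<phi>"
  shows "derives U \<Gamma> (subst \<phi> x t)"
proof -
  \<comment> \<open>The context is fixed to two hypotheses: an arbitrary \<open>\<Gamma>\<close>
    might contain the quantified variable free and block generalization in the last case.\<close>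
  have "derives U [subst \<phi> x s, s \<^bold>= t] (subst \<phi> x t)" using assms(3,4)
  proof (induction \<phi> arbitrary: s t)
    case (Eql r r')
    let ?\<Gamma> = "[subst (r \<^bold>= r') x s, s \<^bold>= t]"
    have "derives U ?\<Gamma> (s \<^bold>= t)" by (rule derives_hyp) simp
    note eq = derives_eq_substt[OF this]
    have "derives U ?\<Gamma> (substt r x s \<^bold>= substt r' x s)" by (rule derives_hyp) simp
    from derives_eq_trans[OF derives_eq_sym[OF eq] derives_eq_trans[OF this eq]]
    show ?case unfolding subst.simps .
  next
    case (Leq r r')
    let ?\<Gamma> = "[subst (r \<^bold>\<le> r') x s, s \<^bold>= t]"
    have "derives U ?\<Gamma> (s \<^bold>= t)" by (rule derives_hyp) simp
    note eq = derives_eq_substt[OF this]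
    have "derives U ?\<Gamma> (substt r x s \<^bold>\<le> substt r' x s)" by (rule derives_hyp) simp
    from derives_eq_Leq[OF eq eq this] show ?case unfolding subst.simps .
  next
    case (Neg \<phi>)
    let ?\<Gamma> = "[subst (\<^bold>\<not> \<phi>) x s, s \<^bold>= t]"
    have "derives U (subst \<phi> x t # ?\<Gamma>) (s \<^bold>= t)" "derives U (subst \<phi> x t # ?\<Gamma>) (subst \<phi> x t)"
      and *: "derives U (subst \<phi> x t # ?\<Gamma>) (\<^bold>\<not> subst \<phi> x s)"
      by (rule derives_hyp, simp)+
    from derives_cut2[OF Neg.IH this(2) derives_eq_sym[OF this(1)]] Neg.prems
    have "derives U (subst \<phi> x t # ?\<Gamma>) (subst \<phi> x s)" by simp
    from derives_notI[OF this *] show ?case unfolding subst.simps .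
  next
    case (Imp \<phi> \<psi>)
    let ?\<Gamma> = "subst \<phi> x t # [subst (\<phi> \<^bold>\<rightarrow> \<psi>) x s, s \<^bold>= t]"
    have eq: "derives U ?\<Gamma> (s \<^bold>= t)" and \<phi>: "derives U ?\<Gamma> (subst \<phi> x t)"
      and imp: "derives U ?\<Gamma> (subst \<phi> x s \<^bold>\<rightarrow> subst \<psi> x s)"
      by (rule derives_hyp, simp)+
    have "free_for s x \<phi>" "free_for t x \<phi>" "free_for s x \<psi>" "free_for t x \<psi>" using Imp.prems by auto
    note IH = Imp.IH(1)[OF this(2,1)] Imp.IH(2)[OF this(3,4)]
    have "derives U ?\<Gamma> (subst \<psi> x t)"
      by (rule derives_cut2[OF IH(2) derives_mp[OF imp derives_cut2[OF IH(1) \<phi> derives_eq_sym[OF eq]]] eq])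
    from derives_impI[OF this] show ?case unfolding subst.simps .
  next
    case (Forall y \<phi>)
    show ?case
    \<comment> \<open>\<open>free_for\<close> says something about the body only if \<open>x\<close>
      is free; otherwise both substitutions are idle.\<close>
    proof (cases "x \<in> fv (Forall y \<phi>)")
      case False
      then have "subst (Forall y \<phi>) x s = subst (Forall y \<phi>) x t" by (metis subst_idle)
      then show ?thesis by (metis derives_hyp list.set_intros(1))
    next
      case True
      then have y: "y \<noteq> x" "y \<notin> fvt s" "y \<notin> fvt t" and ff: "free_for s x \<phi>" "free_for t x \<phi>"
        using Forall.prems by auto
      let ?\<Gamma> = "[Forall y (subst \<phi> x s), s \<^bold>= t]"
      have "derives U ?\<Gamma> (Forall y (subst \<phi> x s))" "derives U ?\<Gamma> (s \<^bold>= t)"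
        by (rule derives_hyp, simp)+
      with derives_allE[OF this(1), of "Vr y"]
      have "derives U ?\<Gamma> (subst \<phi> x t)" using derives_cut2[OF Forall.IH[OF ff]] by simp
      then have "derives U ?\<Gamma> (Forall y (subst \<phi> x t))" by (rule derives_allI) (use y in auto)
      then show ?thesis using y by simp
    qed
  qed
  from derives_cut2[OF this assms(2,1)] show ?thesis .
qed

section \<open>Robinson arithmetic\<close>

lemma evalt_cong: "(\<And>x. x \<in> fvt t \<Longrightarrow> e x = e' x) \<Longrightarrow> evalt e t = evalt e' t"
  by (induction t) auto

lemma evalt_fun_upd: "x \<notin> fvt t \<Longrightarrow> evalt (e(x := k)) t = evalt e t"
  by (rule evalt_cong) auto

text \<open>Replaces a numeral bound by finitely many cases, which is how Robinson arithmetic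
  handles bounded quantifiers without induction.\<close>

primrec eq_upto :: "trm \<Rightarrow> nat \<Rightarrow> fm" where
  "eq_upto t 0 = (t \<^bold>= \<^bold>0)"
| "eq_upto t (Suc n) = (eq_upto t n \<^bold>\<or> t \<^bold>= num (Suc n))"

lemma fv_eq_upto [simp]: "fv (eq_upto t n) = fvt t"
  by (induction n) auto

lemma qfree_eq_upto [simp]: "qfree (eq_upto t n)"
  by (induction n) auto

lemma simsubstt_num [simp]: "simsubstt \<sigma> (num n) = num n"
  by (induction n) auto

lemma simsubst_eq_upto [simp]: "simsubst \<sigma> (eq_upto t n) = eq_upto (simsubstt \<sigma> t) n"
  by (induction n) auto

lemma derives_eq_uptoI: "derives U \<Gamma> (t \<^bold>= num i) \<Longrightarrow> i \<le> n \<Longrightarrow> derives U \<Gamma> (eq_upto t n)"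
proof (induction n)
  case (Suc n)
  then show ?case
    using derives_disjI1[of U \<Gamma> "eq_upto t n"] derives_disjI2[of U \<Gamma> "t \<^bold>= num (Suc n)"]
    by (cases "i = Suc n") auto
qed simp

lemma derives_eq_uptoE:
  "derives U \<Gamma> (eq_upto t n) \<Longrightarrow> (\<And>i. i \<le> n \<Longrightarrow> derives U ((t \<^bold>= num i) # \<Gamma>) \<chi>) \<Longrightarrow> derives U \<Gamma> \<chi>"
proof (induction n arbitrary: \<Gamma>)
  case 0
  then show ?case using derives_cut[of U \<Gamma> "t \<^bold>= \<^bold>0" \<chi>] by force
next
  case (Suc n)
  show ?case
  proof (rule derives_disjE)
    show "derives U \<Gamma> (eq_upto t n \<^bold>\<or> t \<^bold>= num (Suc n))" using Suc.prems(1) by simp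
    show "derives U (eq_upto t n # \<Gamma>) \<chi>"
    proof (rule Suc.IH)
      show "derives U (eq_upto t n # \<Gamma>) (eq_upto t n)" by (rule derives_hyp) simp
      show "derives U ((t \<^bold>= num i) # eq_upto t n # \<Gamma>) \<chi>" if "i \<le> n" for i
        by (rule derives_weaken[OF Suc.prems(2)[of i]]) (use that in auto)
    qed
  qed (rule Suc.prems(2), simp)
qed

text \<open>Instantiating a quantifier by a numeral is the syntactic counterpart of updating the
  environment, so inductions on formulas can run over all environments.\<close>

lemma subst_simsubst_num:
  "subst (simsubst ((\<lambda>y. num (f y))(x := Vr x)) \<phi>) x (num k) = simsubst (\<lambda>y. num ((f(x := k)) y)) \<phi>"
proof -
  have "(\<lambda>y. num (f y))(x := num k) = (\<lambda>y. num ((f(x := k)) y))" by auto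
  then show ?thesis using simsubst_fun_upd[of x "\<lambda>y. num (f y)" \<phi> "num k"] by simp
qed

lemma simsubst_BForall:
  assumes "x \<notin> fvt t"
  shows "simsubst \<sigma> (BForall x t \<phi>) = BForall x (simsubstt \<sigma> t) (simsubst (\<sigma>(x := Vr x)) \<phi>)"
proof -
  have "simsubstt (\<sigma>(x := Vr x)) t = simsubstt \<sigma> t" by (rule simsubstt_cong) (use assms in auto)
  then show ?thesis by simp
qed

lemma prv_Exists:
  assumes "U \<tturnstile> simsubst (\<lambda>y. num ((f(x := k)) y)) \<phi>"
  shows "U \<tturnstile> simsubst (\<lambda>y. num (f y)) (Exists x \<phi>)"
  using derives_exI[of U "[]" "simsubst ((\<lambda>y. num (f y))(x := Vr x)) \<phi>" x "num k"] assms
  by (simp only: subst_simsubst_num simsubst.simps derives.simps(1) free_for_num)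

lemma prv_conjI: "U \<tturnstile> \<phi> \<Longrightarrow> U \<tturnstile> \<psi> \<Longrightarrow> U \<tturnstile> (\<phi> \<^bold>\<and> \<psi>)"
  using derives_conjI[of U "[]"] by simp

lemma prv_notnotI: "U \<tturnstile> \<phi> \<Longrightarrow> U \<tturnstile> (\<^bold>\<not> \<^bold>\<not> \<phi>)"
  using derives_notI[of U "\<^bold>\<not> \<phi>" "[]" \<phi>] derives_prv[of U \<phi>] derives_hyp[of "\<^bold>\<not> \<phi>" "[\<^bold>\<not> \<phi>]"] by simp

text \<open>With the abbreviations unfolded, the conclusion is a doubly negated universal formula
  with a doubly negated body, which accounts for two introductions of double negation.\<close>

lemma prv_not_Exists: "U \<tturnstile> Forall x (\<phi> \<^bold>\<rightarrow> \<^bold>\<not> \<psi>) \<Longrightarrow> U \<tturnstile> (\<^bold>\<not> Exists x (\<phi> \<^bold>\<and> \<psi>))"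
  using derives_allE[of U "[]" x "\<phi> \<^bold>\<rightarrow> \<^bold>\<not> \<psi>" "Vr x"]
  by (simp add: prv_notnotI prv.generalization)

section \<open>Order and numerals in Robinson arithmetic\<close>

context
  fixes U :: "fm set"
  assumes Q: "extends U Robinson_Q"
begin

lemma prv_Q:
  "U \<tturnstile> (\<^bold>\<not> (Scc (Vr 0) \<^bold>= \<^bold>0))"
  "U \<tturnstile> (Scc (Vr 0) \<^bold>= Scc (Vr 1) \<^bold>\<rightarrow> Vr 0 \<^bold>= Vr 1)"
  "U \<tturnstile> (Vr 0 \<^bold>+ \<^bold>0 \<^bold>= Vr 0)"
  "U \<tturnstile> (Vr 0 \<^bold>+ Scc (Vr 1) \<^bold>= Scc (Vr 0 \<^bold>+ Vr 1))"
  "U \<tturnstile> (Vr 0 \<^bold>* \<^bold>0 \<^bold>= \<^bold>0)"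
  "U \<tturnstile> (Vr 0 \<^bold>* Scc (Vr 1) \<^bold>= Vr 0 \<^bold>* Vr 1 \<^bold>+ Vr 0)"
  "U \<tturnstile> (Vr 0 \<^bold>\<le> Vr 1 \<^bold>\<leftrightarrow> Exists 2 (Vr 2 \<^bold>+ Vr 0 \<^bold>= Vr 1))"
  "U \<tturnstile> (Exists 1 (Vr 0 \<^bold>= \<^bold>0 \<^bold>\<or> Vr 0 \<^bold>= Scc (Vr 1)))"
proof -
  have 1: "U \<tturnstile> \<phi>" if "Forall x \<phi> \<in> Robinson_Q" for x \<phi>
    using derives_allE[of U "[]" x \<phi> "Vr x"] Q that unfolding extends_def by auto
  have 2: "U \<tturnstile> \<phi>" if "Forall x (Forall y \<phi>) \<in> Robinson_Q" for x y \<phi>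
    using derives_allE[of U "[]" y \<phi> "Vr y"] 1[OF that] by auto
  show
    "U \<tturnstile> (\<^bold>\<not> (Scc (Vr 0) \<^bold>= \<^bold>0))"
    "U \<tturnstile> (Vr 0 \<^bold>+ \<^bold>0 \<^bold>= Vr 0)"
    "U \<tturnstile> (Vr 0 \<^bold>* \<^bold>0 \<^bold>= \<^bold>0)"
    "U \<tturnstile> (Exists 1 (Vr 0 \<^bold>= \<^bold>0 \<^bold>\<or> Vr 0 \<^bold>= Scc (Vr 1)))"
    by (rule 1[of 0], simp add: Robinson_Q_def)+
  show
    "U \<tturnstile> (Scc (Vr 0) \<^bold>= Scc (Vr 1) \<^bold>\<rightarrow> Vr 0 \<^bold>= Vr 1)"
    "U \<tturnstile> (Vr 0 \<^bold>+ Scc (Vr 1) \<^bold>= Scc (Vr 0 \<^bold>+ Vr 1))"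
    "U \<tturnstile> (Vr 0 \<^bold>* Scc (Vr 1) \<^bold>= Vr 0 \<^bold>* Vr 1 \<^bold>+ Vr 0)"
    "U \<tturnstile> (Vr 0 \<^bold>\<le> Vr 1 \<^bold>\<leftrightarrow> Exists 2 (Vr 2 \<^bold>+ Vr 0 \<^bold>= Vr 1))"
    by (rule 2[of 0 1], simp add: Robinson_Q_def)+
qed

lemma derives_Scc_neq_Zer: "derives U \<Gamma> (\<^bold>\<not> (Scc t \<^bold>= \<^bold>0))"
  using derives_instance[OF prv_Q(1), of \<Gamma> t] by simp

lemma derives_Scc_inject: "derives U \<Gamma> (Scc s \<^bold>= Scc t) \<Longrightarrow> derives U \<Gamma> (s \<^bold>= t)"
  using derives_mp[of U \<Gamma>] derives_instance[OF prv_Q(2), of \<Gamma> s t] by simp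

lemma derives_Pls_Zer: "derives U \<Gamma> (t \<^bold>+ \<^bold>0 \<^bold>= t)"
  using derives_instance[OF prv_Q(3), of \<Gamma> t] by simp

lemma derives_Pls_Scc: "derives U \<Gamma> (s \<^bold>+ Scc t \<^bold>= Scc (s \<^bold>+ t))"
  using derives_instance[OF prv_Q(4), of \<Gamma> s t] by simp

lemma derives_Tms_Zer: "derives U \<Gamma> (t \<^bold>* \<^bold>0 \<^bold>= \<^bold>0)"
  using derives_instance[OF prv_Q(5), of \<Gamma> t] by simp

lemma derives_Tms_Scc: "derives U \<Gamma> (s \<^bold>* Scc t \<^bold>= s \<^bold>* t \<^bold>+ s)"
  using derives_instance[OF prv_Q(6), of \<Gamma> s t] by simp

text \<open>Instantiating the definition of the order directly could capture a \<open>Vr 2\<close>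
  in the terms. The witness is first made a free variable, which leaves a quantifier-free
  implication to instantiate.\<close>

lemma derives_LeqI:
  assumes "derives U \<Gamma> (u \<^bold>+ s \<^bold>= t)"
  shows "derives U \<Gamma> (s \<^bold>\<le> t)"
proof -
  let ?\<phi> = "Vr 2 \<^bold>+ Vr 0 \<^bold>= Vr 1"
  have "derives U [?\<phi>] (Vr 0 \<^bold>\<le> Vr 1)"
  proof (rule derives_iffD2[OF derives_prv[OF prv_Q(7)]])
    have "derives U [?\<phi>] (subst ?\<phi> 2 (Vr 2))" by (simp only: subst_Vr, rule derives_hyp, simp)
    then show "derives U [?\<phi>] (Exists 2 ?\<phi>)" by (rule derives_exI) simp
  qed
  from derives_impI[OF this] have "U \<tturnstile> (?\<phi> \<^bold>\<rightarrow> Vr 0 \<^bold>\<le> Vr 1)" by simp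
  from derives_instance[OF this, of \<Gamma> s t u] assms show ?thesis
    using derives_mp[of U \<Gamma> "u \<^bold>+ s \<^bold>= t"] by simp
qed

lemma derives_zero_or_Scc:
  assumes "derives U ((Vr 0 \<^bold>= \<^bold>0) # \<Gamma>) \<phi>" "derives U ((Vr 0 \<^bold>= Scc (Vr 1)) # \<Gamma>) \<phi>"
    and "1 \<notin> fv \<phi>" "\<forall>\<gamma> \<in> set \<Gamma>. 1 \<notin> fv \<gamma>"
  shows "derives U \<Gamma> \<phi>"
proof (rule derives_exE[OF derives_prv[OF prv_Q(8)] _ assms(3,4)])
  let ?\<gamma> = "Vr 0 \<^bold>= \<^bold>0 \<^bold>\<or> Vr 0 \<^bold>= Scc (Vr 1)"
  show "derives U (?\<gamma> # \<Gamma>) \<phi>"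
  proof (rule derives_disjE)
    show "derives U (?\<gamma> # \<Gamma>) ?\<gamma>" by (rule derives_hyp) simp
    show "derives U ((Vr 0 \<^bold>= \<^bold>0) # ?\<gamma> # \<Gamma>) \<phi>" by (rule derives_weaken[OF assms(1)]) auto
    show "derives U ((Vr 0 \<^bold>= Scc (Vr 1)) # ?\<gamma> # \<Gamma>) \<phi>" by (rule derives_weaken[OF assms(2)]) auto
  qed
qed

text \<open>The smaller number is the second summand, the one on which addition recurses. Splitting
  it by the predecessor axiom lets a successor be cancelled on both sides, in an induction that
  takes place outside the theory.\<close>

lemma prv_Pls_eq_num: "U \<tturnstile> (Vr 2 \<^bold>+ Vr 0 \<^bold>= num n \<^bold>\<rightarrow> eq_upto (Vr 0) n)"
proof -
  have "derives U [Vr 2 \<^bold>+ Vr 0 \<^bold>= num n] (eq_upto (Vr 0) n)"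
  proof (induction n)
    case 0
    show ?case
    proof (rule derives_zero_or_Scc)
      show "derives U [Vr 0 \<^bold>= \<^bold>0, Vr 2 \<^bold>+ Vr 0 \<^bold>= num 0] (eq_upto (Vr 0) 0)"
        by (rule derives_hyp) simp
      let ?\<Gamma> = "[Vr 0 \<^bold>= Scc (Vr 1), Vr 2 \<^bold>+ Vr 0 \<^bold>= num 0]"
      have "derives U ?\<Gamma> (Vr 2 \<^bold>+ Vr 0 \<^bold>= Vr 2 \<^bold>+ Scc (Vr 1))"
        by (rule derives_eq_Pls[OF derives_eq_refl derives_hyp]) simp
      from derives_eq_trans[OF this derives_Pls_Scc]
      have "derives U ?\<Gamma> (Scc (Vr 2 \<^bold>+ Vr 1) \<^bold>= \<^bold>0)" by (rule derives_eq_euclid[OF _ derives_hyp]) simp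
      then show "derives U ?\<Gamma> (eq_upto (Vr 0) 0)" by (rule derives_explode[OF _ derives_Scc_neq_Zer])
    qed auto
  next
    case (Suc n)
    show ?case
    proof (rule derives_zero_or_Scc)
      show "derives U [Vr 0 \<^bold>= \<^bold>0, Vr 2 \<^bold>+ Vr 0 \<^bold>= num (Suc n)] (eq_upto (Vr 0) (Suc n))"
        by (rule derives_eq_uptoI[of _ _ _ 0], rule derives_hyp) simp_all
      let ?\<Gamma> = "[Vr 0 \<^bold>= Scc (Vr 1), Vr 2 \<^bold>+ Vr 0 \<^bold>= num (Suc n)]"
      have "derives U ?\<Gamma> (Vr 2 \<^bold>+ Vr 0 \<^bold>= Vr 2 \<^bold>+ Scc (Vr 1))"
        by (rule derives_eq_Pls[OF derives_eq_refl derives_hyp]) simp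
      from derives_eq_trans[OF this derives_Pls_Scc]
      have "derives U ?\<Gamma> (Scc (Vr 2 \<^bold>+ Vr 1) \<^bold>= Scc (num n))" by (rule derives_eq_euclid[OF _ derives_hyp]) simp
      then have "derives U ?\<Gamma> (Vr 2 \<^bold>+ Vr 1 \<^bold>= num n)" by (rule derives_Scc_inject)
      moreover have "derives U ?\<Gamma> (Vr 2 \<^bold>+ Vr 1 \<^bold>= num n \<^bold>\<rightarrow> eq_upto (Vr 1) n)"
        \<comment> \<open>The induction hypothesis speaks of \<open>Vr 0\<close>; this instance
          moves it to the predecessor \<open>Vr 1\<close>.\<close>
        using derives_instance[OF derives_impI[OF Suc, unfolded derives.simps(1)], of ?\<Gamma> "Vr 1" "Vr 1" "Vr 2"] by simp
      ultimately have "derives U ?\<Gamma> (eq_upto (Vr 1) n)" by (rule derives_mp[rotated])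
      then show "derives U ?\<Gamma> (eq_upto (Vr 0) (Suc n))"
      proof (rule derives_eq_uptoE)
        fix i assume "i \<le> n"
        let ?\<Delta> = "(Vr 1 \<^bold>= num i) # ?\<Gamma>"
        have "derives U ?\<Delta> (Vr 0 \<^bold>= Scc (Vr 1))" "derives U ?\<Delta> (Vr 1 \<^bold>= num i)"
          by (rule derives_hyp, simp)+
        from derives_eq_trans[OF this(1) derives_eq_Scc[OF this(2)]]
        have "derives U ?\<Delta> (Vr 0 \<^bold>= num (Suc i))" by simp
        then show "derives U ?\<Delta> (eq_upto (Vr 0) (Suc n))" by (rule derives_eq_uptoI) (use \<open>i \<le> n\<close> in simp)
      qed
    qed auto
  qed
  from derives_impI[OF this] show ?thesis by simp
qed

lemma derives_Leq_numD: "derives U \<Gamma> (t \<^bold>\<le> num n) \<Longrightarrow> derives U \<Gamma> (eq_upto t n)"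
proof -
  assume le: "derives U \<Gamma> (t \<^bold>\<le> num n)"
  have "U \<tturnstile> (Vr 0 \<^bold>\<le> num n \<^bold>\<leftrightarrow> Exists 2 (Vr 2 \<^bold>+ Vr 0 \<^bold>= num n))"
    using prv_subst[OF prv_Q(7), of "num n" 1] by simp
  note ax = derives_prv[OF this]
  have "derives U [Vr 0 \<^bold>\<le> num n] (Exists 2 (Vr 2 \<^bold>+ Vr 0 \<^bold>= num n))"
    by (rule derives_iffD1[OF ax derives_hyp]) simp
  then have "derives U [Vr 0 \<^bold>\<le> num n] (eq_upto (Vr 0) n)"
  proof (rule derives_exE)
    show "derives U [Vr 2 \<^bold>+ Vr 0 \<^bold>= num n, Vr 0 \<^bold>\<le> num n] (eq_upto (Vr 0) n)"
      by (rule derives_mp[OF derives_prv[OF prv_Pls_eq_num] derives_hyp]) simp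
  qed auto
  from derives_impI[OF this] have "U \<tturnstile> (Vr 0 \<^bold>\<le> num n \<^bold>\<rightarrow> eq_upto (Vr 0) n)" by simp
  from derives_instance[OF this, of \<Gamma> t] le show ?thesis using derives_mp[of U \<Gamma>] by simp
qed

lemma derives_num_Pls: "derives U \<Gamma> (num m \<^bold>+ num n \<^bold>= num (m + n))"
  by (induction n) (auto intro: derives_Pls_Zer derives_eq_trans[OF derives_Pls_Scc derives_eq_Scc])

lemma derives_num_Tms: "derives U \<Gamma> (num m \<^bold>* num n \<^bold>= num (m * n))"
proof (induction n)
  case (Suc n)
  from derives_eq_trans[OF derives_eq_trans[OF derives_Tms_Scc derives_eq_Pls[OF Suc derives_eq_refl]] derives_num_Pls]
  show ?case by (simp add: add.commute)
qed (simp add: derives_Tms_Zer)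

lemma derives_num_neq: "m \<noteq> n \<Longrightarrow> derives U \<Gamma> (\<^bold>\<not> (num m \<^bold>= num n))"
proof (induction m arbitrary: n)
  case 0
  then obtain k where n: "n = Suc k" by (cases n) auto
  show ?case
  proof (rule derives_notI)
    show "derives U ((num 0 \<^bold>= num n) # \<Gamma>) (Scc (num k) \<^bold>= \<^bold>0)"
      by (rule derives_eq_sym[OF derives_hyp]) (simp add: n)
  qed (rule derives_Scc_neq_Zer)
next
  case (Suc m)
  show ?case
  proof (cases n)
    case 0
    then show ?thesis by (simp add: derives_Scc_neq_Zer)
  next
    case (Suc k)
    show ?thesis
    proof (rule derives_notI)
      show "derives U ((num (Suc m) \<^bold>= num n) # \<Gamma>) (num m \<^bold>= num k)"
        by (rule derives_Scc_inject[OF derives_hyp]) (simp add: Suc)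
      show "derives U ((num (Suc m) \<^bold>= num n) # \<Gamma>) (\<^bold>\<not> (num m \<^bold>= num k))"
        by (rule derives_Cons[OF Suc.IH]) (use Suc Suc.prems in simp)
    qed
  qed
qed

lemma derives_num_Leq: "m \<le> n \<Longrightarrow> derives U \<Gamma> (num m \<^bold>\<le> num n)"
  using derives_LeqI[OF derives_num_Pls[of \<Gamma> "n - m" m]] by simp

lemma derives_num_not_Leq: "\<not> m \<le> n \<Longrightarrow> derives U \<Gamma> (\<^bold>\<not> (num m \<^bold>\<le> num n))"
proof (rule derives_notI')
  assume "\<not> m \<le> n"
  let ?\<Gamma> = "(num m \<^bold>\<le> num n) # \<Gamma>"
  have "derives U ?\<Gamma> (eq_upto (num m) n)" by (rule derives_Leq_numD[OF derives_hyp]) simp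
  then show "derives U ?\<Gamma> (\<^bold>\<not> (num m \<^bold>\<le> num n))"
  proof (rule derives_eq_uptoE)
    fix i assume "i \<le> n"
    show "derives U ((num m \<^bold>= num i) # ?\<Gamma>) (\<^bold>\<not> (num m \<^bold>\<le> num n))"
      by (rule derives_explode[OF derives_hyp derives_num_neq]) (use \<open>\<not> m \<le> n\<close> \<open>i \<le> n\<close> in auto)
  qed
qed

text \<open>In a model of Robinson arithmetic two arbitrary elements need not be comparable. An
  element and a numeral are, by induction on the numeral outside the theory; the uniqueness part of
  the diagonal lemma rests on this.\<close>

lemma derives_Leq_num_linear: "derives U \<Gamma> (t \<^bold>\<le> num n \<^bold>\<or> num n \<^bold>\<le> t)"
proof -
  have "U \<tturnstile> (Vr 0 \<^bold>\<le> num n \<^bold>\<or> num n \<^bold>\<le> Vr 0)"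
  proof (induction n)
    case 0
    have "derives U [] (\<^bold>0 \<^bold>\<le> Vr 0)" by (rule derives_LeqI[OF derives_Pls_Zer])
    from derives_disjI2[OF this, of "Vr 0 \<^bold>\<le> \<^bold>0"] show ?case by simp
  next
    case (Suc n)
    let ?\<phi> = "Vr 0 \<^bold>\<le> num (Suc n) \<^bold>\<or> num (Suc n) \<^bold>\<le> Vr 0"
    have "derives U [] ?\<phi>"
    proof (rule derives_zero_or_Scc)
      have "derives U [Vr 0 \<^bold>= \<^bold>0] (\<^bold>0 \<^bold>= Vr 0)" by (rule derives_eq_sym[OF derives_hyp]) simp
      from derives_eq_Leq[OF this derives_eq_refl derives_LeqI[OF derives_Pls_Zer]]
      show "derives U [Vr 0 \<^bold>= \<^bold>0] ?\<phi>" by (rule derives_disjI1)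
      let ?\<Gamma> = "[Vr 0 \<^bold>= Scc (Vr 1)]"
      have "derives U ?\<Gamma> (Vr 1 \<^bold>\<le> num n \<^bold>\<or> num n \<^bold>\<le> Vr 1)"
        using derives_instance[OF Suc, of ?\<Gamma> "Vr 1"] by simp
      then show "derives U ?\<Gamma> ?\<phi>"
      proof (rule derives_disjE)
        let ?\<Delta> = "(Vr 1 \<^bold>\<le> num n) # ?\<Gamma>"
        have "derives U ?\<Delta> (eq_upto (Vr 1) n)" by (rule derives_Leq_numD[OF derives_hyp]) simp
        then show "derives U ?\<Delta> ?\<phi>"
        proof (rule derives_eq_uptoE)
          fix i assume "i \<le> n"
          let ?\<Theta> = "(Vr 1 \<^bold>= num i) # ?\<Delta>"
          have "derives U ?\<Theta> (Vr 0 \<^bold>= Scc (Vr 1))" "derives U ?\<Theta> (Vr 1 \<^bold>= num i)"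
            by (rule derives_hyp, simp)+
          from derives_eq_sym[OF derives_eq_trans[OF this(1) derives_eq_Scc[OF this(2)]]]
          have "derives U ?\<Theta> (num (Suc i) \<^bold>= Vr 0)" by simp
          from derives_eq_Leq[OF this derives_eq_refl derives_num_Leq[of "Suc i" "Suc n"]]
          show "derives U ?\<Theta> ?\<phi>" using \<open>i \<le> n\<close> by (intro derives_disjI1) simp
        qed
      next
        let ?\<Delta> = "(num n \<^bold>\<le> Vr 1) # ?\<Gamma>"
        have "U \<tturnstile> (num n \<^bold>\<le> Vr 1 \<^bold>\<leftrightarrow> Exists 2 (Vr 2 \<^bold>+ num n \<^bold>= Vr 1))"
          using prv_subst[OF prv_Q(7), of "num n" 0] by simp
        note ax = derives_prv[OF this]
        have "derives U ?\<Delta> (Exists 2 (Vr 2 \<^bold>+ num n \<^bold>= Vr 1))"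
          by (rule derives_iffD1[OF ax derives_hyp]) simp
        then show "derives U ?\<Delta> ?\<phi>"
        proof (rule derives_exE)
          let ?\<Theta> = "(Vr 2 \<^bold>+ num n \<^bold>= Vr 1) # ?\<Delta>"
          have "derives U ?\<Theta> (Vr 0 \<^bold>= Scc (Vr 1))" "derives U ?\<Theta> (Vr 2 \<^bold>+ num n \<^bold>= Vr 1)"
            by (rule derives_hyp, simp)+
          \<comment> \<open>The summand \<open>Vr 2\<close> that witnesses the inequality for
            \<open>Vr 1\<close> also witnesses it for the successors.\<close>
          from derives_eq_trans[OF derives_Pls_Scc derives_eq_trans[OF derives_eq_Scc[OF this(2)] derives_eq_sym[OF this(1)]]]
          have "derives U ?\<Theta> (Vr 2 \<^bold>+ num (Suc n) \<^bold>= Vr 0)" by simp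
          from derives_LeqI[OF this] show "derives U ?\<Theta> ?\<phi>" by (rule derives_disjI2)
        qed auto
      qed
    qed auto
    then show ?case by simp
  qed
  from derives_instance[OF this, of \<Gamma> t] show ?thesis by simp
qed

text \<open>A variable below \<open>t\<close> is provably one of the numerals up to
  \<open>n\<close>, and Leibniz's law carries the instance for that numeral over to the
  variable.\<close>

lemma derives_BForall_num:
  assumes "\<And>k. k \<le> n \<Longrightarrow> U \<tturnstile> subst \<phi> x (num k)" "U \<tturnstile> (t \<^bold>= num n)"
  shows "U \<tturnstile> BForall x t \<phi>"
proof -
  let ?\<Gamma> = "[Vr x \<^bold>\<le> t]"
  have "derives U ?\<Gamma> (Vr x \<^bold>\<le> t)" by (rule derives_hyp) simp
  from derives_Leq_numD[OF derives_eq_Leq[OF derives_eq_refl derives_prv[OF assms(2)] this]]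
  have "derives U ?\<Gamma> \<phi>"
  proof (rule derives_eq_uptoE)
    fix k assume "k \<le> n"
    let ?\<Delta> = "(Vr x \<^bold>= num k) # ?\<Gamma>"
    have "derives U ?\<Delta> (num k \<^bold>= Vr x)" by (rule derives_eq_sym[OF derives_hyp]) simp
    from derives_eq_subst[OF this derives_prv[OF assms(1)[OF \<open>k \<le> n\<close>]]]
    show "derives U ?\<Delta> \<phi>" by simp
  qed
  from derives_impI[OF this] show ?thesis by (simp add: prv.generalization)
qed

section \<open>Provability of true Sigma_1 formulas\<close>

lemma prv_closed_term: "U \<tturnstile> (simsubstt (\<lambda>x. num (f x)) t \<^bold>= num (evalt f t))"
proof -
  have "derives U [] (simsubstt (\<lambda>x. num (f x)) t \<^bold>= num (evalt f t))"
  proof (induction t)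
    case (Pls s t)
    from derives_eq_trans[OF derives_eq_Pls[OF Pls] derives_num_Pls] show ?case by simp
  next
    case (Tms s t)
    from derives_eq_trans[OF derives_eq_Tms[OF Tms] derives_num_Tms] show ?case by simp
  next
    case (Scc t)
    from derives_eq_Scc[OF this] show ?case by simp
  qed (simp_all only: simsubstt.simps evalt.simps num.simps derives_eq_refl)
  then show ?thesis by simp
qed

lemma prv_BForall:
  assumes "\<And>k. k \<le> evalt f t \<Longrightarrow> U \<tturnstile> simsubst (\<lambda>y. num ((f(x := k)) y)) \<phi>" "x \<notin> fvt t"
  shows "U \<tturnstile> simsubst (\<lambda>y. num (f y)) (BForall x t \<phi>)"
  unfolding simsubst_BForall[OF assms(2)]
  by (rule derives_BForall_num[OF _ prv_closed_term]) (simp only: subst_simsubst_num assms(1))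

lemma prv_Eql:
  assumes "evalt f s = evalt f t"
  shows "U \<tturnstile> simsubst (\<lambda>y. num (f y)) (s \<^bold>= t)"
proof -
  have "derives U [] (num (evalt f u) \<^bold>= simsubstt (\<lambda>y. num (f y)) u)" for u
    by (rule derives_eq_sym[OF derives_prv[OF prv_closed_term]])
  from derives_eq_euclid[OF this[of s] this[of t, folded assms]] show ?thesis by simp
qed

lemma prv_Leq:
  assumes "evalt f s \<le> evalt f t"
  shows "U \<tturnstile> simsubst (\<lambda>y. num (f y)) (s \<^bold>\<le> t)"
proof -
  have "derives U [] (num (evalt f u) \<^bold>= simsubstt (\<lambda>y. num (f y)) u)" for u
    by (rule derives_eq_sym[OF derives_prv[OF prv_closed_term]])
  from derives_eq_Leq[OF this this derives_num_Leq[OF assms]] show ?thesis by simp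
qed

text \<open>Provability and refutability are shown together because negations and antecedents
  exchange them.\<close>

theorem sigma0_complete:
  "sigma0 \<phi> \<Longrightarrow> (sat f \<phi> \<longrightarrow> (U \<tturnstile> simsubst (\<lambda>x. num (f x)) \<phi>)) \<and>
    (\<not> sat f \<phi> \<longrightarrow> (U \<tturnstile> (\<^bold>\<not> simsubst (\<lambda>x. num (f x)) \<phi>)))"
proof (induction \<phi> arbitrary: f rule: sigma0.induct)
  case (1 s t)
  let ?s = "simsubstt (\<lambda>x. num (f x)) s" and ?t = "simsubstt (\<lambda>x. num (f x)) t"
  have eq: "derives U \<Gamma> (?s \<^bold>= num (evalt f s))" "derives U \<Gamma> (?t \<^bold>= num (evalt f t))" for \<Gamma>
    by (rule derives_prv[OF prv_closed_term])+
  have "derives U [] (\<^bold>\<not> (?s \<^bold>= ?t))" if "evalt f s \<noteq> evalt f t"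
  proof (rule derives_notI[OF _ derives_num_neq[OF that]])
    have "derives U [?s \<^bold>= ?t] (?s \<^bold>= ?t)" by (rule derives_hyp) simp
    from derives_eq_trans[OF derives_eq_euclid[OF eq(1) this] eq(2)]
    show "derives U [?s \<^bold>= ?t] (num (evalt f s) \<^bold>= num (evalt f t))" .
  qed
  then show ?case using prv_Eql[of f s t] by auto
next
  case (2 s t)
  let ?s = "simsubstt (\<lambda>x. num (f x)) s" and ?t = "simsubstt (\<lambda>x. num (f x)) t"
  have eq: "derives U \<Gamma> (?s \<^bold>= num (evalt f s))" "derives U \<Gamma> (?t \<^bold>= num (evalt f t))" for \<Gamma>
    by (rule derives_prv[OF prv_closed_term])+
  have "derives U [] (\<^bold>\<not> (?s \<^bold>\<le> ?t))" if "\<not> evalt f s \<le> evalt f t"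
  proof (rule derives_notI[OF _ derives_num_not_Leq[OF that]])
    have "derives U [?s \<^bold>\<le> ?t] (?s \<^bold>\<le> ?t)" by (rule derives_hyp) simp
    from derives_eq_Leq[OF eq this]
    show "derives U [?s \<^bold>\<le> ?t] (num (evalt f s) \<^bold>\<le> num (evalt f t))" .
  qed
  then show ?case using prv_Leq[of f s t] by auto
next
  case (3 \<phi>)
  then show ?case using prv_notnotI by auto
next
  case (4 \<phi> \<psi>)
  let ?\<phi> = "simsubst (\<lambda>x. num (f x)) \<phi>" and ?\<psi> = "simsubst (\<lambda>x. num (f x)) \<psi>"
  have "derives U [] (?\<phi> \<^bold>\<rightarrow> ?\<psi>)" if "U \<tturnstile> (\<^bold>\<not> ?\<phi>)"
    by (rule derives_impI[OF derives_explode[OF derives_hyp derives_prv[OF that]]]) simp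
  moreover have "derives U [] (\<^bold>\<not> (?\<phi> \<^bold>\<rightarrow> ?\<psi>))" if "U \<tturnstile> ?\<phi>" "U \<tturnstile> (\<^bold>\<not> ?\<psi>)"
    by (rule derives_notI[OF derives_mp[OF derives_hyp derives_prv[OF that(1)]] derives_prv[OF that(2)]]) simp
  ultimately show ?case using "4.IH"[of f] prv_K[of U ?\<psi> ?\<phi>] by auto
next
  case (5 \<phi> x t)
  have "U \<tturnstile> (\<^bold>\<not> simsubst (\<lambda>x. num (f x)) (BForall x t \<phi>))" if not: "\<not> sat f (BForall x t \<phi>)"
  proof -
    \<comment> \<open>The bound is read in the updated environment, so that both parts of the
      counterexample fit the instance of the whole matrix at \<open>k\<close>.\<close>
    from not have "\<exists>k. evalt (f(x := k)) (Vr x) \<le> evalt (f(x := k)) t \<and> \<not> sat (f(x := k)) \<phi>"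
      by simp
    then obtain k where k: "evalt (f(x := k)) (Vr x) \<le> evalt (f(x := k)) t" "\<not> sat (f(x := k)) \<phi>" by blast
    let ?\<sigma> = "\<lambda>y. num ((f(x := k)) y)"
    let ?F = "simsubst (\<lambda>x. num (f x)) (BForall x t \<phi>)"
    have "derives U [?F] (simsubst ?\<sigma> (Vr x \<^bold>\<le> t \<^bold>\<rightarrow> \<phi>))"
      using derives_allE[of U "[?F]" x "simsubst ((\<lambda>x. num (f x))(x := Vr x)) (Vr x \<^bold>\<le> t \<^bold>\<rightarrow> \<phi>)" "num k"]
        derives_hyp[of ?F "[?F]" U]
      unfolding subst_simsubst_num by (simp del: fun_upd_apply)
    then have imp: "derives U [?F] (simsubst ?\<sigma> (Vr x \<^bold>\<le> t) \<^bold>\<rightarrow> simsubst ?\<sigma> \<phi>)" by simp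
    note 1 = derives_mp[OF imp derives_prv[OF prv_Leq[OF k(1)]]]
    have "U \<tturnstile> (\<^bold>\<not> simsubst ?\<sigma> \<phi>)" using "5.IH"[of "f(x := k)"] k(2) by blast
    from derives_notI[OF 1 derives_prv[OF this]] show ?thesis by simp
  qed
  moreover have "U \<tturnstile> simsubst (\<lambda>x. num (f x)) (BForall x t \<phi>)" if "sat f (BForall x t \<phi>)"
  proof (rule prv_BForall[OF _ \<open>x \<notin> fvt t\<close>])
    fix k assume "k \<le> evalt f t"
    then have "sat (f(x := k)) \<phi>" using that \<open>x \<notin> fvt t\<close> by (simp add: evalt_fun_upd)
    then show "U \<tturnstile> simsubst (\<lambda>y. num ((f(x := k)) y)) \<phi>" using "5.IH"[of "f(x := k)"] by blast
  qed
  ultimately show ?case by blast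
next
  case (6 \<phi> x t)
  have "U \<tturnstile> (\<^bold>\<not> simsubst (\<lambda>x. num (f x)) (BExists x t \<phi>))" if not: "\<not> sat f (BExists x t \<phi>)"
  proof -
    \<comment> \<open>A false bounded existential is refuted by proving the dual bounded universal
      formula.\<close>
    have "U \<tturnstile> simsubst (\<lambda>x. num (f x)) (BForall x t (\<^bold>\<not> \<phi>))"
    proof (rule prv_BForall[OF _ \<open>x \<notin> fvt t\<close>])
      fix k assume "k \<le> evalt f t"
      then have "\<not> sat (f(x := k)) \<phi>" using that \<open>x \<notin> fvt t\<close> by (simp add: evalt_fun_upd)
      then show "U \<tturnstile> simsubst (\<lambda>y. num ((f(x := k)) y)) (\<^bold>\<not> \<phi>)"
        using "6.IH"[of "f(x := k)"] by (simp del: fun_upd_apply)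
    qed
    then show ?thesis
      using prv_not_Exists[of U x "simsubst ((\<lambda>x. num (f x))(x := Vr x)) (Vr x \<^bold>\<le> t)" "simsubst ((\<lambda>x. num (f x))(x := Vr x)) \<phi>"]
      by (simp only: simsubst.simps)
  qed
  moreover have "U \<tturnstile> simsubst (\<lambda>x. num (f x)) (BExists x t \<phi>)" if "sat f (BExists x t \<phi>)"
  proof -
    from that obtain k where k: "evalt (f(x := k)) (Vr x) \<le> evalt (f(x := k)) t" "sat (f(x := k)) \<phi>" by auto
    then have "U \<tturnstile> simsubst (\<lambda>y. num ((f(x := k)) y)) \<phi>" using "6.IH"[of "f(x := k)"] by blast
    from prv_conjI[OF prv_Leq[OF k(1)] this]
    show ?thesis by (intro prv_Exists[of U f x k]) (simp del: fun_upd_apply)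
  qed
  ultimately show ?case by blast
qed

text \<open>A false unbounded existential may be irrefutable, so only truth is transferred here; for
  a true one the standard model supplies a numeral as witness.\<close>

theorem sigma1_complete:
  "sigma1 \<phi> \<Longrightarrow> sat f \<phi> \<Longrightarrow> U \<tturnstile> simsubst (\<lambda>x. num (f x)) \<phi>"
proof (induction \<phi> arbitrary: f rule: sigma1.induct)
  case (1 \<phi>)
  then show ?case using sigma0_complete by blast
next
  case (2 \<phi> \<psi>)
  then show ?case using prv_conjI by simp
next
  case (3 \<phi> \<psi>)
  let ?\<phi> = "simsubst (\<lambda>x. num (f x)) \<phi>" and ?\<psi> = "simsubst (\<lambda>x. num (f x)) \<psi>"
  show ?case
  proof (cases "sat f \<phi>")
    case True
    then have "derives U [] ?\<phi>" using "3.IH"(1) by simp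
    from derives_disjI1[OF this, of ?\<psi>] show ?thesis by simp
  next
    case False
    then have "derives U [] ?\<psi>" using "3.IH"(2) "3.prems" by simp
    from derives_disjI2[OF this, of ?\<phi>] show ?thesis by simp
  qed
next
  case (4 \<phi> x)
  then obtain k where "sat (f(x := k)) \<phi>" by auto
  from prv_Exists[OF "4.IH"[OF this]] show ?case .
next
  case (5 \<phi> x t)
  show ?case
  proof (rule prv_BForall[OF _ \<open>x \<notin> fvt t\<close>])
    fix k assume "k \<le> evalt f t"
    then have "sat (f(x := k)) \<phi>" using "5.prems" \<open>x \<notin> fvt t\<close> by (simp add: evalt_fun_upd)
    then show "U \<tturnstile> simsubst (\<lambda>y. num ((f(x := k)) y)) \<phi>" by (rule "5.IH")
  qed
qed

corollary sigma1_sentence_complete: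
  assumes "sigma1 \<phi>" "sentence \<phi>" "sat f \<phi>"
  shows "U \<tturnstile> \<phi>"
proof -
  have "simsubst (\<lambda>x. num (f x)) \<phi> = simsubst Vr \<phi>"
    using assms(2) by (intro simsubst_cong) (simp add: sentence_def)
  then show ?thesis using sigma1_complete[OF assms(1,3)] by simp
qed

end

section \<open>Coding of finite sequences\<close>

definition beta :: "nat \<Rightarrow> nat \<Rightarrow> nat \<Rightarrow> nat"
  where "beta c d i = c mod Suc (Suc i * d)"

text \<open>Goedel's beta lemma, by the Chinese remainder theorem for the moduli
  \<open>Suc (Suc i * d)\<close>.\<close>

lemma ex_beta: "\<exists>c d. \<forall>i < length xs. beta c d i = xs ! i"
proof -
  let ?n = "length xs"
  \<comment> \<open>The length in the factorial makes every difference of indices divide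
    \<open>d\<close>; the sum makes \<open>d\<close> at least as large as every entry, so an entry
    is its own remainder.\<close>
  define d :: nat where "d = fact (?n + sum_list xs)"
  have "coprime (Suc (Suc i * d)) (Suc (Suc j * d))" if "i < j" "j < ?n" for i j
  proof (rule ccontr)
    assume "\<not> coprime (Suc (Suc i * d)) (Suc (Suc j * d))"
    then obtain p where p: "prime p" "p dvd Suc (Suc i * d)" "p dvd Suc (Suc j * d)"
      by (metis gcd_nat.bounded_iff not_coprimeE prime_factor_nat is_unit_gcd coprime_iff_gcd_eq_1)
    \<comment> \<open>A common prime divides this difference of moduli. As \<open>j - i\<close>
      divides \<open>d\<close>, the prime divides \<open>d\<close> and hence 1.\<close>
    have "Suc (Suc j * d) - Suc (Suc i * d) = (j - i) * d" by (simp add: diff_mult_distrib)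
    then have "p dvd (j - i) * d" using dvd_diff_nat[OF p(3,2)] by simp
    moreover have "j - i dvd d" unfolding d_def using that by (intro dvd_fact) auto
    ultimately have "p dvd d" using p(1) by (meson dvd_trans prime_dvd_mult_iff)
    then have "p dvd 1" using p(2) by (metis dvd_add_right_iff dvd_mult plus_1_eq_Suc add.commute)
    then show False using p(1) by simp
  qed
  then have "\<forall>i \<in> {..<?n}. \<forall>j \<in> {..<?n}. i \<noteq> j \<longrightarrow> coprime (Suc (Suc i * d)) (Suc (Suc j * d))"
    by (metis coprime_commute lessThan_iff linorder_neqE_nat)
  from chinese_remainder_nat[OF _ this, of "(!) xs"]
  obtain c where c: "\<forall>i < ?n. [c = xs ! i] (mod Suc (Suc i * d))" by auto
  have "beta c d i = xs ! i" if "i < ?n" for i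
  proof -
    have "xs ! i \<le> sum_list xs" using that by (simp add: member_le_sum_list)
    also have "\<dots> \<le> d" unfolding d_def using fact_ge_self le_trans le_add2 by blast
    finally have "xs ! i < Suc (Suc i * d)" by simp
    then show ?thesis using c that by (simp add: beta_def cong_def)
  qed
  then show ?thesis by blast
qed

section \<open>Truth conditions for coded sequences\<close>

lemma sat_Con: "sat e (\<phi> \<^bold>\<and> \<psi>) \<longleftrightarrow> sat e \<phi> \<and> sat e \<psi>" by simp
lemma sat_Dis: "sat e (\<phi> \<^bold>\<or> \<psi>) \<longleftrightarrow> sat e \<phi> \<or> sat e \<psi>" by auto
lemma sat_Exists: "sat e (Exists x \<phi>) \<longleftrightarrow> (\<exists>n. sat (e(x := n)) \<phi>)" by simp
lemma sat_neq: "sat e (\<^bold>\<not> (s \<^bold>= t)) \<longleftrightarrow> evalt e s \<noteq> evalt e t" by simp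

text \<open>These rules read the abbreviations as units. The rules \<open>sat.simps(3-5)\<close>
  would dissolve conjunctions and existential quantifiers into negations and implications, so they
  are deleted where the schemas are evaluated.\<close>

lemmas sat_simps = sat_Con sat_Dis sat_Exists sat_neq sat.simps(1,2)

lemma evalt_pairT [simp]: "evalt e (pairT s t) = pair (evalt e s) (evalt e t)"
  by (simp add: pairT_def pair_def)

lemma fvt_pairT [simp]: "fvt (pairT s t) = fvt s \<union> fvt t"
  by (auto simp: pairT_def)

lemma sat_betaF:
  assumes "1 \<notin> fvt c \<union> fvt d \<union> fvt i \<union> fvt z"
  shows "sat e (betaF c d i z) \<longleftrightarrow> beta (evalt e c) (evalt e d) (evalt e i) = evalt e z"
proof -
  have "(\<exists>q. c' = q * Suc m + z') \<and> z' \<le> m \<longleftrightarrow> c' mod Suc m = z'" for c' z' m :: nat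
  proof
    assume "(\<exists>q. c' = q * Suc m + z') \<and> z' \<le> m"
    then show "c' mod Suc m = z'" by (auto simp del: mult_Suc_right)
  next
    assume "c' mod Suc m = z'"
    then have "c' = c' div Suc m * Suc m + z'" "z' \<le> m"
      using div_mult_mod_eq[of c' "Suc m"] mod_less_divisor[of "Suc m" c'] by (auto simp del: mult_Suc_right)
    then show "(\<exists>q. c' = q * Suc m + z') \<and> z' \<le> m" by blast
  qed
  then show ?thesis using assms by (simp add: betaF_def beta_def evalt_fun_upd del: mult_Suc)
qed

definition earlier :: "nat \<Rightarrow> nat \<Rightarrow> nat \<Rightarrow> nat set"
  where "earlier c d i = {w. \<exists>j < i. beta c d j = w}"

lemma sat_earlierF:
  assumes "{1, 2} \<inter> (fvt c \<union> fvt d \<union> fvt i \<union> fvt w) = {}"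
  shows "sat e (earlierF c d i w) \<longleftrightarrow> evalt e w \<in> earlier (evalt e c) (evalt e d) (evalt e i)"
  using assms
  by (auto simp: earlierF_def earlier_def sat_simps sat_betaF evalt_fun_upd Suc_le_eq simp del: sat.simps(3-5))

section \<open>Inductive sets given by construction sequences\<close>

definition justified :: "(nat set \<Rightarrow> nat \<Rightarrow> bool) \<Rightarrow> nat list \<Rightarrow> bool"
  where "justified S xs \<longleftrightarrow> (\<forall>i < length xs. S (set (take i xs)) (xs ! i))"

text \<open>For monotone \<open>S\<close> this is an inductively generated set, presented through
  finite construction sequences because those are what the beta function codes.\<close>

definition constructible :: "(nat set \<Rightarrow> nat \<Rightarrow> bool) \<Rightarrow> nat set"
  where "constructible S = {z. \<exists>xs. justified S xs \<and> z \<in> set xs}"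

lemma mono_stepD: "mono S \<Longrightarrow> P \<subseteq> P' \<Longrightarrow> S P z \<Longrightarrow> S P' z" for S :: "nat set \<Rightarrow> nat \<Rightarrow> bool"
  unfolding mono_def le_fun_def le_bool_def by blast

lemma justified_append:
  assumes "mono S" "justified S xs" "justified S ys"
  shows "justified S (xs @ ys)"
  unfolding justified_def
proof (intro allI impI)
  fix i assume i: "i < length (xs @ ys)"
  show "S (set (take i (xs @ ys))) ((xs @ ys) ! i)"
  proof (cases "i < length xs")
    case True
    then show ?thesis using assms(2) by (simp add: justified_def nth_append)
  next
    case False
    with i have "S (set (take (i - length xs) ys)) (ys ! (i - length xs))"
      using assms(3) by (simp add: justified_def)
    then have "S (set (take i (xs @ ys))) (ys ! (i - length xs))"
      by (rule mono_stepD[OF assms(1), rotated]) auto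
    with False show ?thesis by (simp add: nth_append)
  qed
qed

text \<open>Construction sequences of the finitely many premises are concatenated and
  \<open>z\<close> is put at the end. By monotonicity a justification survives when more entries
  precede it.\<close>

lemma constructibleI:
  assumes "mono S" "finite P" "P \<subseteq> constructible S" "S P z"
  shows "z \<in> constructible S"
proof -
  from assms(2,3) have "\<exists>xs. justified S xs \<and> P \<subseteq> set xs"
  proof (induction P rule: finite_induct)
    case empty
    then show ?case by (auto simp: justified_def intro: exI[of _ "[]"])
  next
    case (insert a P)
    then obtain xs ys where "justified S xs" "P \<subseteq> set xs" "justified S ys" "a \<in> set ys"
      by (auto simp: constructible_def)
    then show ?case using justified_append[OF assms(1)] by (intro exI[of _ "xs @ ys"]) auto
  qed
  then obtain xs where xs: "justified S xs" "P \<subseteq> set xs" by blast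
  with mono_stepD[OF assms(1) xs(2) assms(4)] have "justified S (xs @ [z])"
    by (auto simp: justified_def nth_append less_Suc_eq)
  then show ?thesis by (auto simp: constructible_def)
qed

text \<open>The value of \<open>n\<close> is a last index and not a length, and the list may
  continue beyond it.\<close>

lemma sat_seqF:
  assumes "justified S xs" "e n < length xs" "\<And>i. i < length xs \<Longrightarrow> beta (e a) (e b) i = xs ! i"
    and vars: "2 < k" "{a, b, n} \<inter> {1, 2, k, k + 1} = {}"
    and step: "\<And>i z. S (earlier (e a) (e b) i) z \<Longrightarrow>
      sat (e(k := i, k + 1 := z)) (step (earlierF (Vr a) (Vr b) (Vr k)) (Vr (k + 1)))"
  shows "sat e (seqF k step (Vr a) (Vr b) (Vr n))"
proof -
  have "\<exists>z. sat (e(k := i, k + 1 := z)) (betaF (Vr a) (Vr b) (Vr k) (Vr (k + 1)) \<^bold>\<and>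
      step (earlierF (Vr a) (Vr b) (Vr k)) (Vr (k + 1)))" if "i \<le> e n" for i
  proof
    have i: "i < length xs" using that assms(2) by simp
    \<comment> \<open>Decoded entries agree with the list, so those before \<open>i\<close> form its
      initial segment.\<close>
    have "earlier (e a) (e b) i = beta (e a) (e b) ` {0..<i}" by (auto simp: earlier_def)
    also have "\<dots> = (!) xs ` {0..<i}" using assms(3) i by (intro image_cong) auto
    also have "\<dots> = set (take i xs)" using i by (intro nth_image) simp
    finally have "earlier (e a) (e b) i = set (take i xs)" .
    then have "S (earlier (e a) (e b) i) (xs ! i)" using assms(1) i by (simp add: justified_def)
    from step[OF this]
    show "sat (e(k := i, k + 1 := xs ! i)) (betaF (Vr a) (Vr b) (Vr k) (Vr (k + 1)) \<^bold>\<and>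
      step (earlierF (Vr a) (Vr b) (Vr k)) (Vr (k + 1)))"
      using vars assms(3) i by (auto simp: sat_Con sat_betaF simp del: sat.simps(3-5))
  qed
  then show ?thesis using vars by (auto simp: seqF_def)
qed

text \<open>The premise \<open>step\<close> ranges over all environments that agree with
  \<open>e\<close> outside a block of five variables. The block carries the code, the position and
  the entry, while the parameters of a schema keep their values.\<close>

lemma sat_constructibleF:
  assumes "evalt e x \<in> constructible S"
    and vars: "2 < k" "fvt x \<inter> {1, k, k + 1, k + 2} = {}"
    and step: "\<And>e' . (\<And>v. v \<notin> {k..k + 4} \<Longrightarrow> e' v = e v) \<Longrightarrow>
      S (earlier (e' k) (e' (k + 1)) (e' (k + 3))) (e' (k + 4)) \<Longrightarrow>
      sat e' (step (earlierF (Vr k) (Vr (k + 1)) (Vr (k + 3))) (Vr (k + 4)))"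
  shows "sat e (constructibleF k step x)"
proof -
  from assms(1) obtain xs n where xs: "justified S xs" "n < length xs" "evalt e x = xs ! n"
    by (auto simp: constructible_def in_set_conv_nth)
  obtain c d where cd: "\<forall>i < length xs. beta c d i = xs ! i" using ex_beta by blast
  \<comment> \<open>The code stops at the index \<open>n\<close> at which the wanted number
    occurs.\<close>
  let ?e = "e(k := c, k + 1 := d, k + 2 := n)"
  have x: "evalt ?e x = evalt e x" by (rule evalt_cong) (use vars(2) in auto)
  have "sat ?e (betaF (Vr k) (Vr (k + 1)) (Vr (k + 2)) x)"
    using vars x xs cd by (subst sat_betaF) auto
  moreover have "sat ?e (seqF (k + 3) step (Vr k) (Vr (k + 1)) (Vr (k + 2)))"
  proof (rule sat_seqF[OF xs(1)])
    fix i z assume *: "S (earlier (?e k) (?e (k + 1)) i) z"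
    let ?e' = "?e(k + 3 := i, k + 4 := z)"
    have "sat ?e' (step (earlierF (Vr k) (Vr (k + 1)) (Vr (k + 3))) (Vr (k + 4)))"
    proof (rule step)
      show "?e' v = e v" if "v \<notin> {k..k + 4}" for v using that by auto
      show "S (earlier (?e' k) (?e' (k + 1)) (?e' (k + 3))) (?e' (k + 4))" using * by simp
    qed
    then show "sat (?e(k + 3 := i, k + 3 + 1 := z))
      (step (earlierF (Vr k) (Vr (k + 1)) (Vr (k + 3))) (Vr (k + 3 + 1)))"
      by (simp add: numeral_eq_Suc)
  qed (use vars xs cd in auto)
  ultimately show ?thesis unfolding constructibleF_def sat_Exists sat_Con by blast
qed

section \<open>Truth of the provability predicate\<close>

text \<open>The step of \<open>termF\<close> as an operator on sets of numbers; the later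
  definitions ending in \<open>S\<close> do the same for the other schemas.\<close>

definition termS :: "nat set \<Rightarrow> nat \<Rightarrow> bool" where
  "termS P z \<longleftrightarrow> z = pair 0 0 \<or> (\<exists>v. z = pair 1 v) \<or> (\<exists>a. a \<in> P \<and> z = pair 2 a) \<or>
    (\<exists>a b. a \<in> P \<and> b \<in> P \<and> (z = pair 3 (pair a b) \<or> z = pair 4 (pair a b)))"

lemma mono_termS: "mono termS"
  unfolding termS_def mono_def le_fun_def le_bool_def by blast

lemma gnt_termS: "gnt t \<in> constructible termS"
proof (induction t)
  case Zer
  have "termS {} (gnt \<^bold>0)" unfolding termS_def gnt.simps by blast
  from constructibleI[OF mono_termS _ _ this] show ?case by simp
next
  case (Vr x)
  have "termS {} (gnt (Vr x))" unfolding termS_def gnt.simps by blast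
  from constructibleI[OF mono_termS _ _ this] show ?case by simp
next
  case (Scc t)
  have "termS {gnt t} (gnt (Scc t))" unfolding termS_def gnt.simps by blast
  from constructibleI[OF mono_termS _ _ this] Scc show ?case by simp
next
  case (Pls s t)
  have "termS {gnt s, gnt t} (gnt (s \<^bold>+ t))" unfolding termS_def gnt.simps by blast
  from constructibleI[OF mono_termS _ _ this] Pls show ?case by simp
next
  case (Tms s t)
  have "termS {gnt s, gnt t} (gnt (s \<^bold>* t))" unfolding termS_def gnt.simps by blast
  from constructibleI[OF mono_termS _ _ this] Tms show ?case by simp
qed

lemma sat_termF:
  assumes "evalt e x = gnt t" "fvt x \<inter> ({1, 2} \<union> {10..<20}) = {}"
  shows "sat e (termF x)"
  unfolding termF_def
proof (rule sat_constructibleF[where S = termS], goal_cases)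
  case (4 e')
  then show ?case by (simp add: termS_def sat_simps sat_earlierF del: sat.simps(3-5))
qed (use assms gnt_termS in auto)

text \<open>Atoms are described through genuine terms instead of the formula \<open>termF\<close>,
  since \<open>sat_termF\<close> already turns codes of terms into truths.\<close>

definition formulaS :: "nat set \<Rightarrow> nat \<Rightarrow> bool" where
  "formulaS P z \<longleftrightarrow> (\<exists>s t. z = gn (s \<^bold>= t) \<or> z = gn (s \<^bold>\<le> t)) \<or> (\<exists>a. a \<in> P \<and> z = pair 7 a) \<or>
    (\<exists>a b. a \<in> P \<and> b \<in> P \<and> z = pair 8 (pair a b)) \<or> (\<exists>v a. a \<in> P \<and> z = pair 9 (pair v a))"

lemma mono_formulaS: "mono formulaS"
  unfolding formulaS_def mono_def le_fun_def le_bool_def by blast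

lemma gn_formulaS: "gn \<phi> \<in> constructible formulaS"
proof (induction \<phi>)
  case (Eql s t)
  have "formulaS {} (gn (s \<^bold>= t))" unfolding formulaS_def by blast
  from constructibleI[OF mono_formulaS _ _ this] show ?case by simp
next
  case (Leq s t)
  have "formulaS {} (gn (s \<^bold>\<le> t))" unfolding formulaS_def by blast
  from constructibleI[OF mono_formulaS _ _ this] show ?case by simp
next
  case (Neg \<phi>)
  have "formulaS {gn \<phi>} (gn (\<^bold>\<not> \<phi>))" unfolding formulaS_def gn.simps by blast
  from constructibleI[OF mono_formulaS _ _ this] Neg show ?case by simp
next
  case (Imp \<phi> \<psi>)
  have "formulaS {gn \<phi>, gn \<psi>} (gn (\<phi> \<^bold>\<rightarrow> \<psi>))" unfolding formulaS_def gn.simps by blast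
  from constructibleI[OF mono_formulaS _ _ this] Imp show ?case by simp
next
  case (Forall x \<phi>)
  have "formulaS {gn \<phi>} (gn (Forall x \<phi>))" unfolding formulaS_def gn.simps by blast
  from constructibleI[OF mono_formulaS _ _ this] Forall show ?case by simp
qed

lemma sat_formulaF:
  assumes "evalt e x = gn \<phi>" "fvt x \<inter> ({1, 2} \<union> {20..<30}) = {}"
  shows "sat e (formulaF x)"
  unfolding formulaF_def
proof (rule sat_constructibleF[where S = formulaS], goal_cases)
  case (4 e')
  have "sat (e'(25 := gnt s, 26 := b)) (termF (Vr 25))" "sat (e'(25 := b, 26 := gnt s)) (termF (Vr 26))" for s b
    by (rule sat_termF[where t = s]; simp)+
  with 4(2) show ?case
    unfolding formulaS_def gn.simps by (simp add: sat_simps sat_earlierF del: sat.simps(3-5)) blast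
qed (use assms gn_formulaS in auto)

definition not_in_termS :: "nat \<Rightarrow> nat set \<Rightarrow> nat \<Rightarrow> bool" where
  "not_in_termS x P z \<longleftrightarrow> z = pair 0 0 \<or> (\<exists>v. v \<noteq> x \<and> z = pair 1 v) \<or> (\<exists>a. a \<in> P \<and> z = pair 2 a) \<or>
    (\<exists>a b. a \<in> P \<and> b \<in> P \<and> (z = pair 3 (pair a b) \<or> z = pair 4 (pair a b)))"

lemma mono_not_in_termS: "mono (not_in_termS x)"
  unfolding not_in_termS_def mono_def le_fun_def le_bool_def by blast

lemma gnt_not_in_termS: "x \<notin> fvt t \<Longrightarrow> gnt t \<in> constructible (not_in_termS x)"
proof (induction t)
  case Zer
  have "not_in_termS x {} (gnt \<^bold>0)" unfolding not_in_termS_def gnt.simps by blast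
  from constructibleI[OF mono_not_in_termS _ _ this] show ?case by simp
next
  case (Vr y)
  then have "y \<noteq> x" by auto
  then have "not_in_termS x {} (gnt (Vr y))" unfolding not_in_termS_def gnt.simps by blast
  from constructibleI[OF mono_not_in_termS _ _ this] show ?case by simp
next
  case (Scc t)
  have "not_in_termS x {gnt t} (gnt (Scc t))" unfolding not_in_termS_def gnt.simps by blast
  from constructibleI[OF mono_not_in_termS _ _ this] Scc show ?case by simp
next
  case (Pls s t)
  have "not_in_termS x {gnt s, gnt t} (gnt (s \<^bold>+ t))" unfolding not_in_termS_def gnt.simps by blast
  from constructibleI[OF mono_not_in_termS _ _ this] Pls show ?case by simp
next
  case (Tms s t)
  have "not_in_termS x {gnt s, gnt t} (gnt (s \<^bold>* t))" unfolding not_in_termS_def gnt.simps by blast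
  from constructibleI[OF mono_not_in_termS _ _ this] Tms show ?case by simp
qed

lemma sat_not_in_termF:
  assumes "evalt e y = gnt t" "evalt e x \<notin> fvt t"
    and "fvt x \<inter> ({1, 2} \<union> {30..<40}) = {}" "fvt y \<inter> ({1, 2} \<union> {30..<40}) = {}"
  shows "sat e (not_in_termF x y)"
  unfolding not_in_termF_def
proof (rule sat_constructibleF[where S = "not_in_termS (evalt e x)"], goal_cases)
  case (4 e')
  have "e' v = e v" if "v \<in> fvt x" for v
    by (rule 4(1)) (use assms(3) that in \<open>auto simp: disjoint_iff\<close>)
  then have x: "evalt (e'(35 := a)) x = evalt e x" for a
    by (intro evalt_cong) (use assms(3) in \<open>auto simp: disjoint_iff\<close>)
  from 4(2) show ?case by (simp add: not_in_termS_def sat_simps sat_earlierF x del: sat.simps(3-5))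
qed (use assms gnt_not_in_termS in auto)

definition not_freeS :: "nat \<Rightarrow> nat set \<Rightarrow> nat \<Rightarrow> bool" where
  "not_freeS x P z \<longleftrightarrow>
    (\<exists>s t. x \<notin> fvt s \<and> x \<notin> fvt t \<and> (z = gn (s \<^bold>= t) \<or> z = gn (s \<^bold>\<le> t))) \<or>
    (\<exists>a. a \<in> P \<and> z = pair 7 a) \<or>
    (\<exists>a b. a \<in> P \<and> b \<in> P \<and> z = pair 8 (pair a b)) \<or>
    (\<exists>v a. a \<in> P \<and> z = pair 9 (pair v a)) \<or>
    (\<exists>\<phi>. z = gn (Forall x \<phi>))"

lemma mono_not_freeS: "mono (not_freeS x)"
  unfolding not_freeS_def mono_def le_fun_def le_bool_def by blast

lemma gn_not_freeS: "x \<notin> fv \<phi> \<Longrightarrow> gn \<phi> \<in> constructible (not_freeS x)"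
proof (induction \<phi>)
  case (Eql s t)
  then have "not_freeS x {} (gn (s \<^bold>= t))" unfolding not_freeS_def by auto
  from constructibleI[OF mono_not_freeS _ _ this] show ?case by simp
next
  case (Leq s t)
  then have "not_freeS x {} (gn (s \<^bold>\<le> t))" unfolding not_freeS_def by auto
  from constructibleI[OF mono_not_freeS _ _ this] show ?case by simp
next
  case (Neg \<phi>)
  have "not_freeS x {gn \<phi>} (gn (\<^bold>\<not> \<phi>))" unfolding not_freeS_def gn.simps by blast
  from constructibleI[OF mono_not_freeS _ _ this] Neg show ?case by simp
next
  case (Imp \<phi> \<psi>)
  have "not_freeS x {gn \<phi>, gn \<psi>} (gn (\<phi> \<^bold>\<rightarrow> \<psi>))" unfolding not_freeS_def gn.simps by blast
  from constructibleI[OF mono_not_freeS _ _ this] Imp show ?case by simp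
next
  case (Forall y \<phi>)
  show ?case
  proof (cases "y = x")
    case True
    then have "not_freeS x {} (gn (Forall y \<phi>))" unfolding not_freeS_def by blast
    from constructibleI[OF mono_not_freeS _ _ this] show ?thesis by simp
  next
    case False
    have "not_freeS x {gn \<phi>} (gn (Forall y \<phi>))" unfolding not_freeS_def gn.simps by blast
    from constructibleI[OF mono_not_freeS _ _ this] Forall False show ?thesis by simp
  qed
qed

lemma sat_not_freeF:
  assumes "evalt e y = gn \<phi>" "evalt e x \<notin> fv \<phi>"
    and "fvt x \<inter> ({1, 2} \<union> {30..<50}) = {}" "fvt y \<inter> ({1, 2} \<union> {40..<50}) = {}"
  shows "sat e (not_freeF x y)"
  unfolding not_freeF_def
proof (rule sat_constructibleF[where S = "not_freeS (evalt e x)"], goal_cases)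
  case (4 e')
  have "e' v = e v" if "v \<in> fvt x" for v
    by (rule 4(1)) (use assms(3) that in \<open>auto simp: disjoint_iff\<close>)
  then have x: "evalt (e'(45 := a, 46 := b)) x = evalt e x" "evalt (e'(46 := b)) x = evalt e x" for a b
    by (intro evalt_cong; use assms(3) in \<open>auto simp: disjoint_iff\<close>)+
  have "sat (e'(45 := gnt s, 46 := b)) (not_in_termF x (Vr 45))"
    "sat (e'(45 := b, 46 := gnt s)) (not_in_termF x (Vr 46))" if "evalt e x \<notin> fvt s" for s b
    by (rule sat_not_in_termF[where t = s]; use assms(3) that in \<open>auto simp: x\<close>)+
  moreover have "sat (e'(46 := gn \<phi>)) (formulaF (Vr 46))" for \<phi>
    by (rule sat_formulaF[where \<phi> = \<phi>]; simp)
  ultimately show ?case using 4(2)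
    unfolding not_freeS_def gn.simps by (simp add: sat_simps sat_earlierF x del: sat.simps(3-5)) blast
qed (use assms gn_not_freeS in auto)

definition subst_termS :: "nat \<Rightarrow> nat \<Rightarrow> nat set \<Rightarrow> nat \<Rightarrow> bool" where
  "subst_termS x t P z \<longleftrightarrow> z = pair (pair 0 0) (pair 0 0) \<or> z = pair (pair 1 x) t \<or>
    (\<exists>v. v \<noteq> x \<and> z = pair (pair 1 v) (pair 1 v)) \<or>
    (\<exists>a b. pair a b \<in> P \<and> z = pair (pair 2 a) (pair 2 b)) \<or>
    (\<exists>a b c d. pair a b \<in> P \<and> pair c d \<in> P \<and>
      (z = pair (pair 3 (pair a c)) (pair 3 (pair b d)) \<or> z = pair (pair 4 (pair a c)) (pair 4 (pair b d))))"

lemma mono_subst_termS: "mono (subst_termS x t)"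
  unfolding subst_termS_def mono_def le_fun_def le_bool_def by blast

lemma gnt_subst_termS: "pair (gnt r) (gnt (substt r x t)) \<in> constructible (subst_termS x (gnt t))"
proof (induction r)
  case Zer
  have "subst_termS x (gnt t) {} (pair (gnt \<^bold>0) (gnt (substt \<^bold>0 x t)))" by (simp add: subst_termS_def)
  from constructibleI[OF mono_subst_termS _ _ this] show ?case by simp
next
  case (Vr y)
  have "subst_termS x (gnt t) {} (pair (gnt (Vr y)) (gnt (substt (Vr y) x t)))"
    by (auto simp: subst_termS_def)
  from constructibleI[OF mono_subst_termS _ _ this] show ?case by simp
next
  case (Scc r)
  have "subst_termS x (gnt t) {pair (gnt r) (gnt (substt r x t))} (pair (gnt (Scc r)) (gnt (substt (Scc r) x t)))"
    unfolding subst_termS_def gnt.simps substt.simps by blast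
  from constructibleI[OF mono_subst_termS _ _ this] Scc show ?case by simp
next
  case (Pls r s)
  have "subst_termS x (gnt t) {pair (gnt r) (gnt (substt r x t)), pair (gnt s) (gnt (substt s x t))}
      (pair (gnt (r \<^bold>+ s)) (gnt (substt (r \<^bold>+ s) x t)))"
    unfolding subst_termS_def gnt.simps substt.simps by blast
  from constructibleI[OF mono_subst_termS _ _ this] Pls show ?case by simp
next
  case (Tms r s)
  have "subst_termS x (gnt t) {pair (gnt r) (gnt (substt r x t)), pair (gnt s) (gnt (substt s x t))}
      (pair (gnt (r \<^bold>* s)) (gnt (substt (r \<^bold>* s) x t)))"
    unfolding subst_termS_def gnt.simps substt.simps by blast
  from constructibleI[OF mono_subst_termS _ _ this] Tms show ?case by simp
qed

lemma sat_subst_termF: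
  assumes "evalt e y = pair (gnt r) (gnt (substt r (evalt e x) s))" "evalt e t = gnt s"
    and "(fvt x \<union> fvt t \<union> fvt y) \<inter> ({1, 2} \<union> {50..<60}) = {}"
  shows "sat e (subst_termF x t y)"
  unfolding subst_termF_def
proof (rule sat_constructibleF[where S = "subst_termS (evalt e x) (gnt s)"], goal_cases)
  case (4 e')
  have e': "e' v = e v" if "v \<in> fvt x \<union> fvt t" for v
    by (rule 4(1)) (use assms(3) that in \<open>auto simp: disjoint_iff\<close>)
  then have x: "evalt (e'(55 := a)) x = evalt e x" "evalt e' x = evalt e x" for a
    by (intro evalt_cong; use assms(3) in \<open>auto simp: disjoint_iff\<close>)+
  have t: "evalt e' t = evalt e t"
    by (intro evalt_cong; use assms(3) e' in \<open>auto simp: disjoint_iff\<close>)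
  from 4(2) show ?case
    by (simp add: subst_termS_def sat_simps sat_earlierF x t assms(2) del: sat.simps(3-5))
qed (use assms gnt_subst_termS in auto)

definition substS :: "nat \<Rightarrow> trm \<Rightarrow> nat set \<Rightarrow> nat \<Rightarrow> bool" where
  "substS x t P z \<longleftrightarrow>
    (\<exists>r s. z = pair (gn (r \<^bold>= s)) (gn (subst (r \<^bold>= s) x t)) \<or> z = pair (gn (r \<^bold>\<le> s)) (gn (subst (r \<^bold>\<le> s) x t))) \<or>
    (\<exists>a b. pair a b \<in> P \<and> z = pair (pair 7 a) (pair 7 b)) \<or>
    (\<exists>a b c d. pair a b \<in> P \<and> pair c d \<in> P \<and> z = pair (pair 8 (pair a c)) (pair 8 (pair b d))) \<or>
    (\<exists>y \<phi>. x \<notin> fv (Forall y \<phi>) \<and> z = pair (gn (Forall y \<phi>)) (gn (Forall y \<phi>))) \<or>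
    (\<exists>y a b. y \<noteq> x \<and> y \<notin> fvt t \<and> pair a b \<in> P \<and> z = pair (pair 9 (pair y a)) (pair 9 (pair y b)))"

lemma mono_substS: "mono (substS x t)"
  unfolding substS_def mono_def le_fun_def le_bool_def by blast

lemma gn_substS: "free_for t x \<phi> \<Longrightarrow> pair (gn \<phi>) (gn (subst \<phi> x t)) \<in> constructible (substS x t)"
proof (induction \<phi>)
  case (Eql r s)
  have "substS x t {} (pair (gn (r \<^bold>= s)) (gn (subst (r \<^bold>= s) x t)))" unfolding substS_def by blast
  from constructibleI[OF mono_substS _ _ this] show ?case by simp
next
  case (Leq r s)
  have "substS x t {} (pair (gn (r \<^bold>\<le> s)) (gn (subst (r \<^bold>\<le> s) x t)))" unfolding substS_def by blast
  from constructibleI[OF mono_substS _ _ this] show ?case by simp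
next
  case (Neg \<phi>)
  have "substS x t {pair (gn \<phi>) (gn (subst \<phi> x t))} (pair (gn (\<^bold>\<not> \<phi>)) (gn (subst (\<^bold>\<not> \<phi>) x t)))"
    unfolding substS_def gn.simps subst.simps by blast
  from constructibleI[OF mono_substS _ _ this] Neg show ?case by simp
next
  case (Imp \<phi> \<psi>)
  have "substS x t {pair (gn \<phi>) (gn (subst \<phi> x t)), pair (gn \<psi>) (gn (subst \<psi> x t))}
      (pair (gn (\<phi> \<^bold>\<rightarrow> \<psi>)) (gn (subst (\<phi> \<^bold>\<rightarrow> \<psi>) x t)))"
    unfolding substS_def gn.simps subst.simps by blast
  from constructibleI[OF mono_substS _ _ this] Imp show ?case by simp
next
  case (Forall y \<phi>)
  show ?case
  \<comment> \<open>If \<open>x\<close> is not free, \<open>free_for\<close> gives no information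
    about the body, and the clause for unchanged quantified formulas applies instead.\<close>
  proof (cases "x \<in> fv (Forall y \<phi>)")
    case False
    then have "substS x t {} (pair (gn (Forall y \<phi>)) (gn (subst (Forall y \<phi>) x t)))"
      unfolding subst_idle[OF False] substS_def by blast
    from constructibleI[OF mono_substS _ _ this] show ?thesis by simp
  next
    case True
    then have y: "y \<noteq> x" "y \<notin> fvt t" "free_for t x \<phi>" using Forall.prems by auto
    have "substS x t {pair (gn \<phi>) (gn (subst \<phi> x t))} (pair (gn (Forall y \<phi>)) (gn (Forall y (subst \<phi> x t))))"
      unfolding substS_def gn.simps using y(1,2) by blast
    from constructibleI[OF mono_substS _ _ this] Forall.IH y show ?thesis by simp
  qed
qed

lemma sat_substF:
  assumes "evalt e y = pair (gn \<phi>) (gn (subst \<phi> (evalt e x) s))" "evalt e t = gnt s" "free_for s (evalt e x) \<phi>"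
    and vars: "(fvt x \<union> fvt t) \<inter> ({1, 2} \<union> {30..<70}) = {}" "fvt y \<inter> ({1, 2} \<union> {60..<70}) = {}"
  shows "sat e (substF x t y)"
  unfolding substF_def
proof (rule sat_constructibleF[where S = "substS (evalt e x) s"], goal_cases)
  case (4 e')
  have e': "e' v = e v" if "v \<in> fvt x \<union> fvt t" for v
    by (rule 4(1)) (use vars(1) that in \<open>auto simp: disjoint_iff\<close>)
  then have x: "evalt (e'(65 := a, 66 := b, 67 := c, 68 := d)) x = evalt e x"
     "evalt (e'(65 := a, 66 := b, 67 := c)) x = evalt e x" "evalt (e'(65 := a, 66 := b)) x = evalt e x"
    and t: "evalt (e'(65 := a, 66 := b, 67 := c, 68 := d)) t = gnt s"
     "evalt (e'(65 := a, 66 := b, 67 := c)) t = gnt s" for a b c d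
    unfolding assms(2)[symmetric] by (intro evalt_cong; use vars(1) e' in \<open>auto simp: disjoint_iff\<close>)+
  have "sat (e'(65 := gnt r, 66 := gnt (substt r (evalt e x) s), 67 := c, 68 := d)) (subst_termF x t (pairT (Vr 65) (Vr 66)))"
    "sat (e'(65 := a, 66 := b, 67 := gnt r, 68 := gnt (substt r (evalt e x) s))) (subst_termF x t (pairT (Vr 67) (Vr 68)))"
    for r a b c d
    by (rule sat_subst_termF[where r = r and s = s]; use vars(1) in \<open>auto simp: x t\<close>)+
  moreover have "sat (e'(65 := y, 66 := gn \<phi>)) (not_freeF x (forallT (Vr 65) (Vr 66)))"
    if "evalt e x \<notin> fv (Forall y \<phi>)" for y \<phi>
    by (rule sat_not_freeF[where \<phi> = "Forall y \<phi>"]; use vars(1) that in \<open>auto simp: x\<close>)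
  moreover have "sat (e'(65 := y, 66 := a, 67 := b)) (not_in_termF (Vr 65) t)" if "y \<notin> fvt s" for y a b
    by (rule sat_not_in_termF[where t = s]; use vars(1) that in \<open>auto simp: t\<close>)
  ultimately show ?case using 4(2)
    unfolding substS_def gn.simps subst.simps
    by (simp add: sat_simps sat_earlierF x del: sat.simps(3-5) fv.simps) (elim disj_forward; blast)
qed (use assms gn_substS in auto)

lemma sat_foldr_Dis: "sat e (foldr Dis (map f xs) \<^bold>\<bottom>) \<longleftrightarrow> (\<exists>x \<in> set xs. sat e (f x))"
  by (induction xs) auto

lemma sat_logical_axiomF:
  assumes "logical_axiom \<phi>" "evalt e z = gn \<phi>" "fvt z \<inter> {70..<80} = {}"
  shows "sat e (logical_axiomF z)"
proof -
  have z: "evalt (e(70 := a, 71 := b)) z = gn \<phi>" "evalt (e(70 := a, 71 := b, 72 := c)) z = gn \<phi>"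
    "evalt (e(70 := a, 71 := b, 72 := c, 73 := d)) z = gn \<phi>" for a b c d
    unfolding assms(2)[symmetric] by (intro evalt_cong; use assms(3) in \<open>auto simp: disjoint_iff\<close>)+
  have fm: "sat e' (formulaF (Vr v))" if "e' v = gn \<psi>" "v \<ge> 70" for e' v \<psi>
    by (rule sat_formulaF[where \<phi> = \<psi>]) (use that in auto)
  from assms(1) show ?thesis
  proof cases
    case (1 \<chi> \<psi>)
    then have "sat (e(70 := gn \<chi>, 71 := gn \<psi>))
      (formulaF (Vr 70) \<^bold>\<and> formulaF (Vr 71) \<^bold>\<and> z \<^bold>= impT (Vr 70) (impT (Vr 71) (Vr 70)))"
      unfolding sat_simps by (intro conjI fm[where \<psi> = \<chi>] fm[where \<psi> = \<psi>]; simp add: z)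
    then show ?thesis unfolding logical_axiomF_def sat_Dis sat_Exists by blast
  next
    case (2 \<chi> \<psi> \<theta>)
    then have "sat (e(70 := gn \<chi>, 71 := gn \<psi>, 72 := gn \<theta>))
      (formulaF (Vr 70) \<^bold>\<and> formulaF (Vr 71) \<^bold>\<and> formulaF (Vr 72) \<^bold>\<and>
        z \<^bold>= impT (impT (Vr 70) (impT (Vr 71) (Vr 72))) (impT (impT (Vr 70) (Vr 71)) (impT (Vr 70) (Vr 72))))"
      unfolding sat_simps by (intro conjI fm[where v = 70 and \<psi> = \<chi>] fm[where v = 71 and \<psi> = \<psi>] fm[where v = 72 and \<psi> = \<theta>]; simp add: z)
    then show ?thesis unfolding logical_axiomF_def sat_Dis sat_Exists by blast
  next
    case (3 \<chi> \<psi>)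
    then have "sat (e(70 := gn \<chi>, 71 := gn \<psi>))
      (formulaF (Vr 70) \<^bold>\<and> formulaF (Vr 71) \<^bold>\<and>
        z \<^bold>= impT (impT (negT (Vr 70)) (negT (Vr 71))) (impT (Vr 71) (Vr 70)))"
      unfolding sat_simps by (intro conjI fm[where v = 70 and \<psi> = \<chi>] fm[where v = 71 and \<psi> = \<psi>]; simp add: z)
    then show ?thesis unfolding logical_axiomF_def sat_Dis sat_Exists by blast
  next
    case (4 t x \<chi>)
    let ?e = "e(70 := x, 71 := gnt t, 72 := gn \<chi>, 73 := gn (subst \<chi> x t))"
    have "sat ?e (termF (Vr 71))" by (rule sat_termF[where t = t]) auto
    moreover have "sat ?e (substF (Vr 70) (Vr 71) (pairT (Vr 72) (Vr 73)))"
      by (rule sat_substF[where \<phi> = \<chi> and s = t]) (use 4 in auto)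
    moreover have "sat ?e (z \<^bold>= impT (forallT (Vr 70) (Vr 72)) (Vr 73))"
      using 4 by (simp add: z)
    ultimately have "sat ?e (termF (Vr 71) \<^bold>\<and> substF (Vr 70) (Vr 71) (pairT (Vr 72) (Vr 73)) \<^bold>\<and>
         z \<^bold>= impT (forallT (Vr 70) (Vr 72)) (Vr 73))" unfolding sat_Con by blast
    then show ?thesis unfolding logical_axiomF_def sat_Dis sat_Exists by blast
  next
    case (5 x \<chi> \<psi>)
    let ?e = "e(70 := x, 71 := gn \<chi>, 72 := gn \<psi>)"
    have "sat ?e (not_freeF (Vr 70) (Vr 71))" by (rule sat_not_freeF[where \<phi> = \<chi>]) (use 5 in auto)
    moreover have "sat ?e (formulaF (Vr 72))" by (rule fm[where \<psi> = \<psi>]) auto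
    moreover have "sat ?e (z \<^bold>= impT (forallT (Vr 70) (impT (Vr 71) (Vr 72))) (impT (Vr 71) (forallT (Vr 70) (Vr 72))))"
      using 5 by (simp add: z)
    ultimately have "sat ?e (not_freeF (Vr 70) (Vr 71) \<^bold>\<and> formulaF (Vr 72) \<^bold>\<and>
        z \<^bold>= impT (forallT (Vr 70) (impT (Vr 71) (Vr 72))) (impT (Vr 71) (forallT (Vr 70) (Vr 72))))"
      unfolding sat_Con by blast
    then show ?thesis unfolding logical_axiomF_def sat_Dis sat_Exists by blast
  next
    case 6
    then have "sat e (foldr Dis (map (\<lambda>\<phi>. z \<^bold>= \<ulcorner>\<phi>\<urcorner>) equality_axioms) \<^bold>\<bottom>)"
      unfolding sat_foldr_Dis using assms(2) by (auto simp: goedel_numeral_def)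
    then show ?thesis unfolding logical_axiomF_def sat_Dis by blast
  qed
qed

section \<open>Derivations as construction sequences\<close>

definition proofS :: "fm set \<Rightarrow> nat set \<Rightarrow> nat \<Rightarrow> bool" where
  "proofS U P z \<longleftrightarrow> (\<exists>\<phi>. logical_axiom \<phi> \<and> z = gn \<phi>) \<or> z \<in> gn ` U \<or>
    (\<exists>a. a \<in> P \<and> pair 8 (pair a z) \<in> P) \<or> (\<exists>v a. a \<in> P \<and> z = pair 9 (pair v a))"

lemma mono_proofS: "mono (proofS U)"
  unfolding proofS_def mono_def le_fun_def le_bool_def by blast

text \<open>Entries of a derivation may be open formulas; the restriction to sentences in
  \<open>proofF\<close> concerns only the formula proved.\<close>

lemma gn_proofS: "U \<tturnstile> \<phi> \<Longrightarrow> gn \<phi> \<in> constructible (proofS U)"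
proof (induction rule: prv.induct)
  case (nonlogical \<phi>)
  then have "proofS U {} (gn \<phi>)" unfolding proofS_def by blast
  from constructibleI[OF mono_proofS _ _ this] show ?case by simp
next
  case (logical \<phi>)
  then have "proofS U {} (gn \<phi>)" unfolding proofS_def by blast
  from constructibleI[OF mono_proofS _ _ this] show ?case by simp
next
  case (modus_ponens \<phi> \<psi>)
  have "proofS U {gn \<phi>, gn (\<phi> \<^bold>\<rightarrow> \<psi>)} (gn \<psi>)" unfolding proofS_def gn.simps by blast
  from constructibleI[OF mono_proofS _ _ this] modus_ponens.IH show ?case by simp
next
  case (generalization \<phi> x)
  have "proofS U {gn \<phi>} (gn (Forall x \<phi>))" unfolding proofS_def gn.simps by blast
  from constructibleI[OF mono_proofS _ _ this] generalization.IH show ?case by simp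
qed

lemma sat_sentenceF: "sentence \<phi> \<Longrightarrow> e 0 = gn \<phi> \<Longrightarrow> sat e (sentenceF (Vr 0))"
proof -
  assume \<phi>: "sentence \<phi>" "e 0 = gn \<phi>"
  have "sat e (formulaF (Vr 0))" by (rule sat_formulaF[where \<phi> = \<phi>]) (use \<phi> in auto)
  moreover have "sat (e(3 := n)) (not_freeF (Vr 3) (Vr 0))" for n
    by (rule sat_not_freeF[where \<phi> = \<phi>]) (use \<phi> in \<open>auto simp: sentence_def\<close>)
  ultimately show ?thesis unfolding sentenceF_def sat_Con by simp
qed

theorem sat_provableF:
  assumes "presents \<alpha> U" "U \<tturnstile> \<phi>" "sentence \<phi>" "e 0 = gn \<phi>"
  shows "sat e (provableF \<alpha>)"
proof -
  from gn_proofS[OF assms(2)] obtain xs n where xs: "justified (proofS U) xs" "n < length xs" "gn \<phi> = xs ! n"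
    by (auto simp: constructible_def in_set_conv_nth)
  obtain c d where cd: "\<forall>i < length xs. beta c d i = xs ! i" using ex_beta by blast
  \<comment> \<open>\<open>Vr 90\<close> is the whole proof code, and \<open>Vr 80\<close> to
    \<open>Vr 82\<close> are its components.\<close>
  let ?e1 = "e(90 := pair c (pair d n))"
  let ?e = "?e1(80 := c, 81 := d, 82 := n)"
  have "sat ?e (Vr 90 \<^bold>= pairT (Vr 80) (pairT (Vr 81) (Vr 82)))" by simp
  moreover have "sat ?e (betaF (Vr 80) (Vr 81) (Vr 82) (Vr 0))"
    using xs cd assms(4) by (subst sat_betaF) auto
  moreover have "sat ?e (seqF 83
          (\<lambda>E z.
              logical_axiomF z
            \<^bold>\<or> Exists 0 (Vr 0 \<^bold>= z \<^bold>\<and> \<alpha>)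
            \<^bold>\<or> Exists 85 (E (Vr 85) \<^bold>\<and> E (impT (Vr 85) z))
            \<^bold>\<or> Exists 85 (Exists 86 (E (Vr 86) \<^bold>\<and> z \<^bold>= forallT (Vr 85) (Vr 86))))
          (Vr 80) (Vr 81) (Vr 82))"
  proof (rule sat_seqF[OF xs(1)], goal_cases)
    case (5 i z)
    \<comment> \<open>\<open>83 + 1\<close> stays unevaluated to match the \<open>k + 1\<close> of
      \<open>sat_seqF\<close>.\<close>
    let ?e' = "?e(83 := i, 83 + 1 := z)"
    have "sat ?e' (logical_axiomF (Vr (83 + 1)))" if "logical_axiom \<psi>" "z = gn \<psi>" for \<psi>
      by (rule sat_logical_axiomF[OF that(1)]) (use that in auto)
    \<comment> \<open>The quantifier rebinds variable 0, which held the code of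
      \<open>\<phi>\<close>, to the entry \<open>z\<close>; \<open>presents\<close> covers every
      environment.\<close>
    moreover have "sat ?e' (Exists 0 (Vr 0 \<^bold>= Vr (83 + 1) \<^bold>\<and> \<alpha>))" if "z \<in> gn ` U"
      unfolding sat_simps using assms(1) that by (intro exI[of _ z]) (auto simp: presents_def)
    moreover have "sat ?e' (Exists 85 (earlierF (Vr 80) (Vr 81) (Vr 83) (Vr 85) \<^bold>\<and> earlierF (Vr 80) (Vr 81) (Vr 83) (impT (Vr 85) (Vr (83 + 1)))))"
      if "a \<in> earlier c d i" "pair 8 (pair a z) \<in> earlier c d i" for a
      unfolding sat_simps using that by (intro exI[of _ a]) (simp add: sat_earlierF)
    moreover have "sat ?e' (Exists 85 (Exists 86 (earlierF (Vr 80) (Vr 81) (Vr 83) (Vr 86) \<^bold>\<and> Vr (83 + 1) \<^bold>= forallT (Vr 85) (Vr 86))))"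
      if "a \<in> earlier c d i" "z = pair 9 (pair v a)" for a v
      unfolding sat_simps using that by (intro exI[of _ v] exI[of _ a]) (simp add: sat_earlierF)
    ultimately show ?case using 5 unfolding proofS_def sat_Dis by auto
  qed (use xs cd in auto)
  ultimately have "sat ?e1 (Exists 80 (Exists 81 (Exists 82
       (Vr 90 \<^bold>= pairT (Vr 80) (pairT (Vr 81) (Vr 82)) \<^bold>\<and>
        betaF (Vr 80) (Vr 81) (Vr 82) (Vr 0) \<^bold>\<and>
        seqF 83
          (\<lambda>E z.
              logical_axiomF z
            \<^bold>\<or> Exists 0 (Vr 0 \<^bold>= z \<^bold>\<and> \<alpha>)
            \<^bold>\<or> Exists 85 (E (Vr 85) \<^bold>\<and> E (impT (Vr 85) z))
            \<^bold>\<or> Exists 85 (Exists 86 (E (Vr 86) \<^bold>\<and> z \<^bold>= forallT (Vr 85) (Vr 86))))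
          (Vr 80) (Vr 81) (Vr 82)))))"
    unfolding sat_Exists sat_Con by blast
  moreover have "sat ?e1 (sentenceF (Vr 0))" by (rule sat_sentenceF[OF assms(3)]) (use assms(4) in simp)
  ultimately show ?thesis unfolding provableF_def proofF_def sat_Exists[of e 90] sat_Con[of _ "sentenceF _"] by blast
qed

section \<open>Complexity and free variables of the provability predicate\<close>

lemma sigma1_Eql: "sigma1 (s \<^bold>= t)" and sigma1_Leq: "sigma1 (s \<^bold>\<le> t)" and sigma1_neq: "sigma1 (\<^bold>\<not> (s \<^bold>= t))"
  by (intro sigma1.intros(1) sigma0.intros)+

lemmas sigma1_intros = sigma1_Eql sigma1_Leq sigma1_neq sigma1.intros(2-5)

lemma sigma1_betaF: "sigma1 (betaF c d i z)"
  unfolding betaF_def by (intro sigma1_intros)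

lemma sigma1_earlierF: "sigma1 (earlierF c d i w)"
  unfolding earlierF_def by (intro sigma1_intros sigma1_betaF)

text \<open>The predicate \<open>E\<close> for earlier entries stays abstract, so each schema is
  checked through its own connectives alone.\<close>

lemma sigma1_seqF:
  assumes "\<And>E z. (\<And>w. sigma1 (E w)) \<Longrightarrow> sigma1 (step E z)" "k \<notin> fvt n"
  shows "sigma1 (seqF k step c d n)"
  unfolding seqF_def by (intro sigma1_intros sigma1_betaF assms sigma1_earlierF)

lemma sigma1_constructibleF:
  assumes "\<And>E z. (\<And>w. sigma1 (E w)) \<Longrightarrow> sigma1 (step E z)"
  shows "sigma1 (constructibleF k step x)"
  unfolding constructibleF_def by (intro sigma1_intros sigma1_betaF sigma1_seqF assms) simp_all

lemma sigma1_termF: "sigma1 (termF x)"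
  unfolding termF_def by (rule sigma1_constructibleF) (intro sigma1_intros; simp)

lemma sigma1_formulaF: "sigma1 (formulaF x)"
  unfolding formulaF_def by (rule sigma1_constructibleF) (intro sigma1_intros sigma1_termF; simp)

lemma sigma1_not_in_termF: "sigma1 (not_in_termF x y)"
  unfolding not_in_termF_def by (rule sigma1_constructibleF) (intro sigma1_intros; simp)

lemma sigma1_not_freeF: "sigma1 (not_freeF x y)"
  unfolding not_freeF_def
  by (rule sigma1_constructibleF) (intro sigma1_intros sigma1_not_in_termF sigma1_formulaF; simp)

lemma sigma1_subst_termF: "sigma1 (subst_termF x t y)"
  unfolding subst_termF_def by (rule sigma1_constructibleF) (intro sigma1_intros; simp)

lemma sigma1_substF: "sigma1 (substF x t y)"
  unfolding substF_def
  by (rule sigma1_constructibleF)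
    (intro sigma1_intros sigma1_subst_termF sigma1_not_freeF sigma1_not_in_termF; simp)

lemma sigma1_logical_axiomF: "sigma1 (logical_axiomF z)"
proof -
  have "sigma1 (\<^bold>\<bottom>)" by (rule sigma1_neq)
  then have "sigma1 (foldr Dis (map (\<lambda>\<phi>. z \<^bold>= \<ulcorner>\<phi>\<urcorner>) xs) \<^bold>\<bottom>)" for xs
    by (induction xs) (auto intro: sigma1_intros)
  then show ?thesis
    unfolding logical_axiomF_def
    by (intro sigma1_intros sigma1_formulaF sigma1_termF sigma1_substF sigma1_not_freeF)
qed

lemma sigma1_provableF: "sigma1 \<alpha> \<Longrightarrow> sigma1 (provableF \<alpha>)"
  unfolding provableF_def proofF_def sentenceF_def
  by (intro sigma1_intros sigma1_betaF sigma1_seqF sigma1_logical_axiomF sigma1_formulaF sigma1_not_freeF) simp_all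

section \<open>Free variables of the arithmetized syntax\<close>

lemma fv_betaF: "fv (betaF c d i z) \<subseteq> fvt c \<union> fvt d \<union> fvt i \<union> fvt z"
  unfolding betaF_def by auto

lemma fv_earlierF: "fv (earlierF c d i w) \<subseteq> fvt c \<union> fvt d \<union> fvt i \<union> fvt w"
  unfolding earlierF_def using fv_betaF[of c d "Vr 2" w] by auto

lemma fv_seqF:
  assumes "\<And>E. (\<And>w. fv (E w) \<subseteq> fvt c \<union> fvt d \<union> {k} \<union> fvt w) \<Longrightarrow>
    fv (step E (Vr (k + 1))) \<subseteq> V \<union> fvt c \<union> fvt d \<union> {k, k + 1}"
  shows "fv (seqF k step c d n) \<subseteq> V \<union> fvt c \<union> fvt d \<union> fvt n"
proof -
  have "fv (earlierF c d (Vr k) w) \<subseteq> fvt c \<union> fvt d \<union> {k} \<union> fvt w" for w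
    using fv_earlierF[of c d "Vr k" w] by simp
  from assms[of "earlierF c d (Vr k)", OF this] fv_betaF[of c d "Vr k" "Vr (k + 1)"]
  show ?thesis unfolding seqF_def by auto
qed

text \<open>\<open>V\<close> is meant for the variables of the parameters of a schema; the variables
  of the block end up bound.\<close>

lemma fv_constructibleF:
  assumes "\<And>E. (\<And>w. fv (E w) \<subseteq> {k, k + 1, k + 3} \<union> fvt w) \<Longrightarrow>
    fv (step E (Vr (k + 4))) \<subseteq> V \<union> {k, k + 1, k + 3, k + 4}"
  shows "fv (constructibleF k step x) \<subseteq> V \<union> fvt x"
proof -
  have "fv (seqF (k + 3) step (Vr k) (Vr (k + 1)) (Vr (k + 2))) \<subseteq> V \<union> fvt (Vr k) \<union> fvt (Vr (k + 1)) \<union> fvt (Vr (k + 2))"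
  proof (rule fv_seqF)
    fix E assume "\<And>w. fv (E w) \<subseteq> fvt (Vr k) \<union> fvt (Vr (k + 1)) \<union> {k + 3} \<union> fvt w"
    then have "fv (E w) \<subseteq> {k, k + 1, k + 3} \<union> fvt w" for w by auto
    from assms[OF this] show "fv (step E (Vr (k + 3 + 1))) \<subseteq> V \<union> fvt (Vr k) \<union> fvt (Vr (k + 1)) \<union> {k + 3, k + 3 + 1}"
      by (auto simp: numeral_eq_Suc)
  qed
  with fv_betaF[of "Vr k" "Vr (k + 1)" "Vr (k + 2)" x] show ?thesis
    unfolding constructibleF_def by auto
qed

lemma fv_termF: "fv (termF x) \<subseteq> fvt x"
  unfolding termF_def
  by (rule fv_constructibleF[of _ _ "{}", simplified Un_empty_left]) (fastforce)

lemma fv_formulaF: "fv (formulaF x) \<subseteq> fvt x"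
  unfolding formulaF_def
  by (rule fv_constructibleF[of _ _ "{}", simplified Un_empty_left])
    (use fv_termF[of "Vr 25"] fv_termF[of "Vr 26"] in fastforce)

lemma fv_not_in_termF: "fv (not_in_termF x y) \<subseteq> fvt x \<union> fvt y"
  unfolding not_in_termF_def by (rule fv_constructibleF) fastforce

lemma fv_not_freeF: "fv (not_freeF x y) \<subseteq> fvt x \<union> fvt y"
  unfolding not_freeF_def
  by (rule fv_constructibleF)
    (use fv_not_in_termF[of x "Vr 45"] fv_not_in_termF[of x "Vr 46"] fv_formulaF[of "Vr 46"] in fastforce)

lemma fv_subst_termF: "fv (subst_termF x t y) \<subseteq> fvt x \<union> fvt t \<union> fvt y"
  unfolding subst_termF_def by (rule fv_constructibleF) fastforce

lemma fv_substF: "fv (substF x t y) \<subseteq> fvt x \<union> fvt t \<union> fvt y"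
  unfolding substF_def
  by (rule fv_constructibleF)
    (use fv_subst_termF[of x t "pairT (Vr 65) (Vr 66)"] fv_subst_termF[of x t "pairT (Vr 67) (Vr 68)"]
      fv_not_freeF[of x "forallT (Vr 65) (Vr 66)"] fv_not_in_termF[of "Vr 65" t] in fastforce)

lemma fv_logical_axiomF: "fv (logical_axiomF z) \<subseteq> fvt z"
proof -
  have "fv (foldr Dis (map (\<lambda>\<phi>. z \<^bold>= \<ulcorner>\<phi>\<urcorner>) xs) \<^bold>\<bottom>) \<subseteq> fvt z" for xs
    by (induction xs) (auto simp: goedel_numeral_def)
  then show ?thesis unfolding logical_axiomF_def
    using fv_formulaF[of "Vr 70"] fv_formulaF[of "Vr 71"] fv_formulaF[of "Vr 72"] fv_termF[of "Vr 71"]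
      fv_substF[of "Vr 70" "Vr 71" "pairT (Vr 72) (Vr 73)"] fv_not_freeF[of "Vr 70" "Vr 71"]
    by fastforce
qed

lemma fv_provableF:
  assumes "fv \<alpha> \<subseteq> {0}"
  shows "fv (provableF \<alpha>) \<subseteq> {0}"
proof -
  have "fv (sentenceF (Vr 0)) \<subseteq> {0}"
    unfolding sentenceF_def using fv_formulaF[of "Vr 0"] fv_not_freeF[of "Vr 3" "Vr 0"] by auto
  moreover have "fv (seqF 83
          (\<lambda>E z.
              logical_axiomF z
            \<^bold>\<or> Exists 0 (Vr 0 \<^bold>= z \<^bold>\<and> \<alpha>)
            \<^bold>\<or> Exists 85 (E (Vr 85) \<^bold>\<and> E (impT (Vr 85) z))
            \<^bold>\<or> Exists 85 (Exists 86 (E (Vr 86) \<^bold>\<and> z \<^bold>= forallT (Vr 85) (Vr 86))))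
          (Vr 80) (Vr 81) (Vr 82)) \<subseteq> {} \<union> fvt (Vr 80) \<union> fvt (Vr 81) \<union> fvt (Vr 82)"
    by (rule fv_seqF) (use fv_logical_axiomF[of "Vr 84"] assms in fastforce)
  ultimately show ?thesis
    unfolding provableF_def proofF_def using fv_betaF[of "Vr 80" "Vr 81" "Vr 82" "Vr 0"] by auto
qed

section \<open>Provability sentences and necessitation\<close>

lemma sigma0_subst_num: "sigma0 \<phi> \<Longrightarrow> sigma0 (subst \<phi> x (num k))"
proof (induction rule: sigma0.induct)
  \<comment> \<open>Numerals are closed, so the substituted bound still avoids the quantified
    variable; for \<open>y = x\<close> the formula does not change.\<close>
  case (5 \<phi> y t)
  then show ?case using fvt_substt[of t x "num k"] sigma0.intros(5)[of "subst \<phi> x (num k)" y "substt t x (num k)"]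
      sigma0.intros(5)[of \<phi> y t] by (cases "y = x") auto
next
  case (6 \<phi> y t)
  then show ?case using fvt_substt[of t x "num k"] sigma0.intros(6)[of "subst \<phi> x (num k)" y "substt t x (num k)"]
      sigma0.intros(6)[of \<phi> y t] by (cases "y = x") auto
qed (auto intro: sigma0.intros(1-4))

lemma sigma1_subst_num: "sigma1 \<phi> \<Longrightarrow> sigma1 (subst \<phi> x (num k))"
proof (induction rule: sigma1.induct)
  case (1 \<phi>)
  then show ?case by (intro sigma1.intros(1) sigma0_subst_num)
next
  case (4 \<phi> y)
  then show ?case using sigma1.intros(4)[of "subst \<phi> x (num k)" y]
      sigma1.intros(4)[of \<phi> y] by (cases "y = x") auto
next
  case (5 \<phi> y t)
  then show ?case using fvt_substt[of t x "num k"] sigma1.intros(5)[of "subst \<phi> x (num k)" y "substt t x (num k)"]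
      sigma1.intros(5)[of \<phi> y t] by (cases "y = x") auto
qed (simp_all add: sigma1.intros(2,3))

text \<open>Makes provability sentences admissible as \<open>\<sigma>\<close> in the third family of
  axioms of \<open>Q_prime\<close>.\<close>

lemma sigma1_Pr: "sigma1 \<alpha> \<Longrightarrow> sigma1 (Pr \<alpha> \<phi>)"
  unfolding Pr_def goedel_numeral_def by (intro sigma1_subst_num sigma1_provableF)

lemma sentence_Pr: "fv \<alpha> \<subseteq> {0} \<Longrightarrow> sentence (Pr \<alpha> \<phi>)"
  using fv_provableF[of \<alpha>] fv_subst[of "provableF \<alpha>" 0 "\<ulcorner>\<phi>\<urcorner>"]
  unfolding sentence_def Pr_def goedel_numeral_def by auto

theorem necessitation:
  assumes "presents \<alpha> U" "extends U Robinson_Q" "U \<tturnstile> \<phi>" "sentence \<phi>"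
  shows "U \<tturnstile> Pr \<alpha> \<phi>"
proof -
  have \<alpha>: "sigma1 \<alpha>" "fv \<alpha> \<subseteq> {0}" using assms(1) by (auto simp: presents_def)
  \<comment> \<open>Only variable 0 can be free in \<open>provableF \<alpha>\<close>, so the
    instance at this constant environment is \<open>Pr \<alpha> \<phi>\<close> itself.\<close>
  let ?f = "\<lambda>_. gn \<phi>"
  have "sat ?f (provableF \<alpha>)" by (rule sat_provableF[OF assms(1,3,4)]) simp
  from sigma1_complete[OF assms(2) sigma1_provableF[OF \<alpha>(1)] this]
  have "U \<tturnstile> simsubst (\<lambda>x. num (gn \<phi>)) (provableF \<alpha>)" .
  also have "simsubst (\<lambda>x. num (gn \<phi>)) (provableF \<alpha>) = Pr \<alpha> \<phi>"
    unfolding Pr_def subst_eq_simsubst goedel_numeral_def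
    by (rule simsubst_cong) (use fv_provableF[OF \<alpha>(2)] in auto)
  finally show ?thesis .
qed

section \<open>The diagonal lemma\<close>

text \<open>Bounding the quotient by \<open>c\<close> makes Goedel's beta predicate Sigma_0. The
  diagonal function will occur in antecedents, where a Sigma_1 formula would lead out of the
  class.\<close>

definition bbetaF :: "trm \<Rightarrow> trm \<Rightarrow> trm \<Rightarrow> trm \<Rightarrow> fm" where
  "bbetaF c d i z = (BExists 10 c (c \<^bold>= Vr 10 \<^bold>* Scc (Scc i \<^bold>* d) \<^bold>+ z) \<^bold>\<and> z \<^bold>\<le> Scc i \<^bold>* d)"

text \<open>\<open>diagF x y v\<close>: if \<open>x\<close> codes \<open>\<theta>\<close>, then \<open>y\<close> codes \<open>Forall 1 (Vr 1 \<^bold>= num x \<^bold>\<rightarrow> \<theta>)\<close>, and \<open>v\<close> bounds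
  the data of a computation of the code of \<open>num x\<close>.\<close>

definition diagF :: "trm \<Rightarrow> trm \<Rightarrow> trm \<Rightarrow> fm" where
  "diagF x y v = BExists 5 v (BExists 6 v (BExists 7 v (
     bbetaF (Vr 5) (Vr 6) \<^bold>0 \<^bold>0 \<^bold>\<and>
     BForall 8 x (Vr 8 \<^bold>= x \<^bold>\<or> BExists 9 (Vr 5)
       (bbetaF (Vr 5) (Vr 6) (Vr 8) (Vr 9) \<^bold>\<and> bbetaF (Vr 5) (Vr 6) (Scc (Vr 8)) (sccT (Vr 9)))) \<^bold>\<and>
     bbetaF (Vr 5) (Vr 6) x (Vr 7) \<^bold>\<and>
     y \<^bold>= forallT (num 1) (impT (eqlT (vrT (num 1)) (Vr 7)) x))))"

lemma sat_BExists: "sat e (BExists x t \<phi>) \<longleftrightarrow> (\<exists>n \<le> evalt e t. sat (e(x := n)) \<phi>)" if "x \<notin> fvt t"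
  using that by (auto simp: evalt_fun_upd)

lemma sat_BForall: "sat e (BForall x t \<phi>) \<longleftrightarrow> (\<forall>n \<le> evalt e t. sat (e(x := n)) \<phi>)" if "x \<notin> fvt t"
  using that by (auto simp: evalt_fun_upd)

lemma sat_bbetaF:
  assumes "10 \<notin> fvt c \<union> fvt d \<union> fvt i \<union> fvt z"
  shows "sat e (bbetaF c d i z) \<longleftrightarrow> beta (evalt e c) (evalt e d) (evalt e i) = evalt e z"
proof -
  have "(\<exists>q \<le> c'. c' = q * Suc m + z') \<and> z' \<le> m \<longleftrightarrow> c' mod Suc m = z'" for c' z' m :: nat
  proof
    assume "(\<exists>q \<le> c'. c' = q * Suc m + z') \<and> z' \<le> m"
    then show "c' mod Suc m = z'" by (auto simp del: mult_Suc_right)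
  next
    assume "c' mod Suc m = z'"
    then have "c' = c' div Suc m * Suc m + z'" "z' \<le> m" "c' div Suc m \<le> c'"
      using div_mult_mod_eq[of c' "Suc m"] mod_less_divisor[of "Suc m" c'] by (auto simp del: mult_Suc_right)
    then show "(\<exists>q \<le> c'. c' = q * Suc m + z') \<and> z' \<le> m" by blast
  qed
  then show ?thesis using assms unfolding bbetaF_def sat_Con
    by (subst sat_BExists) (auto simp: beta_def evalt_fun_upd simp del: mult_Suc)
qed

text \<open>The recursion lists the codes of the numerals: it starts at 0, which equals
  \<open>pair 0 0\<close>, and every successor applies \<open>pair 2\<close>.\<close>

lemma sat_diagF:
  assumes "(fvt x \<union> fvt y \<union> fvt v) \<inter> {5..10} = {}"
  shows "sat e (diagF x y v) \<longleftrightarrow> (\<exists>c \<le> evalt e v. \<exists>d \<le> evalt e v. \<exists>u \<le> evalt e v.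
    beta c d 0 = 0 \<and> (\<forall>i < evalt e x. beta c d (Suc i) = pair 2 (beta c d i)) \<and> beta c d (evalt e x) = u \<and>
    evalt e y = pair 9 (pair 1 (pair 8 (pair (pair 5 (pair (pair 1 1) u)) (evalt e x)))))"
proof -
  have nin: "a \<notin> fvt x" "a \<notin> fvt y" "a \<notin> fvt v" if "a \<in> {5, 6, 7, 8, 9, 10}" for a
    using assms that by (auto simp: disjoint_iff)
  \<comment> \<open>An entry is a remainder of \<open>c\<close>, so bounding \<open>Vr 9\<close> by
    \<open>Vr 5\<close> loses nothing.\<close>
  have "beta c d i \<le> c" for c d i by (simp add: beta_def)
  then have *: "(\<exists>w \<le> c. beta c d i = w \<and> beta c d (Suc i) = pair 2 w) \<longleftrightarrow> beta c d (Suc i) = pair 2 (beta c d i)" for c d i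
    by auto
  \<comment> \<open>The bounded quantifier includes its bound; the disjunct for the last index makes
    the range strict.\<close>
  have **: "(\<forall>i \<le> n. i = n \<or> P i) \<longleftrightarrow> (\<forall>i < n. P i)" for n and P :: "nat \<Rightarrow> bool"
    by (metis le_less less_irrefl)
  show ?thesis unfolding diagF_def
    by (simp add: sat_BExists sat_BForall sat_Con sat_Dis sat_bbetaF nin evalt_fun_upd * ** del: sat.simps(3-5))
qed

lemma sigma0_Con: "sigma0 \<phi> \<Longrightarrow> sigma0 \<psi> \<Longrightarrow> sigma0 (\<phi> \<^bold>\<and> \<psi>)" and sigma0_Dis: "sigma0 \<phi> \<Longrightarrow> sigma0 \<psi> \<Longrightarrow> sigma0 (\<phi> \<^bold>\<or> \<psi>)"
  by (intro sigma0.intros; assumption)+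

lemma sigma0_diagF: "(fvt x \<union> fvt v) \<inter> {5..10} = {} \<Longrightarrow> sigma0 (diagF x y v)"
  unfolding diagF_def bbetaF_def
  by (intro sigma0.intros(5,6) sigma0_Con sigma0_Dis sigma0.intros(1,2)) (auto simp: disjoint_iff)

lemma substt_pairT [simp]: "substt (pairT s t) x u = pairT (substt s x u) (substt t x u)"
  by (simp add: pairT_def)

lemma subst_diagF:
  "z \<notin> {5..10} \<Longrightarrow> subst (diagF x y v) z t = diagF (substt x z t) (substt y z t) (substt v z t)"
  unfolding diagF_def bbetaF_def by auto

lemma fv_diagF: "fv (diagF x y v) \<subseteq> fvt x \<union> fvt y \<union> fvt v"
  unfolding diagF_def bbetaF_def by auto

text \<open>The clause on \<open>Vr 3\<close> and \<open>Vr 4\<close> makes the value unique provably in Robinson arithmetic, which only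
  knows that the bound is comparable with every numeral.\<close>

definition diagonalF :: "trm \<Rightarrow> fm" where
  "diagonalF x = Exists 2 (Vr 0 \<^bold>\<le> Vr 2 \<^bold>\<and> diagF x (Vr 0) (Vr 2) \<^bold>\<and>
    BForall 3 (Vr 2) (BForall 4 (Vr 3) (diagF x (Vr 4) (Vr 3) \<^bold>\<rightarrow> Vr 4 \<^bold>= Vr 0)))"

text \<open>In the standard model the start and the recursion fix every entry up to the last,
  whatever \<open>c\<close>, \<open>d\<close> and the bound are.\<close>

lemma diagF_unique:
  assumes "sat e (diagF (num (gn \<theta>)) y v)" "(fvt y \<union> fvt v) \<inter> {5..10} = {}"
  shows "evalt e y = gn (Forall 1 (Vr 1 \<^bold>= num (gn \<theta>) \<^bold>\<rightarrow> \<theta>))"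
proof -
  let ?n = "gn \<theta>"
  from assms obtain c d where cd: "beta c d 0 = 0" "\<forall>i < ?n. beta c d (Suc i) = pair 2 (beta c d i)"
    "evalt e y = pair 9 (pair 1 (pair 8 (pair (pair 5 (pair (pair 1 1) (beta c d ?n))) ?n)))"
    by (auto simp: sat_diagF)
  have "beta c d i = gnt (num i)" if "i \<le> ?n" for i
    using that cd(1,2) by (induction i) (auto simp: pair_def)
  with cd(3) show ?thesis by simp
qed

lemma ex_diagF:
  obtains k where "sat e (diagF (num (gn \<theta>)) (num (gn (Forall 1 (Vr 1 \<^bold>= num (gn \<theta>) \<^bold>\<rightarrow> \<theta>)))) (num k))"
    "gn (Forall 1 (Vr 1 \<^bold>= num (gn \<theta>) \<^bold>\<rightarrow> \<theta>)) \<le> k"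
proof -
  let ?n = "gn \<theta>" and ?m = "gn (Forall 1 (Vr 1 \<^bold>= num (gn \<theta>) \<^bold>\<rightarrow> \<theta>))"
  define xs where "xs = map (\<lambda>i. gnt (num i)) [0..<Suc ?n]"
  obtain c d where "\<forall>i < length xs. beta c d i = xs ! i" using ex_beta by blast
  then have cd: "beta c d i = gnt (num i)" if "i \<le> ?n" for i
    using that by (simp add: xs_def del: upt_Suc)
  have "beta c d 0 = 0" using cd[of 0] by (simp add: pair_def)
  moreover have "\<forall>i < ?n. beta c d (Suc i) = pair 2 (beta c d i)" using cd by simp
  \<comment> \<open>The sum bounds \<open>c\<close>, \<open>d\<close> and the last entry as
    \<open>diagF\<close> demands, and the value \<open>?m\<close> as \<open>diagonalF\<close>
    demands.\<close>
  ultimately have "sat e (diagF (num ?n) (num ?m) (num (c + d + beta c d ?n + ?m)))"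
    using cd[of ?n] by (simp add: sat_diagF) (rule exI[of _ c], simp, rule exI[of _ d], simp)
  then show thesis using that by simp
qed

text \<open>Robinson arithmetic cannot exclude nonstandard bounds, so uniqueness is proved by
  comparing the bound with a standard \<open>k\<close> that already admits a computation of the
  right value.\<close>

lemma prv_diagonalF:
  fixes \<theta> :: fm
  assumes Q: "extends U Robinson_Q"
  defines "n \<equiv> gn \<theta>" and "m \<equiv> gn (Forall 1 (Vr 1 \<^bold>= num (gn \<theta>) \<^bold>\<rightarrow> \<theta>))"
  shows "U \<tturnstile> (diagonalF (num n) \<^bold>\<rightarrow> Vr 0 \<^bold>= num m)" and "U \<tturnstile> subst (diagonalF (num n)) 0 (num m)"
proof -
  fix e :: "nat \<Rightarrow> nat"
  obtain k where k: "sat e (diagF (num n) (num m) (num k))" "m \<le> k"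
    using ex_diagF unfolding n_def m_def by blast
  have unique: "evalt e y = m" if "sat e (diagF (num n) y v)" "(fvt y \<union> fvt v) \<inter> {5..10} = {}" for e y v
    using diagF_unique that unfolding n_def m_def by blast

  let ?S = "subst (diagonalF (num n)) 0 (num m)"
  have S: "?S = Exists 2 (num m \<^bold>\<le> Vr 2 \<^bold>\<and> diagF (num n) (num m) (Vr 2) \<^bold>\<and>
    BForall 3 (Vr 2) (BForall 4 (Vr 3) (diagF (num n) (Vr 4) (Vr 3) \<^bold>\<rightarrow> Vr 4 \<^bold>= num m)))"
    by (simp add: diagonalF_def subst_diagF)
  \<comment> \<open>Existence is a true Sigma_1 sentence: only \<open>Vr 2\<close> is quantified
    without a bound.\<close>
  have "sigma1 ?S" unfolding S
    by (intro sigma1.intros(4) sigma1.intros(1) sigma0_Con sigma0.intros(5) sigma0.intros(4) sigma0_diagF sigma0.intros(1,2)) auto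
  moreover have "sentence ?S" unfolding S sentence_def
    using fv_diagF[of "num n" "num m" "Vr 2"] fv_diagF[of "num n" "Vr 4" "Vr 3"] by auto
  moreover have "sat e ?S"
  proof -
    have "sat (e(2 := k)) (diagF (num n) (num m) (Vr 2))"
      using k(1) by (simp add: sat_diagF)
    moreover have "sat (e(2 := k)) (BForall 3 (Vr 2) (BForall 4 (Vr 3) (diagF (num n) (Vr 4) (Vr 3) \<^bold>\<rightarrow> Vr 4 \<^bold>= num m)))"
      using unique[of _ "Vr 4" "Vr 3"] by simp
    ultimately show ?thesis unfolding S sat_Exists sat_Con using k(2) by (intro exI[of _ k]) simp
  qed
  ultimately show "U \<tturnstile> ?S" by (rule sigma1_sentence_complete[OF Q])

  \<comment> \<open>Uniqueness for bounds up to \<open>k\<close> is a true Sigma_0 sentence. The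
    conjunct \<open>Vr 0 \<le> Vr 2\<close> of \<open>diagonalF\<close> is what permits
    \<open>Vr 0\<close> to be bounded here.\<close>
  let ?B = "BForall 2 (num k) (BForall 0 (Vr 2) (diagF (num n) (Vr 0) (Vr 2) \<^bold>\<rightarrow> Vr 0 \<^bold>= num m))"
  have B: "U \<tturnstile> ?B"
  proof (rule sigma1_sentence_complete[OF Q])
    show "sigma1 ?B"
      by (intro sigma1.intros(1) sigma0.intros(5) sigma0.intros(4) sigma0_diagF sigma0.intros(1)) auto
    show "sentence ?B" unfolding sentence_def using fv_diagF[of "num n" "Vr 0" "Vr 2"] by auto
    show "sat e ?B" using unique[of _ "Vr 0" "Vr 2"] by simp
  qed
  have diag: "U \<tturnstile> diagF (num n) (num m) (num k)"
  proof (rule sigma1_sentence_complete[OF Q _ _ k(1)])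
    show "sigma1 (diagF (num n) (num m) (num k))" by (intro sigma1.intros(1) sigma0_diagF) auto
    show "sentence (diagF (num n) (num m) (num k))"
      unfolding sentence_def using fv_diagF[of "num n" "num m" "num k"] by auto
  qed
  let ?D = "diagF (num n) (Vr 0) (Vr 2)"
  let ?C = "BForall 3 (Vr 2) (BForall 4 (Vr 3) (diagF (num n) (Vr 4) (Vr 3) \<^bold>\<rightarrow> Vr 4 \<^bold>= Vr 0))"
  have "derives U [diagonalF (num n)] (Vr 0 \<^bold>= num m)"
  proof (rule derives_exE)
    show "derives U [diagonalF (num n)] (Exists 2 (Vr 0 \<^bold>\<le> Vr 2 \<^bold>\<and> ?D \<^bold>\<and> ?C))"
      by (rule derives_hyp) (simp add: diagonalF_def)
    let ?\<Gamma> = "[Vr 0 \<^bold>\<le> Vr 2 \<^bold>\<and> ?D \<^bold>\<and> ?C, diagonalF (num n)]"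
    show "derives U ?\<Gamma> (Vr 0 \<^bold>= num m)"
    proof (rule derives_disjE[OF derives_Leq_num_linear[OF Q]])
      \<comment> \<open>A bound up to \<open>k\<close> falls under \<open>?B\<close>.\<close>
      let ?\<Delta> = "(Vr 2 \<^bold>\<le> num k) # ?\<Gamma>"
      have hyp: "derives U ?\<Delta> (Vr 0 \<^bold>\<le> Vr 2 \<^bold>\<and> ?D \<^bold>\<and> ?C)" and le: "derives U ?\<Delta> (Vr 2 \<^bold>\<le> num k)"
        by (rule derives_hyp, simp)+
      note D = derives_conjD1[OF derives_conjD2[OF hyp]]
      have "derives U ?\<Delta> (BForall 0 (Vr 2) (?D \<^bold>\<rightarrow> Vr 0 \<^bold>= num m))"
        by (rule derives_mp[OF _ le]) (use derives_allE[OF derives_prv[OF B], of "Vr 2" ?\<Delta>] in \<open>simp only: subst_Vr free_for_Vr\<close>)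
      from derives_allE[OF this, of "Vr 0"]
      have "derives U ?\<Delta> (Vr 0 \<^bold>\<le> Vr 2 \<^bold>\<rightarrow> ?D \<^bold>\<rightarrow> Vr 0 \<^bold>= num m)" by (simp only: subst_Vr free_for_Vr)
      from derives_mp[OF derives_mp[OF this derives_conjD1[OF hyp]] D]
      show "derives U ?\<Delta> (Vr 0 \<^bold>= num m)" .
    next
      \<comment> \<open>A larger bound sees the standard computation: the clause \<open>?C\<close>
        at \<open>k\<close> and \<open>m\<close> forces \<open>m\<close> to be the value.\<close>
      let ?\<Delta> = "(num k \<^bold>\<le> Vr 2) # ?\<Gamma>"
      have hyp: "derives U ?\<Delta> (Vr 0 \<^bold>\<le> Vr 2 \<^bold>\<and> ?D \<^bold>\<and> ?C)" and le: "derives U ?\<Delta> (num k \<^bold>\<le> Vr 2)"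
        by (rule derives_hyp, simp)+
      note C = derives_conjD2[OF derives_conjD2[OF hyp]]
      have "derives U ?\<Delta> (BForall 4 (num k) (diagF (num n) (Vr 4) (num k) \<^bold>\<rightarrow> Vr 4 \<^bold>= Vr 0))"
        by (rule derives_mp[OF _ le]) (use derives_allE[OF C, of "num k"] in \<open>simp add: subst_diagF\<close>)
      from derives_allE[OF this, of "num m"]
      have "derives U ?\<Delta> (num m \<^bold>\<le> num k \<^bold>\<rightarrow> diagF (num n) (num m) (num k) \<^bold>\<rightarrow> num m \<^bold>= Vr 0)"
        by (simp add: subst_diagF)
      from derives_mp[OF derives_mp[OF this derives_num_Leq[OF Q k(2)]] derives_prv[OF diag]]
      show "derives U ?\<Delta> (Vr 0 \<^bold>= num m)" by (rule derives_eq_sym)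
    qed
  qed (auto simp: diagonalF_def)
  from derives_impI[OF this] show "U \<tturnstile> (diagonalF (num n) \<^bold>\<rightarrow> Vr 0 \<^bold>= num m)" by simp
qed

theorem diagonal_lemma:
  assumes Q: "extends U Robinson_Q" and fv: "fv \<psi> \<subseteq> {0}"
  obtains G where "sentence G" "U \<tturnstile> (G \<^bold>\<leftrightarrow> subst \<psi> 0 \<ulcorner>G\<urcorner>)"
proof -
  define \<theta> where "\<theta> = Forall 0 (diagonalF (Vr 1) \<^bold>\<rightarrow> \<psi>)"
  \<comment> \<open>\<open>G\<close> is equivalent to \<open>\<theta>\<close> at its own code, but
    its code arises by pairing once the code of the numeral is known.\<close>
  define G where "G = Forall 1 (Vr 1 \<^bold>= num (gn \<theta>) \<^bold>\<rightarrow> \<theta>)"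
  let ?n = "num (gn \<theta>)" and ?m = "num (gn G)"
  let ?D = "diagonalF ?n"
  note D = prv_diagonalF[OF Q, of \<theta>, folded G_def]
  have "fv (diagonalF (Vr 1)) \<subseteq> {0, 1}"
    unfolding diagonalF_def using fv_diagF[of "Vr 1" "Vr 0" "Vr 2"] fv_diagF[of "Vr 1" "Vr 4" "Vr 3"] by auto
  then have G: "sentence G" using fv by (auto simp: sentence_def G_def \<theta>_def)
  have "subst \<psi> 1 ?n = \<psi>" by (rule subst_idle) (use fv in auto)
  then have \<theta>n: "subst \<theta> 1 ?n = Forall 0 (?D \<^bold>\<rightarrow> \<psi>)"
    by (simp add: \<theta>_def diagonalF_def subst_diagF)
  have closed: "fv (subst \<psi> 0 ?m) = {}" using fv_subst[of \<psi> 0 ?m] fv by auto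
  \<comment> \<open>This direction uses that the diagonal formula holds of the code of
    \<open>G\<close>.\<close>
  have "derives U [G] (subst \<psi> 0 ?m)"
  proof -
    have "derives U [G] G" by (rule derives_hyp) simp
    from derives_allE[OF this[unfolded G_def], of ?n, folded G_def]
    have "derives U [G] (?n \<^bold>= ?n \<^bold>\<rightarrow> Forall 0 (?D \<^bold>\<rightarrow> \<psi>))" by (simp add: \<theta>n[unfolded One_nat_def])
    from derives_allE[OF derives_mp[OF this derives_eq_refl], of ?m]
    have "derives U [G] (subst ?D 0 ?m \<^bold>\<rightarrow> subst \<psi> 0 ?m)" by simp
    from derives_mp[OF this derives_prv[OF D(2)]] show ?thesis .
  qed
  \<comment> \<open>The converse uses that the diagonal formula holds of nothing else.\<close>
  moreover have "derives U [subst \<psi> 0 ?m] G"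
  proof -
    have "derives U [?D, subst \<psi> 0 ?m] (?m \<^bold>= Vr 0)"
      by (rule derives_eq_sym[OF derives_mp[OF derives_prv[OF D(1)] derives_hyp]]) simp
    from derives_eq_subst[OF this derives_hyp, of \<psi> 0] have "derives U [?D, subst \<psi> 0 ?m] \<psi>" by simp
    from derives_allI[OF derives_impI[OF this], of 0] closed
    have \<theta>: "derives U [subst \<psi> 0 ?m] (subst \<theta> 1 ?n)" unfolding \<theta>n by simp
    have "derives U [Vr 1 \<^bold>= ?n, subst \<psi> 0 ?m] (?n \<^bold>= Vr 1)"
      by (rule derives_eq_sym[OF derives_hyp]) simp
    from derives_eq_subst[OF this derives_Cons[OF \<theta>]]
    have "derives U [Vr 1 \<^bold>= ?n, subst \<psi> 0 ?m] \<theta>" by simp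
    from derives_allI[OF derives_impI[OF this], of 1] closed show ?thesis by (simp add: G_def)
  qed
  ultimately have "derives U [] (G \<^bold>\<leftrightarrow> subst \<psi> 0 ?m)" by (rule derives_iffI)
  then show thesis using that[OF G] by (simp add: goedel_numeral_def)
qed

section \<open>The second incompleteness theorem\<close>

theorem mainTheorem1:
  fixes T :: "fm set" and \<tau> :: fm
  assumes "presents \<tau> T"
    and "consistent T"
    and "extends T Q_prime"
  shows "\<not> (T \<tturnstile> Consis \<tau>)"
proof
  assume con: "T \<tturnstile> Consis \<tau>"
  have \<tau>: "sigma1 \<tau>" "fv \<tau> \<subseteq> {0}" using assms(1) by (auto simp: presents_def)
  have Q: "extends T Robinson_Q" using assms(3) by (auto simp: extends_def Q_prime_def)
  have "fv (\<^bold>\<not> provableF \<tau>) \<subseteq> {0}" using fv_provableF[OF \<tau>(2)] by simp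
  from diagonal_lemma[OF Q this] obtain G where G: "sentence G" "T \<tturnstile> (G \<^bold>\<leftrightarrow> \<^bold>\<not> Pr \<tau> G)"
    by (auto simp: Pr_def)
  have D1: "T \<tturnstile> Pr \<tau> \<phi>" if "T \<tturnstile> \<phi>" "sentence \<phi>" for \<phi>
    using necessitation[OF assms(1) Q that] .
  have D2: "T \<tturnstile> (Pr \<tau> (\<phi> \<^bold>\<rightarrow> \<psi>) \<^bold>\<rightarrow> Pr \<tau> \<phi> \<^bold>\<rightarrow> Pr \<tau> \<psi>)" if "sentence \<phi>" "sentence \<psi>" for \<phi> \<psi>
    using assms(1,3) that unfolding extends_def Q_prime_def by blast
  have s: "sentence (Pr \<tau> G)" using sentence_Pr[OF \<tau>(2)] .
  \<comment> \<open>The third condition is taken for \<open>T\<close> itself, with the Sigma_1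
    sentence \<open>Pr \<tau> G\<close>.\<close>
  have "T \<tturnstile> (Pr \<tau> G \<^bold>\<rightarrow> Pr \<tau> (Pr \<tau> G))"
    using assms(1,3) Q s sigma1_Pr[OF \<tau>(1)] unfolding extends_def Q_prime_def by blast
  then have 1: "derives T [Pr \<tau> G] (Pr \<tau> (Pr \<tau> G))" by (simp add: derives.simps(2))

  \<comment> \<open>That \<open>G\<close> clashes with its own provability is a theorem of
    \<open>T\<close>; necessitation and the second condition then carry the clash inside
    \<open>Pr \<tau>\<close>.\<close>
  have "derives T [G, Pr \<tau> G] (\<^bold>\<not> Pr \<tau> G)" "derives T [G, Pr \<tau> G] (Pr \<tau> G)"
    by (rule derives_iffD1[OF derives_prv[OF G(2)] derives_hyp], simp, rule derives_hyp, simp)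
  from derives_explode[OF this(2,1), of "\<^bold>\<bottom>"]
  have "T \<tturnstile> (Pr \<tau> G \<^bold>\<rightarrow> G \<^bold>\<rightarrow> \<^bold>\<bottom>)" by (simp add: derives.simps(2))
  moreover have G': "sentence (G \<^bold>\<rightarrow> \<^bold>\<bottom>)" "sentence \<^bold>\<bottom>" using G(1) by (simp_all add: sentence_def)
  ultimately have "T \<tturnstile> Pr \<tau> (Pr \<tau> G \<^bold>\<rightarrow> G \<^bold>\<rightarrow> \<^bold>\<bottom>)" using D1 s by (simp add: sentence_def)
  from derives_mp[OF derives_mp[OF derives_prv[OF D2[OF s G'(1)]] derives_prv[OF this]] 1]
  have 2: "derives T [Pr \<tau> G] (Pr \<tau> (G \<^bold>\<rightarrow> \<^bold>\<bottom>))" .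
  from derives_mp[OF derives_mp[OF derives_prv[OF D2[OF G(1) G'(2)]] 2] derives_hyp]
  have "derives T [Pr \<tau> G] (Pr \<tau> \<^bold>\<bottom>)" by simp
  \<comment> \<open>Consistency thus refutes \<open>Pr \<tau> G\<close> inside \<open>T\<close>, and
    this refutation is \<open>G\<close> up to provable equivalence.\<close>
  from derives_notI[OF this derives_prv[OF con[unfolded Consis_def]]]
  have not_Pr: "derives T [] (\<^bold>\<not> Pr \<tau> G)" .
  from derives_iffD2[OF derives_prv[OF G(2)] this] have "T \<tturnstile> G" by simp
  \<comment> \<open>Necessitation for \<open>G\<close> proves exactly what was just refuted.\<close>
  from D1[OF this G(1)] not_Pr assms(2) show False by (auto simp: consistent_def)
qed

end
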